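(* Let $s\ge0$, let $k_1,\dots,k_{s+1}$ be positive integers, let $r_1,\dots,r_s\in\{\mathsf{u},\mathsf{d},\mathsf{o},\mathsf{c}\}$ with $r_1\cdots r_s$ weakly proper, let $e=E(r_1\cdots r_s)$, and let $0\le t_0<t_1<\cdots<t_{e+1}\le 1$ be real numbers such that $(k_1r_1\cdots k_sr_sk_{s+1};t_0,\dots,t_{e+1})$ is admissible. Then \[ \zeta(k_1r_1\cdots k_sr_sk_{s+1};t_0,\dots,t_{e+1})=J\big(\bullet\{\mathsf{u}\circ\}^{k_1-1}r_1\cdots\bullet\{\mathsf{u}\circ\}^{k_s-1}r_s\bullet\{\mathsf{u}\circ\}^{k_{s+1}-1};t_0,\dots,t_{e+1}\big). \]
   Context: Symbols and weights: $\mathsf{u},\mathsf{d},\mathsf{o},\mathsf{c}$ are formal symbols with $E(\mathsf{u})=E(\mathsf{d})=0$, $E(\mathsf{o})=1$, $E(\mathsf{c})=-1$, $E(r_1\cdots r_s)=\sum_i E(r_i)$. A sequence $r_1\cdots r_s$ is weakly proper if $E(r_1\cdots r_j)\ge0$ for all $1\le j\le s$. Lattice sets: for weakly proper $r_1\cdots r_s$, $L(r_1,\dots,r_s)=\{(x,y)\in\mathbb{Z}^2:1\le x\le s+1,\ y\in Y_x\}$ with $Y_1=\{0\}$ and, writing $Y^\pm=\{y\pm1:y\in Y\}$, $Y_{x+1}=Y_x^+,\ Y_x^-,\ Y_x^+\cup Y_x^-,\ Y_x^+\cap Y_x^-$ according as $r_x=\mathsf{u},\mathsf{d},\mathsf{o},\mathsf{c}$.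 The last column $\{y:(s+1,y)\in L\}$ has exactly $E(r_1\cdots r_s)+1$ elements $y_1<y_2<\cdots$. Determinants: for reals $a_1,\dots,a_{p+1}$ and nonnegative integers $n_1,\dots,n_p$, $F\binom{a_1,\dots,a_{p+1}}{n_1,\dots,n_p}$ is the $(p+1)\times(p+1)$ determinant whose first row is $(1,\dots,1)$ and whose $(i+1)$-st row is $(a_1^{n_i},\dots,a_{p+1}^{n_i})$. Admissibility and generalized zeta values: put $j=E(r_1\cdots r_s)+2$ and let $0\le t_1<\cdots<t_j\le1$ (indices shifted as convenient). $(k_1r_1\cdots k_sr_sk_{s+1};t_1,\dots,t_j)$ is admissible if $k_i>1$ for every $i$ with ($i=1$ or $r_{i-1}\in\{\mathsf{u},\mathsf{o}\}$) and (($i=s+1$ and $t_j=1$) or $r_i\in\{\mathsf{d},\mathsf{c}\}$). In that case, with $L=L(r_1,\dots,r_s)$ and $y_1<\dots<y_{j-1}$ the elements of its last column, \[ \zeta(k_1r_1\cdots k_sr_sk_{s+1};t_1,\dots,t_j)=\sum_{(m_p)_{p\in L}}F\binom{t_1,\dots,t_j}{m_{(s+1,y_1)},\dots,m_{(s+1,y_{j-1})}}\prod_{(x,y)\in L}\frac{1}{m_{(x,y)}^{k_x}}, \] summed over $(m_p)\in\mathbb{N}^L$ ($\mathbb{N}=\{1,2,\dots\}$) with $m_{(x,y)}<m_{(x+1,y+1)}$ whenever both points lie in $L$, and $m_{(x,y)}\ge m_{(x+1,y-1)}$ whenever both points lie in $L$. Labelled posets: for $d_1,\dots,d_{N+1}\in\{\circ,\bullet\}$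 and weakly proper $r_1\cdots r_N$, $P(d_1r_1\cdots d_Nr_Nd_{N+1})$ is $X=L(r_1,\dots,r_N)$ with the partial order generated by $(x,y)\le(x+1,y+1)$ and $(x+1,y-1)\le(x,y)$, and labelling $\delta_X(x,y)=d_x$. Let $\omega_\circ(t)=dt/t$, $\omega_\bullet(t)=dt/(1-t)$. The function $J$: with $m=E(r_1\cdots r_N)+2$ and reals $0\le u_1<\cdots<u_m\le1$, let $z_1<\cdots<z_{m-1}$ be the elements of $\{y:(N+1,y)\in X\}$ and define intervals $U_{(x,y)}=[0,1]$ for $1\le x\le N$ and $U_{(N+1,z_i)}=[u_i,u_{i+1}]$. Then \[ J(d_1r_1\cdots d_Nr_Nd_{N+1};u_1,\dots,u_m)=\int_{\Delta}\prod_{p\in X}\omega_{\delta_X(p)}(t_p),\quad \Delta=\Big\{(t_p)\in\prod_{p\in X}U_p: t_p<t_q\text{ whenever }p<q\Big\}. \] The word $\bullet\{\mathsf{u}\circ\}^{k_1-1}r_1\cdots$ means: $\{\mathsf{u}\circ\}^l$ is $l$ repetitions of $\mathsf{u}\circ$; this word alternates labels and symbols and its symbol sequence is $r_1\cdots r_s$ with extra $\mathsf{u}$'s inserted, so it has the same value of $E$. *)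

theory Defs
  imports "HOL-Analysis.Analysis" "Jordan_Normal_Form.Determinant"
begin

datatype sym = SU | SD | SO | SC

fun sym_weight :: "sym \<Rightarrow> int" where
  "sym_weight SU = 0"
| "sym_weight SD = 0"
| "sym_weight SO = 1"
| "sym_weight SC = - 1"

definition weight :: "sym list \<Rightarrow> int" where
  "weight rs = (\<Sum>r\<leftarrow>rs. sym_weight r)"

definition weakly_proper :: "sym list \<Rightarrow> bool" where
  "weakly_proper rs \<longleftrightarrow> (\<forall>j\<in>{1..length rs}. weight (take j rs) \<ge> 0)"

fun next_column :: "sym \<Rightarrow> int set \<Rightarrow> int set" where
  "next_column SU Y = (\<lambda>y. y + 1) ` Y"
| "next_column SD Y = (\<lambda>y. y - 1) ` Y"
| "next_column SO Y = (\<lambda>y. y + 1) ` Y \<union> (\<lambda>y. y - 1) ` Y"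
| "next_column SC Y = (\<lambda>y. y + 1) ` Y \<inter> (\<lambda>y. y - 1) ` Y"

text \<open>\<open>column rs x\<close> is the set \<open>Y\<^sub>x\<close>. Columns are numbered from 1 whereas list positions
  start at 0, so \<open>Y\<^sub>x\<close> is determined by the first \<open>x - 1\<close> symbols.\<close>

definition column :: "sym list \<Rightarrow> nat \<Rightarrow> int set" where
  "column rs x = fold next_column (take (x - 1) rs) {0}"

definition lattice :: "sym list \<Rightarrow> (nat \<times> int) set" where
  "lattice rs = {(x, y). 1 \<le> x \<and> x \<le> length rs + 1 \<and> y \<in> column rs x}"

definition last_column :: "sym list \<Rightarrow> int list" where
  "last_column rs = sorted_list_of_set (column rs (length rs + 1))"

text \<open>Intended for \<open>length as = length ns + 1\<close>.\<close>

definition gen_det :: "real list \<Rightarrow> nat list \<Rightarrow> real" where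
  "gen_det as ns =
     Determinant.det (Matrix.mat (length ns + 1) (length ns + 1)
       (\<lambda>(i, j). if i = 0 then 1 else (as ! j) ^ (ns ! (i - 1))))"

text \<open>In the next definition \<open>k\<^sub>i\<close> is \<open>ks ! (i - 1)\<close> and \<open>r\<^sub>i\<close> is \<open>rs ! (i - 1)\<close>.\<close>

definition admissible :: "nat list \<Rightarrow> sym list \<Rightarrow> real list \<Rightarrow> bool" where
  "admissible ks rs ts \<longleftrightarrow>
     (\<forall>i\<in>{1..length rs + 1}.
        (i = 1 \<or> rs ! (i - 2) \<in> {SU, SO}) \<and>
        (i = length rs + 1 \<and> last ts = 1 \<or> i \<le> length rs \<and> rs ! (i - 1) \<in> {SD, SC})
        \<longrightarrow> ks ! (i - 1) > 1)"

definition zeta_indices :: "sym list \<Rightarrow> (nat \<times> int \<Rightarrow> nat) set" where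
  "zeta_indices rs = {m \<in> lattice rs \<rightarrow>\<^sub>E {1..}.
     (\<forall>x y. (x, y) \<in> lattice rs \<and> (x + 1, y + 1) \<in> lattice rs \<longrightarrow> m (x, y) < m (x + 1, y + 1)) \<and>
     (\<forall>x y. (x, y) \<in> lattice rs \<and> (x + 1, y - 1) \<in> lattice rs \<longrightarrow> m (x, y) \<ge> m (x + 1, y - 1))}"

definition zeta_term ::
    "nat list \<Rightarrow> sym list \<Rightarrow> real list \<Rightarrow> (nat \<times> int \<Rightarrow> nat) \<Rightarrow> real" where
  "zeta_term ks rs ts m =
     gen_det ts (map (\<lambda>y. m (length rs + 1, y)) (last_column rs)) *
     (\<Prod>(x, y)\<in>lattice rs. 1 / real (m (x, y)) ^ (ks ! (x - 1)))"

text \<open>The value is 0 if the family is not summable; the same caveat applies to the integral \<open>J\<close>.\<close>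

definition zeta :: "nat list \<Rightarrow> sym list \<Rightarrow> real list \<Rightarrow> real" where
  "zeta ks rs ts = (\<Sum>\<^sub>\<infinity>m\<in>zeta_indices rs. zeta_term ks rs ts m)"

text \<open>A word \<open>d\<^sub>1 r\<^sub>1 \<dots> d\<^sub>N r\<^sub>N d\<^sub>N\<^sub>+\<^sub>1\<close> is a list of letters in which labels and symbols
  alternate; the data of the labelled poset only use its label and symbol subsequences.\<close>

datatype label = Circ | Bullet

datatype letter = Lab label | Sym sym

definition labels :: "letter list \<Rightarrow> label list" where
  "labels w = concat (map (case_letter (\<lambda>d. [d]) (\<lambda>r. [])) w)"

definition symbols :: "letter list \<Rightarrow> sym list" where
  "symbols w = concat (map (case_letter (\<lambda>d. []) (\<lambda>r. [r])) w)"

definition poset_gen :: "letter list \<Rightarrow> ((nat \<times> int) \<times> (nat \<times> int)) set" where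
  "poset_gen w =
     ({((x, y), (x + 1, y + 1)) | x y. True} \<union> {((x + 1, y - 1), (x, y)) | x y. True})
     \<inter> lattice (symbols w) \<times> lattice (symbols w)"

definition poset_less :: "letter list \<Rightarrow> nat \<times> int \<Rightarrow> nat \<times> int \<Rightarrow> bool" where
  "poset_less w p q \<longleftrightarrow> (p, q) \<in> (poset_gen w)\<^sup>* \<and> p \<noteq> q"

definition poset_label :: "letter list \<Rightarrow> nat \<times> int \<Rightarrow> label" where
  "poset_label w p = labels w ! (fst p - 1)"

text \<open>The densities of the two differential forms with respect to \<open>dt\<close>.\<close>

fun omega :: "label \<Rightarrow> real \<Rightarrow> real" where
  "omega Circ t = 1 / t"
| "omega Bullet t = 1 / (1 - t)"

text \<open>With 0-based lists, the interval attached to the point of the last column with ordinate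
  \<open>last_column _ ! i\<close> runs from \<open>us ! i\<close> to \<open>us ! (i + 1)\<close>.\<close>

definition J_domain :: "letter list \<Rightarrow> real list \<Rightarrow> (nat \<times> int \<Rightarrow> real) set" where
  "J_domain w us = {t \<in> lattice (symbols w) \<rightarrow>\<^sub>E UNIV.
     (\<forall>p\<in>lattice (symbols w). fst p \<le> length (symbols w) \<longrightarrow> t p \<in> {0..1}) \<and>
     (\<forall>i<length (last_column (symbols w)).
        t (length (symbols w) + 1, last_column (symbols w) ! i) \<in> {us ! i .. us ! (i + 1)}) \<and>
     (\<forall>p\<in>lattice (symbols w). \<forall>q\<in>lattice (symbols w). poset_less w p q \<longrightarrow> t p < t q)}"

abbreviation J_measure :: "letter list \<Rightarrow> (nat \<times> int \<Rightarrow> real) measure" where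
  "J_measure w \<equiv> (\<Pi>\<^sub>M p\<in>lattice (symbols w). lborel)"

definition J_integrand :: "letter list \<Rightarrow> (nat \<times> int \<Rightarrow> real) \<Rightarrow> real" where
  "J_integrand w t = (\<Prod>p\<in>lattice (symbols w). omega (poset_label w p) (t p))"

definition J :: "letter list \<Rightarrow> real list \<Rightarrow> real" where
  "J w us = (LINT t:J_domain w us|J_measure w. J_integrand w t)"

definition bullet_block :: "nat \<Rightarrow> letter list" where
  "bullet_block k = Lab Bullet # concat (replicate (k - 1) [Sym SU, Lab Circ])"

text \<open>Here \<open>length ks = length rs + 1\<close>; the last entry of \<open>ks\<close> is not followed by a symbol.\<close>

definition bullet_word :: "nat list \<Rightarrow> sym list \<Rightarrow> letter list" where
  "bullet_word ks rs =
     concat (map2 (\<lambda>k r. bullet_block k @ [Sym r]) (butlast ks) rs) @ bullet_block (last ks)"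

end

theory Submission imports Defs begin

text \<open>
  The points of a lattice set are ordered only between neighbouring columns, so the integral and
  the series are both computed one column at a time. Let \<open>\<Phi>(v)\<close> denote the integral over all columns
  before the current one, whose values \<open>v\<close> range over increasing sequences in \<open>(0, 1)\<close>, times the
  densities at \<open>v\<close>. By induction along the word,
  \<open>\<Phi>(v)\<close> is the sum over the indices \<open>m\<close> of a partial zeta sum times \<open>det (v\<^sub>j ^ (m\<^sub>i - 1))\<close>.
  Integrating this determinant over a box \<open>\<Prod> [a\<^sub>i, a\<^sub>i\<^sub>+\<^sub>1]\<close> yields the determinant \<open>F\<close> with nodes \<open>a\<close>
  and exponents \<open>0, m\<^sub>1, m\<^sub>2, \<dots>\<close>, divided by \<open>\<Prod> m\<^sub>i\<close>. A density \<open>1 / v\<close> lowers the exponents by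
  one again, which raises the current \<open>k\<close>, and the densities \<open>1 / (1 - v)\<close> expand as geometric
  series into a sum over the interlacing indices of the next column. All these determinants are nonnegative,
  so Tonelli's theorem applies throughout, and convergence only has to be checked for the series.
\<close>

section \<open>Determinants of functions of two indices\<close>

text \<open>What makes each step computable is that the order conditions decouple. For fixed values
  of a column, every value of the preceding column has an interval of its own; for fixed indices of
  a column, so has every index of the next one. A determinant whose columns depend on separate
  variables is summed or integrated entrywise. The index intervals are half open,
  \<open>M < k \<le> M'\<close>, which is why the zeta conditions mix a strict and a weak
  inequality: the geometric sum over such an interval is \<open>(v ^ M - v ^ M') / (1 - v)\<close>,
  and the numerators are differences of consecutive rows of the determinant produced by the
  preceding integration. The four symbols differ only in whether the next column has a point below,
  and a point above, all the old ones. A missing one is replaced by a node 0 or 1, whose matrix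
  column turns into a unit vector under these row differences, so the symbols are treated uniformly.
  Nonnegativity comes from the box integral itself, by induction on the size. Admissibility supplies
  convergence: it forces a large exponent at the points where an index can be maximal.\<close>

definition fdet :: "nat \<Rightarrow> (nat \<Rightarrow> nat \<Rightarrow> real) \<Rightarrow> real" where
  "fdet n f = Determinant.det (Matrix.mat n n (\<lambda>(i, j). f i j))"

lemma fdet_cong:
  assumes "\<And>i j. i < n \<Longrightarrow> j < n \<Longrightarrow> f i j = g i j"
  shows "fdet n f = fdet n g"
  unfolding fdet_def using assms by (intro arg_cong[where f = Determinant.det]) (auto intro!: eq_matI)

lemma fdet_leibniz:
  "fdet n f = (\<Sum>p | p permutes {..<n}. signof p * (\<Prod>i<n. f i (p i)))"
  unfolding fdet_def by (subst det_def'[of _ n])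
    (auto simp: lessThan_atLeast0 permutes_in_image intro!: sum.cong prod.cong)

lemma fdet_transpose: "fdet n (\<lambda>i j. f j i) = fdet n f"
proof -
  have "Matrix.mat n n (\<lambda>(i, j). f j i) = transpose_mat (Matrix.mat n n (\<lambda>(i, j). f i j))"
    by (auto intro!: eq_matI)
  then show ?thesis
    unfolding fdet_def by (metis det_transpose mat_carrier)
qed

lemma fdet_scale_rows: "fdet n (\<lambda>i j. c i * f i j) = (\<Prod>i<n. c i) * fdet n f"
  unfolding fdet_leibniz sum_distrib_left by (intro sum.cong) (auto simp: prod.distrib)

lemma fdet_scale_cols: "fdet n (\<lambda>i j. c j * f i j) = (\<Prod>i<n. c i) * fdet n f"
  using fdet_scale_rows[of n c "\<lambda>i j. f j i"] fdet_transpose[of n f]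
    fdet_transpose[of n "\<lambda>i j. c j * f i j"] by simp

lemma fdet_mult: "fdet n (\<lambda>i j. \<Sum>k<n. f i k * g k j) = fdet n f * fdet n g"
proof -
  have "Matrix.mat n n (\<lambda>(i, j). \<Sum>k<n. f i k * g k j) =
      Matrix.mat n n (\<lambda>(i, j). f i j) * Matrix.mat n n (\<lambda>(i, j). g i j)"
    by (auto intro!: eq_matI sum.cong simp: scalar_prod_def lessThan_atLeast0)
  then show ?thesis
    unfolding fdet_def by (metis det_mult mat_carrier)
qed

text \<open>The matrix \<open>T\<close> of the row operation is upper bidiagonal with ones on the
  diagonal, so its determinant is 1. The last row has no successor and is kept; this later matches a
  largest index without upper bound.\<close>

lemma fdet_row_diff_Suc:
  "fdet (Suc n) (\<lambda>i j. f i j - (if i < n then f (Suc i) j else 0)) = fdet (Suc n) f"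
proof -
  define T :: "nat \<Rightarrow> nat \<Rightarrow> real"
    where "T i k = (if k = i then 1 else if k = Suc i then - 1 else 0)" for i k
  have "fdet (Suc n) T = 1"
    unfolding fdet_def
    by (subst det_upper_triangular[of _ "Suc n"])
       (auto simp: T_def prod_list_diag_prod upper_triangular_def)
  moreover have "(\<Sum>k<Suc n. T i k * f k j) = f i j - (if i < n then f (Suc i) j else 0)"
    if "i < Suc n" for i j
  proof -
    have "(\<Sum>k<Suc n. T i k * f k j) =
        (\<Sum>k<Suc n. (if k = i then f k j else 0) + (if k = Suc i then - f k j else 0))"
      by (intro sum.cong) (auto simp: T_def)
    also have "\<dots> = f i j - (if i < n then f (Suc i) j else 0)"
      using that by (subst sum.distrib) (auto simp del: sum.lessThan_Suc)
    finally show ?thesis .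
  qed
  ultimately show ?thesis
    using fdet_mult[of "Suc n" T f]
      fdet_cong[of "Suc n" "\<lambda>i j. \<Sum>k<Suc n. T i k * f k j"
        "\<lambda>i j. f i j - (if i < n then f (Suc i) j else 0)"] by simp
qed

lemma fdet_row_diff_pred:
  "fdet n (\<lambda>i j. f i j - (if 0 < i then f (i - 1) j else 0)) = fdet n f"
proof -
  define T :: "nat \<Rightarrow> nat \<Rightarrow> real"
    where "T i k = (if k = i then 1 else if Suc k = i then - 1 else 0)" for i k
  have "fdet n T = 1"
    unfolding fdet_def
    by (subst det_lower_triangular[of n])
       (auto simp: T_def prod_list_diag_prod)
  moreover have "(\<Sum>k<n. T i k * f k j) = f i j - (if 0 < i then f (i - 1) j else 0)"
    if "i < n" for i j
  proof -
    have "(\<Sum>k<n. T i k * f k j) =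
        (\<Sum>k<n. (if k = i then f k j else 0) + (if k = i - 1 then if 0 < i then - f k j else 0 else 0))"
      by (intro sum.cong) (auto simp: T_def)
    also have "\<dots> = f i j - (if 0 < i then f (i - 1) j else 0)"
      using that by (subst sum.distrib) auto
    finally show ?thesis .
  qed
  ultimately show ?thesis
    using fdet_mult[of n T f]
      fdet_cong[of n "\<lambda>i j. \<Sum>k<n. T i k * f k j"
        "\<lambda>i j. f i j - (if 0 < i then f (i - 1) j else 0)"] by simp
qed

lemma fdet_col_diff_pred:
  "fdet n (\<lambda>i j. f i j - (if 0 < j then f i (j - 1) else 0)) = fdet n f"
  using fdet_row_diff_pred[of n "\<lambda>i j. f j i"] fdet_transpose[of n f]
    fdet_transpose[of n "\<lambda>i j. f i j - (if 0 < j then f i (j - 1) else 0)"] by simp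

lemma fdet_first_col_unit:
  assumes "f 0 0 = 1" "\<And>i. i < n \<Longrightarrow> f (Suc i) 0 = 0"
  shows "fdet (Suc n) f = fdet n (\<lambda>i j. f (Suc i) (Suc j))"
proof -
  let ?A = "Matrix.mat (Suc n) (Suc n) (\<lambda>(i, j). f i j)"
  have "Determinant.det ?A = (\<Sum>i<Suc n. ?A $$ (i, 0) * cofactor ?A i 0)"
    by (rule laplace_expansion_column) auto
  also have "\<dots> = (\<Sum>i<Suc n. if i = 0 then cofactor ?A i 0 else 0)"
  proof (intro sum.cong)
    fix i assume "i \<in> {..<Suc n}"
    then show "?A $$ (i, 0) * cofactor ?A i 0 = (if i = 0 then cofactor ?A i 0 else 0)"
      using assms by (cases i) auto
  qed auto
  also have "\<dots> = cofactor ?A 0 0" by (subst sum.delta) auto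
  also have "\<dots> = fdet n (\<lambda>i j. f (Suc i) (Suc j))"
    unfolding cofactor_def fdet_def mat_delete_def
    by (auto intro!: arg_cong[where f = Determinant.det] eq_matI)
  finally show ?thesis by (simp add: fdet_def)
qed

lemma fdet_first_row_unit:
  assumes "f 0 0 = 1" "\<And>i. i < n \<Longrightarrow> f 0 (Suc i) = 0"
  shows "fdet (Suc n) f = fdet n (\<lambda>i j. f (Suc i) (Suc j))"
  using fdet_first_col_unit[of "\<lambda>i j. f j i" n] assms
    fdet_transpose[of "Suc n" f] fdet_transpose[of n "\<lambda>i j. f (Suc i) (Suc j)"] by simp

lemma fdet_last_col_unit:
  assumes "f n n = 1" "\<And>i. i < n \<Longrightarrow> f i n = 0"
  shows "fdet (Suc n) f = fdet n f"
proof -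
  let ?A = "Matrix.mat (Suc n) (Suc n) (\<lambda>(i, j). f i j)"
  have "Determinant.det ?A = (\<Sum>i<Suc n. ?A $$ (i, n) * cofactor ?A i n)"
    by (rule laplace_expansion_column) auto
  also have "\<dots> = (\<Sum>i<Suc n. if i = n then cofactor ?A i n else 0)"
    using assms by (intro sum.cong) auto
  also have "\<dots> = cofactor ?A n n" by (subst sum.delta) auto
  also have "\<dots> = fdet n f"
    unfolding cofactor_def fdet_def mat_delete_def
    by (auto intro!: arg_cong[where f = Determinant.det] eq_matI)
  finally show ?thesis by (simp add: fdet_def)
qed

lemma fdet_0 [simp]: "fdet 0 f = 1"
  by (simp add: fdet_def)

text \<open>Each of the \<open>n!\<close> Leibniz terms takes one entry from every row, so bounds
  per row suffice.\<close>

lemma abs_fdet_le: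
  assumes "\<And>i j. i < n \<Longrightarrow> j < n \<Longrightarrow> \<bar>f i j\<bar> \<le> c i"
  shows "\<bar>fdet n f\<bar> \<le> fact n * (\<Prod>i<n. c i)"
proof -
  have "\<bar>fdet n f\<bar> \<le> (\<Sum>p | p permutes {..<n}. \<bar>signof p * (\<Prod>i<n. f i (p i))\<bar>)"
    unfolding fdet_leibniz by (rule sum_abs)
  also have "\<dots> \<le> (\<Sum>p | p permutes {..<n}. \<Prod>i<n. c i)"
  proof (intro sum_mono)
    fix p assume "p \<in> {p. p permutes {..<n}}"
    then have "p i < n" if "i < n" for i using that permutes_in_image[of p "{..<n}" i] by auto
    then have "(\<Prod>i<n. \<bar>f i (p i)\<bar>) \<le> (\<Prod>i<n. c i)"
      using assms by (intro prod_mono) auto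
    then show "\<bar>signof p * (\<Prod>i<n. f i (p i))\<bar> \<le> (\<Prod>i<n. c i)"
      by (simp add: abs_mult abs_prod sign_def)
  qed
  also have "\<dots> = fact n * (\<Prod>i<n. c i)"
    by (simp add: card_permutations)
  finally show ?thesis .
qed

text \<open>Column \<open>j\<close> depends only on \<open>u j\<close>, so every Leibniz term is a
  product of functions of separate variables. A general sigma-finite measure covers both Lebesgue
  measure and the counting measure on indices.\<close>

lemma (in sigma_finite_measure) has_integral_fdet:
  fixes f :: "nat \<Rightarrow> nat \<Rightarrow> 'a \<Rightarrow> real"
  assumes "\<And>i j. i < n \<Longrightarrow> j < n \<Longrightarrow> integrable M (f i j)"
  shows "integrable (\<Pi>\<^sub>M j\<in>{..<n}. M) (\<lambda>u. fdet n (\<lambda>i j. f i j (u j)))"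
    and "(\<integral>u. fdet n (\<lambda>i j. f i j (u j)) \<partial>(\<Pi>\<^sub>M j\<in>{..<n}. M)) =
      fdet n (\<lambda>i j. integral\<^sup>L M (f i j))"
proof -
  interpret product_sigma_finite "\<lambda>_::nat. M" by unfold_locales
  \<comment> \<open>Leibniz formula along columns, so that the factor indexed by \<open>j\<close>
    contains \<open>u j\<close> alone.\<close>
  have col: "fdet n g = (\<Sum>p | p permutes {..<n}. signof p * (\<Prod>j<n. g (p j) j))" for g
    using fdet_leibniz[of n "\<lambda>i j. g j i"] fdet_transpose[of n g] by simp
  have p: "p j < n" if "p permutes {..<n}" "j < n" for p j
    using permutes_in_image[OF that(1), of j] that by auto
  have int: "integrable (\<Pi>\<^sub>M j\<in>{..<n}. M) (\<lambda>u. \<Prod>j<n. f (p j) j (u j))" if "p permutes {..<n}" for p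
    using assms p[OF that] by (intro product_integrable_prod) auto
  show "integrable (\<Pi>\<^sub>M j\<in>{..<n}. M) (\<lambda>u. fdet n (\<lambda>i j. f i j (u j)))"
    unfolding col using int by (intro Bochner_Integration.integrable_sum) auto
  show "(\<integral>u. fdet n (\<lambda>i j. f i j (u j)) \<partial>(\<Pi>\<^sub>M j\<in>{..<n}. M)) =
      fdet n (\<lambda>i j. integral\<^sup>L M (f i j))"
    unfolding col
  proof (subst Bochner_Integration.integral_sum)
    show "(\<Sum>p | p permutes {..<n}. \<integral>u. signof p * (\<Prod>j<n. f (p j) j (u j)) \<partial>(\<Pi>\<^sub>M j\<in>{..<n}. M)) =
      (\<Sum>p | p permutes {..<n}. signof p * (\<Prod>j<n. integral\<^sup>L M (f (p j) j)))"
    proof (intro sum.cong refl)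
      fix q assume "q \<in> {p. p permutes {..<n}}"
      then have "(\<integral>u. (\<Prod>j<n. f (q j) j (u j)) \<partial>(\<Pi>\<^sub>M j\<in>{..<n}. M)) = (\<Prod>j<n. integral\<^sup>L M (f (q j) j))"
        using assms p[of q] by (intro product_integral_prod) auto
      then show "(\<integral>u. signof q * (\<Prod>j<n. f (q j) j (u j)) \<partial>(\<Pi>\<^sub>M j\<in>{..<n}. M)) =
          signof q * (\<Prod>j<n. integral\<^sup>L M (f (q j) j))" by simp
    qed
  qed (use int in auto)
qed

section \<open>Generalized Vandermonde determinants\<close>

definition gvdm :: "nat \<Rightarrow> (nat \<Rightarrow> real) \<Rightarrow> (nat \<Rightarrow> nat) \<Rightarrow> real" where
  "gvdm n a e = fdet n (\<lambda>i j. a j ^ e i)"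

lemma gvdm_cong:
  assumes "\<And>i. i < n \<Longrightarrow> a i = b i" "\<And>i. i < n \<Longrightarrow> d i = e i"
  shows "gvdm n a d = gvdm n b e"
  unfolding gvdm_def using assms by (intro fdet_cong) auto

lemma integral_power_open_interval:
  fixes a b :: real
  assumes "a \<le> b" "1 \<le> m"
  shows "integrable lborel (\<lambda>x. indicator {a<..<b} x * x ^ (m - 1))"
    and "(\<integral>x. indicator {a<..<b} x * x ^ (m - 1) \<partial>lborel) = (b ^ m - a ^ m) / real m"
proof -
  have ae: "AE x in lborel. indicator {a<..<b} x * x ^ (m - 1) = x ^ (m - 1) * indicator {a..b} x"
    using AE_lborel_singleton[of a] AE_lborel_singleton[of b]
    by eventually_elim (auto split: split_indicator)
  have meas: "(\<lambda>x::real. indicator {a<..<b} x * x ^ (m - 1)) \<in> borel_measurable lborel"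
    "(\<lambda>x::real. x ^ (m - 1) * indicator {a..b} x) \<in> borel_measurable lborel" by measurable
  have "integrable lborel (\<lambda>x::real. x ^ (m - 1) * indicator {a..b} x)"
    using borel_integrable_atLeastAtMost[of a b "\<lambda>x. x ^ (m - 1)"]
    by (simp add: mult.commute indicator_def if_distrib cong: if_cong)
  then show "integrable lborel (\<lambda>x. indicator {a<..<b} x * x ^ (m - 1))"
    using integrable_cong_AE[OF meas ae] by blast
  have "(\<integral>x. x ^ (m - 1) * indicator {a..b} x \<partial>lborel) = (b ^ m - a ^ m) / real m"
    using integral_power[OF assms(1), of "m - 1"] assms(2) by simp
  then show "(\<integral>x. indicator {a<..<b} x * x ^ (m - 1) \<partial>lborel) = (b ^ m - a ^ m) / real m"
    using integral_cong_AE[OF meas ae] by simp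
qed

lemma prod_indicator_eq_if:
  fixes n :: nat
  shows "(\<Prod>j<n. indicator (B j) (u j)) = (if \<forall>j<n. u j \<in> B j then 1 else (0::real))"
  by (induction n) (auto simp: less_Suc_eq)

text \<open>The indicator of the box splits into one factor per column and is absorbed into the
  entries, which then integrate to \<open>(a (Suc j) ^ m i - a j ^ m i) / m i\<close>. These are
  column differences of a matrix with an additional top row of ones, which
  \<open>case_nat 0 m\<close> encodes as exponent 0.\<close>

lemma gvdm_box:
  assumes "\<And>j. j < n \<Longrightarrow> a j \<le> a (Suc j)" "\<And>i. i < n \<Longrightarrow> 1 \<le> m i"
  shows "integrable (\<Pi>\<^sub>M j\<in>{..<n}. lborel)
      (\<lambda>u. if \<forall>j<n. a j < u j \<and> u j < a (Suc j) then gvdm n u (\<lambda>i. m i - 1) else 0)"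
    and "(\<integral>u. (if \<forall>j<n. a j < u j \<and> u j < a (Suc j) then gvdm n u (\<lambda>i. m i - 1) else 0)
        \<partial>(\<Pi>\<^sub>M j\<in>{..<n}. lborel)) =
      (\<Prod>i<n. 1 / real (m i)) * gvdm (Suc n) a (case_nat 0 m)"
proof -
  let ?g = "\<lambda>i j x. indicator {a j<..<a (Suc j)} x * x ^ (m i - 1) :: real"
  have eq: "(if \<forall>j<n. a j < u j \<and> u j < a (Suc j) then gvdm n u (\<lambda>i. m i - 1) else 0) =
      fdet n (\<lambda>i j. ?g i j (u j))" for u
  proof -
    define P where "P \<longleftrightarrow> (\<forall>j<n. u j \<in> {a j<..<a (Suc j)})"
    have "fdet n (\<lambda>i j. ?g i j (u j)) = (if P then 1 else 0) * fdet n (\<lambda>i j. u j ^ (m i - 1))"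
      unfolding P_def prod_indicator_eq_if[symmetric] by (rule fdet_scale_cols)
    moreover have "(\<forall>j<n. a j < u j \<and> u j < a (Suc j)) \<longleftrightarrow> P"
      by (simp add: P_def)
    ultimately show ?thesis
      by (simp add: gvdm_def)
  qed
  have int: "integrable lborel (?g i j)" if "i < n" "j < n" for i j
    using assms that by (intro integral_power_open_interval) auto
  show "integrable (\<Pi>\<^sub>M j\<in>{..<n}. lborel)
      (\<lambda>u. if \<forall>j<n. a j < u j \<and> u j < a (Suc j) then gvdm n u (\<lambda>i. m i - 1) else 0)"
    unfolding eq using int by (rule lborel.has_integral_fdet)
  let ?f = "\<lambda>i j. a j ^ case_nat 0 m i"
  have "(\<integral>u. fdet n (\<lambda>i j. ?g i j (u j)) \<partial>(\<Pi>\<^sub>M j\<in>{..<n}. lborel)) =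
      fdet n (\<lambda>i j. integral\<^sup>L lborel (?g i j))"
    using int by (rule lborel.has_integral_fdet)
  also have "\<dots> = fdet n (\<lambda>i j. (1 / real (m i)) * (a (Suc j) ^ m i - a j ^ m i))"
  proof (rule fdet_cong)
    fix i j assume "i < n" "j < n"
    then show "integral\<^sup>L lborel (?g i j) = (1 / real (m i)) * (a (Suc j) ^ m i - a j ^ m i)"
      using integral_power_open_interval(2)[of "a j" "a (Suc j)" "m i"] assms by simp
  qed
  also have "\<dots> = (\<Prod>i<n. 1 / real (m i)) * fdet n (\<lambda>i j. a (Suc j) ^ m i - a j ^ m i)"
    by (rule fdet_scale_rows)
  \<comment> \<open>Read from right to left: column differences turn the top row of ones into
    \<open>(1, 0, ..., 0)\<close>, and expansion along it leaves the differences.\<close>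
  also have "fdet n (\<lambda>i j. a (Suc j) ^ m i - a j ^ m i) =
      fdet (Suc n) (\<lambda>i j. ?f i j - (if 0 < j then ?f i (j - 1) else 0))"
    by (subst fdet_first_row_unit) auto
  also have "\<dots> = gvdm (Suc n) a (case_nat 0 m)"
    unfolding gvdm_def by (rule fdet_col_diff_pred)
  finally show "(\<integral>u. (if \<forall>j<n. a j < u j \<and> u j < a (Suc j) then gvdm n u (\<lambda>i. m i - 1) else 0)
        \<partial>(\<Pi>\<^sub>M j\<in>{..<n}. lborel)) =
      (\<Prod>i<n. 1 / real (m i)) * gvdm (Suc n) a (case_nat 0 m)"
    unfolding eq .
qed

text \<open>Taking \<open>a j ^ e 0\<close> out of each column makes the smallest exponent 0. By
  \<open>gvdm_box\<close> the remaining determinant is a positive multiple of the integral of a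
  smaller one over a box, whose points are again increasing because its intervals are
  consecutive.\<close>

lemma gvdm_nonneg:
  assumes "\<And>j. j < n \<Longrightarrow> 0 \<le> a j" "\<And>j. Suc j < n \<Longrightarrow> a j < a (Suc j)"
    "\<And>j. Suc j < n \<Longrightarrow> e j < e (Suc j)"
  shows "0 \<le> gvdm n a e"
  using assms
proof (induction n arbitrary: a e)
  case 0
  then show ?case by (simp add: gvdm_def)
next
  case (Suc n)
  define m where "m i = e (Suc i) - e 0" for i
  have less: "e 0 < e (Suc i)" if "i < n" for i
    using that by (induction i) (auto intro: Suc.prems(3) less_trans)
  have "e i = e 0 + case_nat 0 m i" if "i < Suc n" for i
    using that less[of "i - 1"] by (cases i) (auto simp: m_def)
  then have "gvdm (Suc n) a e = fdet (Suc n) (\<lambda>i j. a j ^ e 0 * a j ^ case_nat 0 m i)"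
    unfolding gvdm_def power_add[symmetric] by (intro fdet_cong) metis
  also have "\<dots> = (\<Prod>j<Suc n. a j ^ e 0) * gvdm (Suc n) a (case_nat 0 m)"
    unfolding gvdm_def by (rule fdet_scale_cols)
  finally have eq: "gvdm (Suc n) a e = (\<Prod>j<Suc n. a j ^ e 0) * gvdm (Suc n) a (case_nat 0 m)" .
  have m: "1 \<le> m i" if "i < n" for i
    using less[OF that] by (simp add: m_def)
  have "0 \<le> gvdm n u (\<lambda>i. m i - 1)" if u: "\<forall>j<n. a j < u j \<and> u j < a (Suc j)" for u
  proof (rule Suc.IH)
    show "0 \<le> u j" if "j < n" for j
      using u that Suc.prems(1)[of j] by force
    show "u j < u (Suc j)" if "Suc j < n" for j
      using u that by (meson Suc_lessD less_trans)
    show "m j - 1 < m (Suc j) - 1" if "Suc j < n" for j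
      using that Suc.prems(3)[of "Suc j"] less[of j] by (simp add: m_def)
  qed
  then have "0 \<le> (\<Prod>i<n. 1 / real (m i)) * gvdm (Suc n) a (case_nat 0 m)"
    using m Suc.prems(2) by (subst gvdm_box(2)[symmetric]) (auto intro!: integral_nonneg less_imp_le)
  moreover have "0 < (\<Prod>i<n. 1 / real (m i))"
    using m by (intro prod_pos) (auto simp: Suc_le_eq)
  ultimately have "0 \<le> gvdm (Suc n) a (case_nat 0 m)"
    by (simp add: zero_le_mult_iff)
  moreover have "0 \<le> (\<Prod>j<Suc n. a j ^ e 0)"
    using Suc.prems(1) by (intro prod_nonneg) auto
  ultimately show ?case
    unfolding eq by simp
qed

lemma gvdm_case_nat_nonneg:
  assumes "\<And>j. j \<le> n \<Longrightarrow> 0 \<le> a j" "\<And>j. j < n \<Longrightarrow> a j < a (Suc j)"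
    "\<And>i. i < n \<Longrightarrow> 1 \<le> m i" "\<And>i. Suc i < n \<Longrightarrow> m i < m (Suc i)"
  shows "0 \<le> gvdm (Suc n) a (case_nat 0 m)"
  using assms by (intro gvdm_nonneg) (fastforce split: nat.split)+

lemma nn_integral_gvdm_box:
  assumes "\<And>j. j \<le> n \<Longrightarrow> 0 \<le> a j" "\<And>j. j < n \<Longrightarrow> a j < a (Suc j)"
    "\<And>i. i < n \<Longrightarrow> 1 \<le> m i" "\<And>i. Suc i < n \<Longrightarrow> m i < m (Suc i)"
  shows "(\<integral>\<^sup>+u. (if \<forall>j<n. a j < u j \<and> u j < a (Suc j) then ennreal (gvdm n u (\<lambda>i. m i - 1)) else 0)
        \<partial>(\<Pi>\<^sub>M j\<in>{..<n}. lborel)) =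
      (\<Prod>i<n. ennreal (1 / real (m i))) * ennreal (gvdm (Suc n) a (case_nat 0 m))"
proof -
  let ?f = "\<lambda>u. if \<forall>j<n. a j < u j \<and> u j < a (Suc j) then gvdm n u (\<lambda>i. m i - 1) else 0"
  have "0 \<le> ?f u" for u
  proof -
    have "0 \<le> gvdm n u (\<lambda>i. m i - 1)" if u: "\<forall>j<n. a j < u j \<and> u j < a (Suc j)"
    proof (rule gvdm_nonneg)
      show "0 \<le> u j" if "j < n" for j
        using u that assms(1)[of j] by force
      show "u j < u (Suc j)" if "Suc j < n" for j
        using u that by (meson Suc_lessD less_trans)
      show "m j - 1 < m (Suc j) - 1" if "Suc j < n" for j
        using that assms(3)[of j] assms(4)[of j] by simp
    qed
    then show ?thesis by simp
  qed
  then have "(\<integral>\<^sup>+u. ennreal (?f u) \<partial>(\<Pi>\<^sub>M j\<in>{..<n}. lborel)) =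
      ennreal ((\<Prod>i<n. 1 / real (m i)) * gvdm (Suc n) a (case_nat 0 m))"
    using assms by (subst nn_integral_eq_integral[OF gvdm_box(1)])
      (auto simp: gvdm_box(2) less_imp_le)
  also have "\<dots> = (\<Prod>i<n. ennreal (1 / real (m i))) * ennreal (gvdm (Suc n) a (case_nat 0 m))"
    using gvdm_case_nat_nonneg[of n a m] assms
    by (simp add: prod_ennreal prod_nonneg ennreal_mult)
  finally show ?thesis
    by (simp add: if_distrib cong: if_cong)
qed

text \<open>The values \<open>u\<close> of a column lie between consecutive values \<open>v\<close> of the next one, where \<open>v\<close> is
  extended by 0 in front if \<open>low r = 1\<close> and by 1 at the end if \<open>high r = 1\<close>.\<close>

definition low :: "sym \<Rightarrow> nat" where
  "low r = (case r of SU \<Rightarrow> 1 | SC \<Rightarrow> 1 | _ \<Rightarrow> 0)"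

definition high :: "sym \<Rightarrow> nat" where
  "high r = (case r of SD \<Rightarrow> 1 | SC \<Rightarrow> 1 | _ \<Rightarrow> 0)"

definition extend :: "nat \<Rightarrow> nat \<Rightarrow> (nat \<Rightarrow> real) \<Rightarrow> nat \<Rightarrow> real" where
  "extend l n v j = (if j < l then 0 else if j - l < n then v (j - l) else 1)"

text \<open>Generic in the two relations: the integral uses \<open>(<)\<close> twice, the summation
  indices \<open>(<)\<close> upwards and \<open>(\<le>)\<close> downwards. The guard
  \<open>l \<le> i\<close> keeps the truncated subtraction \<open>i - l\<close> from pointing at a
  neighbour that does not exist.\<close>

definition interlaced ::
    "('a \<Rightarrow> 'a \<Rightarrow> bool) \<Rightarrow> ('a \<Rightarrow> 'a \<Rightarrow> bool) \<Rightarrow> nat \<Rightarrow> nat \<Rightarrow> nat \<Rightarrow> (nat \<Rightarrow> 'a) \<Rightarrow> (nat \<Rightarrow> 'a) \<Rightarrow> bool" where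
  "interlaced up down l n n' u v \<longleftrightarrow> (\<forall>i<n. (l \<le> i \<and> i - l < n' \<longrightarrow> down (v (i - l)) (u i)) \<and>
     (i + 1 - l < n' \<longrightarrow> up (u i) (v (i + 1 - l))))"

section \<open>Geometric sums over interlacing indices\<close>

lemma sums_geometric_tail:
  fixes v :: real
  assumes "0 < v" "v < 1"
  shows "(\<lambda>x. indicator {a<..} x * v ^ (x - 1)) sums (v ^ a / (1 - v))"
proof -
  have "(\<lambda>x. v ^ a * v ^ x) sums (v ^ a * (1 / (1 - v)))"
    using assms by (intro sums_mult geometric_sums) auto
  then have "(\<lambda>x. indicator {a<..} (x + Suc a) * v ^ (x + Suc a - 1)) sums (v ^ a / (1 - v))"
    by (simp add: power_add mult.commute)
  then show ?thesis
    by (subst (asm) sums_iff_shift) simp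
qed

text \<open>The sum is a difference of two geometric tails. The flag \<open>c\<close> tells whether
  the range has an upper bound, so that the unbounded interval of a largest index is covered
  too.\<close>

lemma integral_count_space_geometric:
  fixes v :: real
  assumes v: "0 < v" "v < 1" and "c \<Longrightarrow> a \<le> b"
  shows "integrable (count_space UNIV) (\<lambda>x. indicator {x. a < x \<and> (c \<longrightarrow> x \<le> b)} x * v ^ (x - 1))"
    and "(\<integral>x. indicator {x. a < x \<and> (c \<longrightarrow> x \<le> b)} x * v ^ (x - 1) \<partial>count_space UNIV) =
      (v ^ a - (if c then v ^ b else 0)) / (1 - v)"
proof -
  let ?f = "\<lambda>x. indicator {x. a < x \<and> (c \<longrightarrow> x \<le> b)} x * v ^ (x - 1)"
  have "(\<lambda>x. indicator {a<..} x * v ^ (x - 1) - (if c then indicator {b<..} x * v ^ (x - 1) else 0)) sums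
      (v ^ a / (1 - v) - (if c then v ^ b / (1 - v) else 0))"
    using sums_geometric_tail[OF v, of b] sums_zero
    by (intro sums_diff sums_geometric_tail v) (simp split: if_split)
  also have "(\<lambda>x. indicator {a<..} x * v ^ (x - 1) - (if c then indicator {b<..} x * v ^ (x - 1) else 0)) = ?f"
    using assms(3) by (auto simp: fun_eq_iff split: split_indicator)
  finally have sums: "?f sums ((v ^ a - (if c then v ^ b else 0)) / (1 - v))"
    by (simp add: diff_divide_distrib split: if_splits)
  have "norm (?f x) = ?f x" for x using v by (simp add: abs_mult)
  then show int: "integrable (count_space UNIV) ?f"
    using sums by (simp add: integrable_count_space_nat_iff sums_iff)
  show "(\<integral>x. ?f x \<partial>count_space UNIV) = (v ^ a - (if c then v ^ b else 0)) / (1 - v)"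
    using integral_count_space_nat[OF int] sums by (simp add: sums_iff)
qed

text \<open>Each row is replaced by its difference with the next one. The column of a node 0 becomes
  the first unit vector, because \<open>0 ^ 0 = 1\<close> and all other exponents are positive; the
  column of a node 1 becomes the last unit vector, because its entries cancel except in the last
  row. Expansion along them leaves the nodes \<open>v\<close>.\<close>

lemma gvdm_extend:
  fixes v :: "nat \<Rightarrow> real"
  assumes n': "n' + low r + high r = Suc n"
    and m: "\<And>i. i < n \<Longrightarrow> 1 \<le> m i"
  defines "M \<equiv> case_nat 0 m" and "w \<equiv> extend (low r) n' v"
  shows "gvdm (Suc n) w M = fdet n' (\<lambda>i j. v j ^ M (i + low r) -
      (if i + low r < n then v j ^ M (Suc (i + low r)) else 0))"
proof -
  define D where "D i j = w j ^ M i - (if i < n then w j ^ M (Suc i) else 0)" for i j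
  have w: "w (j + low r) = v j" if "j < n'" for j
    using that by (simp add: w_def extend_def)
  have M: "0 ^ M (Suc i) = (0 :: real)" if "i < n" for i
    using m[OF that] by (simp add: M_def)
  have M0: "M 0 = 0"
    by (simp add: M_def)
  have low01: "low r = 0 \<or> low r = 1" and high01: "high r = 0 \<or> high r = 1"
    by (auto simp: low_def high_def split: sym.splits)
  have first: "fdet (Suc n) D = fdet n (\<lambda>i j. D (Suc i) (Suc j))" if "low r = 1"
  proof (rule fdet_first_col_unit)
    have "w 0 = 0" using that by (simp add: w_def extend_def)
    then show "D 0 0 = 1"
      using M[of 0] by (simp add: D_def M0)
    show "D (Suc i) 0 = 0" if "i < n" for i
      using \<open>w 0 = 0\<close> that M[of i] M[of "Suc i"]
      by (cases "Suc i < n") (auto simp: D_def power_0_left)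
  qed
  have last: "D n n = 1" "i < n \<Longrightarrow> D i n = 0" if "high r = 1" for i
  proof -
    have "w n = 1" using that n' by (auto simp: w_def extend_def)
    then show "D n n = 1" "i < n \<Longrightarrow> D i n = 0" by (auto simp: D_def)
  qed
  have "gvdm (Suc n) w M = fdet (Suc n) D"
    unfolding gvdm_def D_def by (rule fdet_row_diff_Suc[symmetric])
  also have "\<dots> = fdet n' (\<lambda>i j. D (i + low r) (j + low r))"
  proof (cases "high r = 0")
    case True
    then show ?thesis using low01 n' first by auto
  next
    case False
    then have h: "high r = 1" using high01 by simp
    show ?thesis
    proof (cases "low r = 0")
      case True
      then show ?thesis using n' h last by (simp add: fdet_last_col_unit)
    next
      case False
      then have l: "low r = 1" using low01 by simp
      then have n: "n = Suc n'" using n' h by simp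
      show ?thesis
        using first[OF l] last[OF h] by (simp add: l n fdet_last_col_unit)
    qed
  qed
  also have "\<dots> = fdet n' (\<lambda>i j. v j ^ M (i + low r) -
      (if i + low r < n then v j ^ M (Suc (i + low r)) else 0))"
    by (intro fdet_cong) (simp add: D_def w)
  finally show ?thesis .
qed

text \<open>For given \<open>m\<close> the conditions on \<open>k\<close> decouple:
  \<open>k i\<close> exceeds \<open>M (i + l)\<close> and is at most \<open>M (i + l + 1)\<close> if
  that entry exists. Summing the determinant therefore means summing each entry, a geometric sum
  whose numerator is a row difference, and \<open>gvdm_extend\<close> recognizes the result.\<close>

lemma nn_integral_gvdm_interlaced:
  assumes n': "n' + low r + high r = Suc n"
    and v: "\<And>j. j < n' \<Longrightarrow> 0 < v j \<and> v j < 1" "\<And>j. Suc j < n' \<Longrightarrow> v j < v (Suc j)"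
    and m: "\<And>i. i < n \<Longrightarrow> 1 \<le> m i" "\<And>i. Suc i < n \<Longrightarrow> m i < m (Suc i)"
  shows "(\<integral>\<^sup>+k. (if interlaced (<) (\<le>) (low r) n n' m k \<and> (\<forall>i<n'. 1 \<le> k i)
          then ennreal (gvdm n' v (\<lambda>i. k i - 1)) else 0) \<partial>count_space (\<Pi>\<^sub>E i\<in>{..<n'}. UNIV)) =
      ennreal ((\<Prod>j<n'. 1 / (1 - v j)) * gvdm (Suc n) (extend (low r) n' v) (case_nat 0 m))"
proof -
  \<comment> \<open>The prepended 0 expresses positivity of an index with no neighbour below it as a
    lower bound of the common form.\<close>
  define M where "M = case_nat 0 m"
  define l where "l = low r"
  have l01: "l = 0 \<or> l = 1" and h01: "high r = 0 \<or> high r = 1"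
    by (auto simp: low_def l_def high_def split: sym.splits)
  define I where "I i = {x. M (i + l) < x \<and> (i + l < n \<longrightarrow> x \<le> M (Suc (i + l)))}" for i
  have inter: "interlaced (<) (\<le>) l n n' m k \<and> (\<forall>i<n'. 1 \<le> k i) \<longleftrightarrow> (\<forall>i<n'. k i \<in> I i)" (is "?A \<longleftrightarrow> ?B")
    for k
  proof
    assume A: ?A
    show ?B
    proof (intro allI impI)
      fix i assume i: "i < n'"
      have "M (i + l) < k i"
      proof (cases "i + l")
        case 0
        then show ?thesis using A i by (auto simp: M_def Suc_le_eq)
      next
        case (Suc j)
        then have "j < n" using i n' l_def by simp
        moreover have "j + 1 - l = i" using Suc l01 by auto
        ultimately show ?thesis using A i Suc by (auto simp: interlaced_def M_def)
      qed
      moreover have "k i \<le> M (Suc (i + l))" if "i + l < n"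
      proof -
        have "l \<le> i + l \<and> i + l - l < n' \<longrightarrow> k (i + l - l) \<le> m (i + l)"
          using A that unfolding interlaced_def by blast
        then show ?thesis using i by (simp add: M_def)
      qed
      ultimately show "k i \<in> I i" by (simp add: I_def)
    qed
  next
    assume B: ?B
    have "k (i - l) \<le> m i" if "i < n" "l \<le> i" "i - l < n'" for i
      using B[rule_format, OF that(3)] that(1,2) by (simp add: I_def M_def)
    moreover have "m i < k (i + 1 - l)" if "i < n" "i + 1 - l < n'" for i
      using B[rule_format, OF that(2)] l01 by (auto simp: I_def M_def)
    moreover have "1 \<le> k i" if "i < n'" for i
      using B[rule_format, OF that] by (simp add: I_def)
    ultimately show ?A by (auto simp: interlaced_def)
  qed
  let ?g = "\<lambda>i j x. indicator (I j) x * v i ^ (x - 1) :: real"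
  have Mle: "M (j + l) \<le> M (Suc (j + l))" if "j + l < n" for j
    using m that by (cases "j + l") (auto simp: M_def less_imp_le)
  have int: "integrable (count_space UNIV) (?g i j)"
    and val: "(\<integral>x. ?g i j x \<partial>count_space UNIV) = (1 / (1 - v i)) *
      (v i ^ M (j + l) - (if j + l < n then v i ^ M (Suc (j + l)) else 0))" if "i < n'" "j < n'" for i j
    using integral_count_space_geometric[of "v i" "j + l < n" "M (j + l)" "M (Suc (j + l))"] v(1)[OF that(1)] Mle
    by (simp_all add: I_def)
  interpret C: sigma_finite_measure "count_space (UNIV :: nat set)"
    by (rule sigma_finite_measure_count_space)
  \<comment> \<open>The variables \<open>k j\<close> must sit in columns to be summed separately,
    whereas in \<open>gvdm\<close> the exponents index rows; hence the transposition.\<close>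
  have eq: "(if \<forall>i<n'. k i \<in> I i then gvdm n' v (\<lambda>i. k i - 1) else 0) = fdet n' (\<lambda>i j. ?g i j (k j))" for k
  proof -
    have "fdet n' (\<lambda>i j. ?g i j (k j)) =
        (if \<forall>i<n'. k i \<in> I i then 1 else 0) * fdet n' (\<lambda>i j. v i ^ (k j - 1))"
      unfolding prod_indicator_eq_if[symmetric] by (rule fdet_scale_cols)
    also have "fdet n' (\<lambda>i j. v i ^ (k j - 1)) = gvdm n' v (\<lambda>i. k i - 1)"
      unfolding gvdm_def by (rule fdet_transpose)
    also have "(if P then 1 else 0) * x = (if P then x else 0)" for P and x :: real
      by simp
    finally show ?thesis by (rule sym)
  qed
  \<comment> \<open>The intervals are consecutive and half open, so every \<open>k\<close> in them
    is strictly increasing. Nonnegativity then permits evaluating the sum as a Bochner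
    integral.\<close>
  have nonneg: "0 \<le> (if \<forall>i<n'. k i \<in> I i then gvdm n' v (\<lambda>i. k i - 1) else 0)" for k
  proof (cases "\<forall>i<n'. k i \<in> I i")
    case True
    have "0 \<le> gvdm n' v (\<lambda>i. k i - 1)"
    proof (rule gvdm_nonneg)
      fix j assume j: "Suc j < n'"
      then have "j + l < n" using n' h01 by (auto simp: l_def)
      then have "k j \<le> M (Suc (j + l))" "M (Suc (j + l)) < k (Suc j)"
        using True[rule_format, of j] True[rule_format, of "Suc j"] j by (auto simp: I_def)
      moreover have "0 < k j" using True[rule_format, of j] j by (simp add: I_def)
      ultimately show "k j - 1 < k (Suc j) - 1" by simp
    qed (use v in \<open>auto simp: less_imp_le\<close>)
    then show ?thesis by simp
  next
    case False
    then show ?thesis by (simp only: if_False order_refl)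
  qed
  have "(\<integral>\<^sup>+k. (if interlaced (<) (\<le>) (low r) n n' m k \<and> (\<forall>i<n'. 1 \<le> k i)
          then ennreal (gvdm n' v (\<lambda>i. k i - 1)) else 0) \<partial>count_space (\<Pi>\<^sub>E i\<in>{..<n'}. UNIV)) =
      (\<integral>\<^sup>+k. ennreal (fdet n' (\<lambda>i j. ?g i j (k j))) \<partial>count_space (\<Pi>\<^sub>E i\<in>{..<n'}. UNIV))"
    unfolding inter[unfolded l_def] eq[symmetric] by (simp only: if_distrib[of ennreal] ennreal_0)
  also have "\<dots> = (\<integral>\<^sup>+k. ennreal (fdet n' (\<lambda>i j. ?g i j (k j))) \<partial>(\<Pi>\<^sub>M i\<in>{..<n'}. count_space UNIV))"
    by (subst count_space_PiM_finite) auto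
  also have "(\<integral>\<^sup>+k. ennreal (fdet n' (\<lambda>i j. ?g i j (k j))) \<partial>(\<Pi>\<^sub>M i\<in>{..<n'}. count_space UNIV)) =
      ennreal (\<integral>k. fdet n' (\<lambda>i j. ?g i j (k j)) \<partial>(\<Pi>\<^sub>M i\<in>{..<n'}. count_space UNIV))"
    using int nonneg unfolding eq by (intro nn_integral_eq_integral C.has_integral_fdet) auto
  also have "(\<integral>k. fdet n' (\<lambda>i j. ?g i j (k j)) \<partial>(\<Pi>\<^sub>M i\<in>{..<n'}. count_space UNIV)) =
      fdet n' (\<lambda>i j. integral\<^sup>L (count_space UNIV) (?g i j))"
    using int by (rule C.has_integral_fdet)
  also have "\<dots> = fdet n' (\<lambda>i j. (1 / (1 - v i)) *
      (v i ^ M (j + l) - (if j + l < n then v i ^ M (Suc (j + l)) else 0)))"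
    using val by (rule fdet_cong)
  also have "\<dots> = (\<Prod>j<n'. 1 / (1 - v j)) *
      fdet n' (\<lambda>i j. v i ^ M (j + l) - (if j + l < n then v i ^ M (Suc (j + l)) else 0))"
    by (rule fdet_scale_rows)
  also have "fdet n' (\<lambda>i j. v i ^ M (j + l) - (if j + l < n then v i ^ M (Suc (j + l)) else 0)) =
      gvdm (Suc n) (extend (low r) n' v) (case_nat 0 m)"
    unfolding l_def M_def by (rule trans[OF fdet_transpose gvdm_extend[OF n' m(1), symmetric]])
  finally show ?thesis .
qed

section \<open>Columns of the lattice\<close>

definition ncol :: "sym list \<Rightarrow> nat" where
  "ncol rs = nat (weight rs + 1)"

text \<open>The lowest ordinate of the last column: a symbol moves it down by 1 if it creates a
  point below the lowest one, and up by 1 if not (\<open>low r = 1\<close>). Every column is an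
  arithmetic progression with difference 2 starting there.\<close>

definition base :: "sym list \<Rightarrow> int" where
  "base rs = (\<Sum>r\<leftarrow>rs. 2 * int (low r) - 1)"

definition pt :: "sym list \<Rightarrow> nat \<Rightarrow> nat \<times> int" where
  "pt rs j = (Suc (length rs), base rs + 2 * int j)"

lemma weight_snoc [simp]: "weight (rs @ [r]) = weight rs + sym_weight r"
  by (simp add: weight_def)

lemma weight_Nil [simp]: "weight [] = 0"
  by (simp add: weight_def)

lemma weight_rev [simp]: "weight (rev rs) = weight rs"
  by (simp add: weight_def rev_map[symmetric] sum_list_rev)

lemma ncol_rev [simp]: "ncol (rev rs) = ncol rs"
  by (simp add: ncol_def)

lemma ncol_Nil [simp]: "ncol [] = 1"
  by (simp add: ncol_def)

lemma ncol_Cons_rev [simp]: "ncol (r # rev rs) = ncol (rs @ [r])"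
  using ncol_rev[of "rs @ [r]"] by simp

lemma weakly_proper_Nil [simp]: "weakly_proper []"
  by (simp add: weakly_proper_def)

lemma weakly_proper_weight: "weakly_proper rs \<Longrightarrow> 0 \<le> weight rs"
  by (cases rs) (auto simp: weakly_proper_def dest!: bspec[where x = "length rs"])

lemma weakly_proper_snoc:
  "weakly_proper (rs @ [r]) \<longleftrightarrow> weakly_proper rs \<and> 0 \<le> weight (rs @ [r])"
proof -
  have "{1..length (rs @ [r])} = insert (length (rs @ [r])) {1..length rs}" by auto
  then show ?thesis by (auto simp: weakly_proper_def simp del: weight_snoc)
qed

text \<open>A column of \<open>n\<close> points has \<open>n + 1\<close> gaps, counting the two
  outer ones. The next column has one point in each, except in the lowest if
  \<open>low r = 1\<close> and in the highest if \<open>high r = 1\<close>.\<close>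

lemma ncol_snoc:
  assumes "weakly_proper (rs @ [r])"
  shows "ncol (rs @ [r]) + low r + high r = Suc (ncol rs)"
  using assms weakly_proper_weight[of rs]
  by (cases r) (auto simp: weakly_proper_snoc ncol_def low_def high_def)

lemma ncol_pos: "weakly_proper rs \<Longrightarrow> 0 < ncol rs"
  using weakly_proper_weight[of rs] by (simp add: ncol_def)

lemma next_column_progression:
  assumes "n' + low r + high r = Suc n" "0 < n" "0 < n'"
  shows "next_column r ((\<lambda>j. b + 2 * int j) ` {..<n}) =
    (\<lambda>j. b + (2 * int (low r) - 1) + 2 * int j) ` {..<n'}"
proof -
  have up: "(\<lambda>y. y + 1) ` (\<lambda>j. b + 2 * int j) ` {..<n} = (\<lambda>j. b + 1 + 2 * int j) ` {..<n}"
    by (auto simp: image_iff)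
  have down: "(\<lambda>y. y - 1) ` (\<lambda>j. b + 2 * int j) ` {..<n} = (\<lambda>j. b - 1 + 2 * int j) ` {..<n}"
    by (auto simp: image_iff)
  show ?thesis
  proof (cases r)
    case SU
    then show ?thesis using assms by (simp add: low_def high_def up)
  next
    case SD
    then show ?thesis using assms by (simp add: low_def high_def down)
  next
    case SO
    then have "n' = Suc n" using assms by (simp add: low_def high_def)
    moreover have "(\<lambda>j. b + 1 + 2 * int j) ` {..<n} = (\<lambda>j. b - 1 + 2 * int j) ` Suc ` {..<n}"
      by (auto simp: image_iff)
    moreover have "Suc ` {..<n} \<union> {..<n} = {..<Suc n}"
      using assms(2) by (auto simp: image_Suc_lessThan)
    ultimately show ?thesis using SO
      by (simp only: next_column.simps up down image_Un[symmetric] low_def) simp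
  next
    case SC
    then have n: "n = Suc n'" using assms by (simp add: low_def high_def)
    have "(\<lambda>j. b + 1 + 2 * int j) ` {..<n} \<inter> (\<lambda>j. b - 1 + 2 * int j) ` {..<n} =
        (\<lambda>j. b + 1 + 2 * int j) ` {..<n'}"
    proof (intro equalityI subsetI)
      fix y assume "y \<in> (\<lambda>j. b + 1 + 2 * int j) ` {..<n} \<inter> (\<lambda>j. b - 1 + 2 * int j) ` {..<n}"
      then obtain i j where "y = b + 1 + 2 * int i" "y = b - 1 + 2 * int j" "i < n" "j < n"
        by (elim IntE imageE) (simp only: lessThan_iff)
      then have "j = Suc i" by linarith
      then show "y \<in> (\<lambda>j. b + 1 + 2 * int j) ` {..<n'}"
        using \<open>y = b + 1 + 2 * int i\<close> \<open>j < n\<close> n by auto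
    next
      fix y assume "y \<in> (\<lambda>j. b + 1 + 2 * int j) ` {..<n'}"
      then obtain i where i: "y = b + 1 + 2 * int i" "i < n'" by auto
      then have "y = b - 1 + 2 * int (Suc i)" by simp
      then show "y \<in> (\<lambda>j. b + 1 + 2 * int j) ` {..<n} \<inter> (\<lambda>j. b - 1 + 2 * int j) ` {..<n}"
        using i n by (intro IntI image_eqI[of _ _ i] image_eqI[of _ _ "Suc i"]) auto
    qed
    then show ?thesis using SC by (simp only: next_column.simps up down low_def) simp
  qed
qed

lemma column_snoc:
  assumes "x \<le> length rs + 1"
  shows "column (rs @ [r]) x = column rs x"
  using assms by (simp add: column_def)

lemma last_column_set:
  assumes "weakly_proper rs"
  shows "column rs (Suc (length rs)) = (\<lambda>j. base rs + 2 * int j) ` {..<ncol rs}"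
  using assms
proof (induction rs rule: rev_induct)
  case Nil
  then show ?case by (simp add: column_def base_def lessThan_Suc)
next
  case (snoc r rs)
  then have wp: "weakly_proper rs" by (simp add: weakly_proper_snoc)
  have "column (rs @ [r]) (Suc (length (rs @ [r]))) = next_column r (column rs (Suc (length rs)))"
    by (simp add: column_def)
  also have "\<dots> = (\<lambda>j. base rs + (2 * int (low r) - 1) + 2 * int j) ` {..<ncol (rs @ [r])}"
    unfolding snoc.IH[OF wp]
    using ncol_snoc[OF snoc.prems] ncol_pos[OF wp] ncol_pos[OF snoc.prems]
    by (intro next_column_progression)
  finally show ?case by (simp add: base_def)
qed

lemma last_column_eq:
  assumes "weakly_proper rs"
  shows "last_column rs = map (\<lambda>j. base rs + 2 * int j) [0..<ncol rs]"
proof -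
  let ?xs = "map (\<lambda>j. base rs + 2 * int j) [0..<ncol rs]"
  have "sorted ?xs" "distinct ?xs"
    by (auto simp: sorted_iff_nth_mono distinct_map inj_on_def)
  then have "sorted_list_of_set (set ?xs) = ?xs"
    by (rule sorted_list_of_set.idem_if_sorted_distinct)
  then show ?thesis
    using last_column_set[OF assms] by (simp add: last_column_def lessThan_atLeast0)
qed

lemma inj_pt: "inj_on (pt rs) A"
  by (auto simp: inj_on_def pt_def)

lemma lattice_Nil: "lattice [] = pt [] ` {..<ncol []}"
  by (auto simp: lattice_def pt_def base_def column_def)

lemma lattice_snoc:
  assumes "weakly_proper (rs @ [r])"
  shows "lattice (rs @ [r]) = lattice rs \<union> pt (rs @ [r]) ` {..<ncol (rs @ [r])}"
    and "lattice rs \<inter> pt (rs @ [r]) ` {..<ncol (rs @ [r])} = {}"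
proof -
  have "(x, y) \<in> lattice (rs @ [r]) \<longleftrightarrow> (x, y) \<in> lattice rs \<or> x = Suc (Suc (length rs)) \<and> y \<in> column (rs @ [r]) x" for x y
    using column_snoc[of x rs r] by (auto simp: lattice_def le_Suc_eq)
  then show "lattice (rs @ [r]) = lattice rs \<union> pt (rs @ [r]) ` {..<ncol (rs @ [r])}"
    using last_column_set[OF assms] by (auto simp: pt_def image_iff)
  show "lattice rs \<inter> pt (rs @ [r]) ` {..<ncol (rs @ [r])} = {}"
    by (auto simp: lattice_def pt_def)
qed

lemma finite_lattice: "weakly_proper rs \<Longrightarrow> finite (lattice rs)"
proof (induction rs rule: rev_induct)
  case Nil
  then show ?case by (simp add: lattice_Nil)
next
  case (snoc r rs)
  then show ?case by (simp add: lattice_snoc(1) weakly_proper_snoc del: weight_snoc)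
qed

lemma fst_lattice_le: "p \<in> lattice rs \<Longrightarrow> 1 \<le> fst p \<and> fst p \<le> Suc (length rs)"
  by (auto simp: lattice_def)

lemma last_column_lattice:
  assumes "weakly_proper rs"
  shows "(Suc (length rs), y) \<in> lattice rs \<longleftrightarrow> (\<exists>j<ncol rs. y = base rs + 2 * int j)"
  using last_column_set[OF assms] by (auto simp: lattice_def)

lemma pt_in_lattice: "weakly_proper rs \<Longrightarrow> j < ncol rs \<Longrightarrow> pt rs j \<in> lattice rs"
  by (auto simp: pt_def last_column_lattice)

section \<open>Order conditions between neighbouring columns\<close>

definition edge_ordered ::
    "('a \<Rightarrow> 'a \<Rightarrow> bool) \<Rightarrow> ('a \<Rightarrow> 'a \<Rightarrow> bool) \<Rightarrow> sym list \<Rightarrow> (nat \<times> int \<Rightarrow> 'a) \<Rightarrow> bool" where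
  "edge_ordered up down rs t \<longleftrightarrow>
     (\<forall>x y. (x, y) \<in> lattice rs \<and> (x + 1, y + 1) \<in> lattice rs \<longrightarrow> up (t (x, y)) (t (x + 1, y + 1))) \<and>
     (\<forall>x y. (x, y) \<in> lattice rs \<and> (x + 1, y - 1) \<in> lattice rs \<longrightarrow> down (t (x + 1, y - 1)) (t (x, y)))"

lemma edge_ordered_cong:
  assumes "\<And>p. p \<in> lattice rs \<Longrightarrow> s p = t p"
  shows "edge_ordered up down rs s \<longleftrightarrow> edge_ordered up down rs t"
  unfolding edge_ordered_def by (simp add: assms cong: imp_cong)

lemma interlaced_cong:
  assumes "\<And>i. i < n \<Longrightarrow> u i = u' i" "\<And>i. i < n' \<Longrightarrow> v i = v' i"
  shows "interlaced up down l n n' u v \<longleftrightarrow> interlaced up down l n n' u' v'"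
  unfolding interlaced_def by (simp add: assms cong: imp_cong conj_cong)

lemma edge_ordered_Nil: "edge_ordered up down [] t"
  by (auto simp: edge_ordered_def lattice_def)

text \<open>Edges join neighbouring columns only, so a new column adds just the edges between the
  last two. Since the base moves from \<open>b\<close> to \<open>b + 2 * l - 1\<close>, the point at
  position \<open>i\<close> has its upper and lower neighbours at positions \<open>i + 1 - l\<close>
  and \<open>i - l\<close> of the new column.\<close>

lemma edge_ordered_snoc:
  assumes wp: "weakly_proper (rs @ [r])"
  shows "edge_ordered up down (rs @ [r]) t \<longleftrightarrow> edge_ordered up down rs t \<and>
    interlaced up down (low r) (ncol rs) (ncol (rs @ [r])) (\<lambda>j. t (pt rs j)) (\<lambda>j. t (pt (rs @ [r]) j))"
    (is "?L \<longleftrightarrow> ?R \<and> ?I")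
proof -
  have wp': "weakly_proper rs" using wp by (simp add: weakly_proper_snoc)
  let ?b = "base rs" and ?l = "low r" and ?n = "ncol rs" and ?n' = "ncol (rs @ [r])" and ?N = "Suc (length rs)"
  have b: "base (rs @ [r]) = ?b + (2 * int ?l - 1)" by (simp add: base_def)
  have l01: "?l = 0 \<or> ?l = 1" by (auto simp: low_def split: sym.splits)
  have old: "(x, y) \<in> lattice (rs @ [r]) \<longleftrightarrow> (x, y) \<in> lattice rs" if "x \<le> ?N" for x y
    using that by (auto simp: lattice_snoc(1)[OF wp] pt_def)
  have new: "(Suc ?N, y) \<in> lattice (rs @ [r]) \<longleftrightarrow> (\<exists>j<?n'. y = ?b + (2 * int ?l - 1) + 2 * int j)" for y
    using last_column_lattice[OF wp, of y] by (simp add: b)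
  have lst: "(?N, y) \<in> lattice rs \<longleftrightarrow> (\<exists>j<?n. y = ?b + 2 * int j)" for y
    by (rule last_column_lattice[OF wp'])
  have bnd: "x \<le> Suc ?N" if "(x, y) \<in> lattice (rs @ [r])" for x y
    using fst_lattice_le[OF that] by simp
  have bnd': "x \<le> ?N" if "(x, y) \<in> lattice rs" for x y
    using fst_lattice_le[OF that] by simp
  have U: "(\<forall>y. (?N, y) \<in> lattice rs \<and> (Suc ?N, y + 1) \<in> lattice (rs @ [r]) \<longrightarrow> up (t (?N, y)) (t (Suc ?N, y + 1))) \<longleftrightarrow>
      (\<forall>i<?n. i + 1 - ?l < ?n' \<longrightarrow> up (t (pt rs i)) (t (pt (rs @ [r]) (i + 1 - ?l))))" (is "?U1 \<longleftrightarrow> ?U2")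
  proof
    assume A: ?U1
    show ?U2
    proof (intro allI impI)
      fix i assume i: "i < ?n" "i + 1 - ?l < ?n'"
      have eq: "?b + 2 * int i + 1 = ?b + (2 * int ?l - 1) + 2 * int (i + 1 - ?l)"
        using l01 by auto
      have "(?N, ?b + 2 * int i) \<in> lattice rs" "(Suc ?N, ?b + 2 * int i + 1) \<in> lattice (rs @ [r])"
        unfolding lst new eq using i by blast+
      then have "up (t (?N, ?b + 2 * int i)) (t (Suc ?N, ?b + 2 * int i + 1))"
        using A by blast
      then show "up (t (pt rs i)) (t (pt (rs @ [r]) (i + 1 - ?l)))"
        unfolding eq by (simp only: pt_def b length_append_singleton)
    qed
  next
    assume A: ?U2
    show ?U1
    proof (intro allI impI)
      fix y assume "(?N, y) \<in> lattice rs \<and> (Suc ?N, y + 1) \<in> lattice (rs @ [r])"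
      then obtain i j where ij: "i < ?n" "y = ?b + 2 * int i" "j < ?n'" "y + 1 = ?b + (2 * int ?l - 1) + 2 * int j"
        unfolding lst new by blast
      then have "j = i + 1 - ?l" using l01 by auto
      then show "up (t (?N, y)) (t (Suc ?N, y + 1))"
      proof -
        have "pt rs i = (?N, y)"
          by (simp add: pt_def ij(2))
        moreover have "pt (rs @ [r]) j = (Suc ?N, y + 1)"
          using ij(4) by (simp only: pt_def b length_append_singleton)
        ultimately show ?thesis
          using A[rule_format, of i] ij(1,3) \<open>j = i + 1 - ?l\<close> by simp
      qed
    qed
  qed
  have D: "(\<forall>y. (?N, y) \<in> lattice rs \<and> (Suc ?N, y - 1) \<in> lattice (rs @ [r]) \<longrightarrow> down (t (Suc ?N, y - 1)) (t (?N, y))) \<longleftrightarrow>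
      (\<forall>i<?n. ?l \<le> i \<and> i - ?l < ?n' \<longrightarrow> down (t (pt (rs @ [r]) (i - ?l))) (t (pt rs i)))" (is "?D1 \<longleftrightarrow> ?D2")
  proof
    assume A: ?D1
    show ?D2
    proof (intro allI impI)
      fix i assume i: "i < ?n" "?l \<le> i \<and> i - ?l < ?n'"
      then have eq: "?b + 2 * int i - 1 = ?b + (2 * int ?l - 1) + 2 * int (i - ?l)"
        by auto
      have "(?N, ?b + 2 * int i) \<in> lattice rs" "(Suc ?N, ?b + 2 * int i - 1) \<in> lattice (rs @ [r])"
        unfolding lst new eq using i by blast+
      then have "down (t (Suc ?N, ?b + 2 * int i - 1)) (t (?N, ?b + 2 * int i))"
        using A by blast
      then show "down (t (pt (rs @ [r]) (i - ?l))) (t (pt rs i))"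
        unfolding eq by (simp only: pt_def b length_append_singleton)
    qed
  next
    assume A: ?D2
    show ?D1
    proof (intro allI impI)
      fix y assume "(?N, y) \<in> lattice rs \<and> (Suc ?N, y - 1) \<in> lattice (rs @ [r])"
      then obtain i j where ij: "i < ?n" "y = ?b + 2 * int i" "j < ?n'" "y - 1 = ?b + (2 * int ?l - 1) + 2 * int j"
        unfolding lst new by blast
      then have "j = i - ?l" "?l \<le> i" by auto
      then show "down (t (Suc ?N, y - 1)) (t (?N, y))"
      proof -
        have "pt rs i = (?N, y)"
          by (simp add: pt_def ij(2))
        moreover have "pt (rs @ [r]) j = (Suc ?N, y - 1)"
          using ij(4) by (simp only: pt_def b length_append_singleton)
        ultimately show ?thesis
          using A[rule_format, of i] ij(1,3) \<open>j = i - ?l\<close> \<open>?l \<le> i\<close> by simp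
      qed
    qed
  qed
  have "?L \<longleftrightarrow> ?R \<and> ?U1 \<and> ?D1"
  proof
    assume L: ?L
    have "?R"
      unfolding edge_ordered_def
    proof (intro conjI allI impI)
      fix x y
      show "up (t (x, y)) (t (x + 1, y + 1))" if "(x, y) \<in> lattice rs \<and> (x + 1, y + 1) \<in> lattice rs"
        using L that old[of x] old[of "x + 1"] bnd' unfolding edge_ordered_def by blast
      show "down (t (x + 1, y - 1)) (t (x, y))" if "(x, y) \<in> lattice rs \<and> (x + 1, y - 1) \<in> lattice rs"
        using L that old[of x] old[of "x + 1"] bnd' unfolding edge_ordered_def by blast
    qed
    moreover have ?U1 ?D1
      using L old[of ?N] by (auto simp: edge_ordered_def)
    ultimately show "?R \<and> ?U1 \<and> ?D1" by blast
  next
    assume R: "?R \<and> ?U1 \<and> ?D1"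
    have *: "x \<le> length rs \<or> x = ?N" if "(x + 1, y) \<in> lattice (rs @ [r])" for x y
      using bnd[OF that] by auto
    show ?L
      unfolding edge_ordered_def
    proof (intro conjI allI impI; elim conjE)
      fix x y
      show "up (t (x, y)) (t (x + 1, y + 1))" if a: "(x, y) \<in> lattice (rs @ [r])" "(x + 1, y + 1) \<in> lattice (rs @ [r])"
        using *[OF a(2)] R a old[of x y] old[of "x + 1" "y + 1"] by (auto simp: edge_ordered_def)
      show "down (t (x + 1, y - 1)) (t (x, y))" if a: "(x, y) \<in> lattice (rs @ [r])" "(x + 1, y - 1) \<in> lattice (rs @ [r])"
        using *[OF a(2)] R a old[of x y] old[of "x + 1" "y - 1"] by (auto simp: edge_ordered_def)
    qed
  qed
  also have "\<dots> \<longleftrightarrow> ?R \<and> ?I"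
    unfolding U D interlaced_def by blast
  finally show ?thesis .
qed

section \<open>Integration column by column\<close>

text \<open>There are two instances: Lebesgue measure with \<open>(<)\<close> and \<open>(<)\<close>
  gives the integral, counting measure on the naturals with \<open>(<)\<close> and
  \<open>(\<le>)\<close> gives the series. The column recursion is proved once for both.\<close>

locale chain = sigma_finite_measure M for M :: "'a measure" +
  fixes up down :: "'a \<Rightarrow> 'a \<Rightarrow> bool"
  assumes pred_up: "Measurable.pred (M \<Otimes>\<^sub>M M) (\<lambda>p. up (fst p) (snd p))"
    and pred_down: "Measurable.pred (M \<Otimes>\<^sub>M M) (\<lambda>p. down (fst p) (snd p))"
begin

sublocale P: product_sigma_finite "\<lambda>_. M"
  by unfold_locales

lemma sigma_finite_PiM: "finite I \<Longrightarrow> sigma_finite_measure (\<Pi>\<^sub>M i\<in>I. M)"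
  by (rule P.sigma_finite)

lemma pred_up_comp:
  assumes "f \<in> measurable N M" "g \<in> measurable N M"
  shows "Measurable.pred N (\<lambda>x. up (f x) (g x))"
  using measurable_compose[OF measurable_Pair[OF assms] pred_up] by simp

lemma pred_down_comp:
  assumes "f \<in> measurable N M" "g \<in> measurable N M"
  shows "Measurable.pred N (\<lambda>x. down (f x) (g x))"
  using measurable_compose[OF measurable_Pair[OF assms] pred_down] by simp

lemma pred_bounded:
  fixes n :: nat
  assumes "\<And>i. i < n \<Longrightarrow> Measurable.pred N (Q i)"
  shows "Measurable.pred N (\<lambda>x. \<forall>i<n. Q i x)"
  using assms by (induction n) (auto simp: All_less_Suc)

lemma pred_interlaced:
  assumes "u \<in> measurable N (\<Pi>\<^sub>M i\<in>{..<n}. M)" "v \<in> measurable N (\<Pi>\<^sub>M i\<in>{..<n'}. M)"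
  shows "Measurable.pred N (\<lambda>x. interlaced up down l n n' (u x) (v x))"
  unfolding interlaced_def
proof (intro pred_bounded pred_intros_logic(3))
  fix i assume i: "i < n"
  have u: "(\<lambda>x. u x i) \<in> measurable N M"
    using i by (intro measurable_compose[OF assms(1) measurable_component_singleton]) auto
  have v: "(\<lambda>x. v x j) \<in> measurable N M" if "j < n'" for j
    using that by (intro measurable_compose[OF assms(2) measurable_component_singleton]) auto
  show "Measurable.pred N (\<lambda>x. l \<le> i \<and> i - l < n' \<longrightarrow> down (v x (i - l)) (u x i))"
    by (intro pred_intros_imp' pred_down_comp u v) (elim conjE)
  show "Measurable.pred N (\<lambda>x. i + 1 - l < n' \<longrightarrow> up (u x i) (v x (i + 1 - l)))"
    by (intro pred_intros_imp' pred_up_comp u v)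
qed

lemma pred_edge_ordered:
  assumes "weakly_proper rs"
  shows "Measurable.pred (\<Pi>\<^sub>M p\<in>lattice rs. M) (edge_ordered up down rs)"
  using assms
proof (induction rs rule: rev_induct)
  case Nil
  have "edge_ordered up down [] = (\<lambda>t :: nat \<times> int \<Rightarrow> 'a. True)"
    by (simp add: fun_eq_iff edge_ordered_Nil)
  then show ?case by simp
next
  case (snoc r rs)
  then have wp: "weakly_proper rs" by (simp add: weakly_proper_snoc)
  let ?N = "\<Pi>\<^sub>M p\<in>lattice (rs @ [r]). M"
  have sub: "lattice rs \<subseteq> lattice (rs @ [r])"
    by (simp add: lattice_snoc(1)[OF snoc.prems])
  have "Measurable.pred ?N (\<lambda>t. edge_ordered up down rs (restrict t (lattice rs)))"
    by (intro measurable_compose[OF measurable_restrict_subset[OF sub] snoc.IH[OF wp]])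
  moreover have "(\<lambda>t. \<lambda>j\<in>{..<ncol rs}. t (pt rs j)) \<in> measurable ?N (\<Pi>\<^sub>M j\<in>{..<ncol rs}. M)"
    using sub pt_in_lattice[OF wp] by (intro measurable_restrict measurable_component_singleton) auto
  moreover have "(\<lambda>t. \<lambda>j\<in>{..<ncol (rs @ [r])}. t (pt (rs @ [r]) j)) \<in>
      measurable ?N (\<Pi>\<^sub>M j\<in>{..<ncol (rs @ [r])}. M)"
    using pt_in_lattice[OF snoc.prems] by (intro measurable_restrict measurable_component_singleton) auto
  ultimately have "Measurable.pred ?N (\<lambda>t. edge_ordered up down rs (restrict t (lattice rs)) \<and>
      interlaced up down (low r) (ncol rs) (ncol (rs @ [r])) (\<lambda>j\<in>{..<ncol rs}. t (pt rs j))
        (\<lambda>j\<in>{..<ncol (rs @ [r])}. t (pt (rs @ [r]) j)))"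
    by (intro pred_intros_logic(3) pred_interlaced)
  also have "(\<lambda>t. edge_ordered up down rs (restrict t (lattice rs)) \<and>
      interlaced up down (low r) (ncol rs) (ncol (rs @ [r])) (\<lambda>j\<in>{..<ncol rs}. t (pt rs j))
        (\<lambda>j\<in>{..<ncol (rs @ [r])}. t (pt (rs @ [r]) j))) = edge_ordered up down (rs @ [r])"
    unfolding edge_ordered_snoc[OF snoc.prems] fun_eq_iff
    by (intro allI conj_cong edge_ordered_cong interlaced_cong) auto
  finally show ?case .
qed

text \<open>\<open>pre w (rev rs) v\<close> integrates over all columns but the last, whose values are \<open>v\<close>
  and carry no weight.\<close>

fun pre :: "(nat \<Rightarrow> 'a \<Rightarrow> ennreal) \<Rightarrow> sym list \<Rightarrow> (nat \<Rightarrow> 'a) \<Rightarrow> ennreal" where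
  "pre w [] v = 1"
| "pre w (r # rs) v = (\<integral>\<^sup>+u. pre w rs u * (\<Prod>i<ncol rs. w (length rs) (u i)) *
     (if interlaced up down (low r) (ncol rs) (ncol (r # rs)) u v then 1 else 0) \<partial>(\<Pi>\<^sub>M i\<in>{..<ncol rs}. M))"

lemma pre_cong:
  assumes "\<And>x. x < length rs \<Longrightarrow> w x = w' x"
  shows "pre w rs v = pre w' rs v"
  using assms
proof (induction rs arbitrary: v)
  case (Cons r rs)
  then have "pre w rs u = pre w' rs u" for u by simp
  with Cons.prems show ?case by simp
qed simp

lemma measurable_pre:
  assumes w: "\<And>x. w x \<in> borel_measurable M"
  shows "pre w rs \<in> borel_measurable (\<Pi>\<^sub>M i\<in>{..<ncol rs}. M)"
proof (induction rs)
  case Nil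
  then show ?case by (simp add: pre.simps(1)[abs_def])
next
  case (Cons r rs)
  interpret Q: sigma_finite_measure "\<Pi>\<^sub>M i\<in>{..<ncol rs}. M"
    by (rule sigma_finite_PiM) simp
  let ?N = "(\<Pi>\<^sub>M i\<in>{..<ncol (r # rs)}. M) \<Otimes>\<^sub>M (\<Pi>\<^sub>M i\<in>{..<ncol rs}. M)"
  have "(\<lambda>p. pre w rs (snd p)) \<in> borel_measurable ?N"
    by (rule measurable_compose[OF measurable_snd Cons.IH])
  moreover have "(\<lambda>p. \<Prod>i<ncol rs. w (length rs) (snd p i)) \<in> borel_measurable ?N"
    by (intro borel_measurable_prod_ennreal measurable_compose[OF _ w]
        measurable_compose[OF measurable_snd measurable_component_singleton])
  moreover have "(\<lambda>p. if interlaced up down (low r) (ncol rs) (ncol (r # rs)) (snd p) (fst p) then 1 else 0 :: ennreal)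
      \<in> borel_measurable ?N"
    by (intro measurable_If measurable_const predE pred_interlaced measurable_fst measurable_snd) simp_all
  ultimately show ?case
    unfolding pre.simps(2)[abs_def]
    by (intro Q.borel_measurable_nn_integral) (auto simp: split_beta')
qed

text \<open>Both measures agree on boxes, and a product measure is determined by these. Used to pass
  from the lattice points of a column to their positions in it.\<close>

lemma nn_integral_reindex:
  fixes f :: "'i \<Rightarrow> 'j"
  assumes "finite I" "inj_on f I" and h: "h \<in> borel_measurable (\<Pi>\<^sub>M i\<in>I. M)"
  shows "(\<integral>\<^sup>+y. h (\<lambda>i\<in>I. y (f i)) \<partial>(\<Pi>\<^sub>M j\<in>f ` I. M)) = (\<integral>\<^sup>+v. h v \<partial>(\<Pi>\<^sub>M i\<in>I. M))"
proof -
  let ?g = "\<lambda>y. \<lambda>i\<in>I. y (f i)"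
  have g: "?g \<in> measurable (\<Pi>\<^sub>M j\<in>f ` I. M) (\<Pi>\<^sub>M i\<in>I. M)"
    by (intro measurable_restrict measurable_component_singleton) auto
  have "distr (\<Pi>\<^sub>M j\<in>f ` I. M) (\<Pi>\<^sub>M i\<in>I. M) ?g = (\<Pi>\<^sub>M i\<in>I. M)"
  proof (rule P.PiM_eqI)
    fix A assume A: "\<And>i. i \<in> I \<Longrightarrow> A i \<in> sets M"
    have "emeasure (distr (\<Pi>\<^sub>M j\<in>f ` I. M) (\<Pi>\<^sub>M i\<in>I. M) ?g) (Pi\<^sub>E I A) =
        emeasure (\<Pi>\<^sub>M j\<in>f ` I. M) (?g -` Pi\<^sub>E I A \<inter> space (\<Pi>\<^sub>M j\<in>f ` I. M))"
      using A assms(1) by (intro emeasure_distr g sets_PiM_I_finite) auto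
    also have "?g -` Pi\<^sub>E I A \<inter> space (\<Pi>\<^sub>M j\<in>f ` I. M) = Pi\<^sub>E (f ` I) (\<lambda>j. A (inv_into I f j))"
    proof -
      have "y \<in> space (\<Pi>\<^sub>M j\<in>f ` I. M)" if "y \<in> Pi\<^sub>E (f ` I) (\<lambda>j. A (inv_into I f j))" for y
        using that A sets.sets_into_space assms(2) by (fastforce simp: space_PiM PiE_iff)
      then show ?thesis
        using assms(2) by (auto simp: space_PiM PiE_iff)
    qed
    also have "emeasure (\<Pi>\<^sub>M j\<in>f ` I. M) \<dots> = (\<Prod>j\<in>f ` I. emeasure M (A (inv_into I f j)))"
      using A assms by (intro P.emeasure_PiM) auto
    also have "\<dots> = (\<Prod>i\<in>I. emeasure M (A i))"
      using assms by (simp add: prod.reindex)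
    finally show "emeasure (distr (\<Pi>\<^sub>M j\<in>f ` I. M) (\<Pi>\<^sub>M i\<in>I. M) ?g) (Pi\<^sub>E I A) = (\<Prod>i\<in>I. emeasure M (A i))" .
  qed (use assms in auto)
  then show ?thesis
    using nn_integral_distr[OF g, of h] h by simp
qed

text \<open>The arbitrary \<open>g\<close> carries the induction: integrating out the last column
  turns \<open>g\<close> into a function \<open>G\<close> of the column before, to which the
  induction hypothesis applies. Tonelli then restores the order of integration in which
  \<open>pre\<close> is defined.\<close>

theorem nn_integral_lattice:
  assumes "weakly_proper rs" and w: "\<And>x. w x \<in> borel_measurable M"
    and "g \<in> borel_measurable (\<Pi>\<^sub>M i\<in>{..<ncol rs}. M)"
  shows "(\<integral>\<^sup>+t. (if edge_ordered up down rs t then 1 else 0) * (\<Prod>p\<in>lattice rs. w (fst p - 1) (t p)) *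
        g (\<lambda>j\<in>{..<ncol rs}. t (pt rs j)) \<partial>(\<Pi>\<^sub>M p\<in>lattice rs. M)) =
      (\<integral>\<^sup>+v. pre w (rev rs) v * (\<Prod>i<ncol rs. w (length rs) (v i)) * g v \<partial>(\<Pi>\<^sub>M i\<in>{..<ncol rs}. M))"
  using assms(1,3)
proof (induction rs arbitrary: g rule: rev_induct)
  case Nil
  let ?h = "\<lambda>v. (\<Prod>i<1. w 0 (v i)) * g v"
  have h: "?h \<in> borel_measurable (\<Pi>\<^sub>M i\<in>{..<1}. M)"
    using Nil by (intro borel_measurable_times_ennreal borel_measurable_prod_ennreal measurable_compose[OF _ w]
        measurable_component_singleton) auto
  have "(\<integral>\<^sup>+t. ?h (\<lambda>j\<in>{..<1}. t (pt [] j)) \<partial>(\<Pi>\<^sub>M p\<in>pt [] ` {..<1}. M)) =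
      (\<integral>\<^sup>+v. ?h v \<partial>(\<Pi>\<^sub>M i\<in>{..<1}. M))"
    by (rule nn_integral_reindex[OF _ inj_pt h]) simp
  then show ?case
    by (simp add: lattice_Nil edge_ordered_Nil prod.reindex[OF inj_pt] pt_def lessThan_Suc restrict_def)
next
  case (snoc r rs)
  note wp' = snoc.prems(1) and g = snoc.prems(2)
  have wp: "weakly_proper rs" using wp' by (simp add: weakly_proper_snoc)
  let ?L = "lattice rs" and ?n = "ncol rs" and ?n' = "ncol (rs @ [r])"
  let ?C = "pt (rs @ [r]) ` {..<?n'}"
  let ?E = "\<lambda>u v. if interlaced up down (low r) ?n ?n' u v then 1 else 0 :: ennreal"
  let ?W = "\<lambda>v. \<Prod>i<?n'. w (Suc (length rs)) (v i)"
  define G where "G u = (\<integral>\<^sup>+v. ?E u v * ?W v * g v \<partial>(\<Pi>\<^sub>M i\<in>{..<?n'}. M))" for u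
  interpret Q: sigma_finite_measure "\<Pi>\<^sub>M i\<in>{..<?n}. M" by (rule sigma_finite_PiM) simp
  interpret Q': sigma_finite_measure "\<Pi>\<^sub>M i\<in>{..<?n'}. M" by (rule sigma_finite_PiM) simp
  interpret QQ: pair_sigma_finite "\<Pi>\<^sub>M i\<in>{..<?n}. M" "\<Pi>\<^sub>M i\<in>{..<?n'}. M" by unfold_locales
  have W: "?W \<in> borel_measurable (\<Pi>\<^sub>M i\<in>{..<?n'}. M)"
    by (intro borel_measurable_prod_ennreal measurable_compose[OF _ w] measurable_component_singleton)
  have E: "(\<lambda>p. ?E (fst p) (snd p)) \<in> borel_measurable ((\<Pi>\<^sub>M i\<in>{..<?n}. M) \<Otimes>\<^sub>M (\<Pi>\<^sub>M i\<in>{..<?n'}. M))"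
    by (intro measurable_If measurable_const predE pred_interlaced measurable_fst measurable_snd) simp_all
  have EWg: "(\<lambda>p. ?E (fst p) (snd p) * ?W (snd p) * g (snd p)) \<in>
      borel_measurable ((\<Pi>\<^sub>M i\<in>{..<?n}. M) \<Otimes>\<^sub>M (\<Pi>\<^sub>M i\<in>{..<?n'}. M))"
    by (intro borel_measurable_times_ennreal E measurable_compose[OF measurable_snd W]
        measurable_compose[OF measurable_snd g])
  then have G: "G \<in> borel_measurable (\<Pi>\<^sub>M i\<in>{..<?n}. M)"
    unfolding G_def[abs_def] by (intro Q'.borel_measurable_nn_integral) (simp add: split_beta')
  let ?f = "\<lambda>t. (if edge_ordered up down (rs @ [r]) t then 1 else 0) *
      (\<Prod>p\<in>lattice (rs @ [r]). w (fst p - 1) (t p)) * g (\<lambda>j\<in>{..<?n'}. t (pt (rs @ [r]) j))"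
  have meas: "?f \<in> borel_measurable (\<Pi>\<^sub>M p\<in>?L \<union> ?C. M)"
    unfolding lattice_snoc(1)[OF wp', symmetric]
  proof (intro borel_measurable_times_ennreal measurable_If measurable_const predE)
    show "Measurable.pred (\<Pi>\<^sub>M p\<in>lattice (rs @ [r]). M) (edge_ordered up down (rs @ [r]))"
      by (rule pred_edge_ordered[OF wp'])
    show "(\<lambda>t. \<Prod>p\<in>lattice (rs @ [r]). w (fst p - 1) (t p)) \<in> borel_measurable (\<Pi>\<^sub>M p\<in>lattice (rs @ [r]). M)"
      by (intro borel_measurable_prod_ennreal measurable_compose[OF _ w] measurable_component_singleton)
    show "(\<lambda>t. g (\<lambda>j\<in>{..<?n'}. t (pt (rs @ [r]) j))) \<in> borel_measurable (\<Pi>\<^sub>M p\<in>lattice (rs @ [r]). M)"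
      using pt_in_lattice[OF wp']
      by (intro measurable_compose[OF _ g] measurable_restrict measurable_component_singleton) auto
  qed simp_all
  \<comment> \<open>With the old columns fixed, the new one interacts with them only through the
    interlacing with the last of them.\<close>
  have inner: "(\<integral>\<^sup>+y. ?f (merge ?L ?C (x, y)) \<partial>(\<Pi>\<^sub>M p\<in>?C. M)) =
      (if edge_ordered up down rs x then 1 else 0) * (\<Prod>p\<in>?L. w (fst p - 1) (x p)) * G (\<lambda>j\<in>{..<?n}. x (pt rs j))"
    if x: "x \<in> space (\<Pi>\<^sub>M p\<in>?L. M)" for x
  proof -
    let ?u = "\<lambda>j\<in>{..<?n}. x (pt rs j)"
    let ?c = "(if edge_ordered up down rs x then 1 else 0) * (\<Prod>p\<in>?L. w (fst p - 1) (x p))"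
    let ?h = "\<lambda>v. ?E ?u v * ?W v * g v"
    have u: "?u \<in> space (\<Pi>\<^sub>M j\<in>{..<?n}. M)"
      using x pt_in_lattice[OF wp] by (auto simp: space_PiM)
    have h: "?h \<in> borel_measurable (\<Pi>\<^sub>M i\<in>{..<?n'}. M)"
      using measurable_compose[OF measurable_Pair1'[OF u] EWg] by simp
    have old: "merge ?L ?C (x, y) p = x p" if "p \<in> ?L" for y p
      using that by (simp add: merge_def)
    have new: "merge ?L ?C (x, y) (pt (rs @ [r]) j) = y (pt (rs @ [r]) j)" if "j < ?n'" for y j
    proof -
      have "pt (rs @ [r]) j \<in> ?C" using that by auto
      then have "pt (rs @ [r]) j \<notin> ?L" using lattice_snoc(2)[OF wp'] by blast
      then show ?thesis using \<open>pt (rs @ [r]) j \<in> ?C\<close> by (simp add: merge_def)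
    qed
    have "?f (merge ?L ?C (x, y)) = ?c * ?h (\<lambda>j\<in>{..<?n'}. y (pt (rs @ [r]) j))" for y
    proof -
      let ?t = "merge ?L ?C (x, y)" and ?v = "\<lambda>j\<in>{..<?n'}. y (pt (rs @ [r]) j)"
      have "edge_ordered up down (rs @ [r]) ?t \<longleftrightarrow> edge_ordered up down rs x \<and>
          interlaced up down (low r) ?n ?n' ?u ?v"
        unfolding edge_ordered_snoc[OF wp']
        by (intro conj_cong edge_ordered_cong interlaced_cong) (simp_all add: old new pt_in_lattice[OF wp])
      moreover have "(\<Prod>p\<in>lattice (rs @ [r]). w (fst p - 1) (?t p)) = (\<Prod>p\<in>?L. w (fst p - 1) (x p)) * ?W ?v"
      proof -
        have "(\<Prod>p\<in>lattice (rs @ [r]). w (fst p - 1) (?t p)) =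
            (\<Prod>p\<in>?L. w (fst p - 1) (?t p)) * (\<Prod>p\<in>?C. w (fst p - 1) (?t p))"
          unfolding lattice_snoc(1)[OF wp']
          using lattice_snoc(2)[OF wp'] finite_lattice[OF wp] by (intro prod.union_disjoint) auto
        also have "(\<Prod>p\<in>?L. w (fst p - 1) (?t p)) = (\<Prod>p\<in>?L. w (fst p - 1) (x p))"
          using old by (intro prod.cong) auto
        also have "(\<Prod>p\<in>?C. w (fst p - 1) (?t p)) = ?W ?v"
          unfolding prod.reindex[OF inj_pt] using new by (intro prod.cong) (auto simp: pt_def)
        finally show ?thesis .
      qed
      moreover have "(\<lambda>j\<in>{..<?n'}. ?t (pt (rs @ [r]) j)) = ?v"
        using new by (intro restrict_ext) auto
      ultimately show ?thesis
        by (simp add: mult_ac)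
    qed
    then have "(\<integral>\<^sup>+y. ?f (merge ?L ?C (x, y)) \<partial>(\<Pi>\<^sub>M p\<in>?C. M)) =
        (\<integral>\<^sup>+y. ?c * ?h (\<lambda>j\<in>{..<?n'}. y (pt (rs @ [r]) j)) \<partial>(\<Pi>\<^sub>M p\<in>?C. M))"
      by (simp only:)
    also have "\<dots> = (\<integral>\<^sup>+v. ?c * ?h v \<partial>(\<Pi>\<^sub>M i\<in>{..<?n'}. M))"
      by (rule nn_integral_reindex[OF _ inj_pt, where h = "\<lambda>v. ?c * ?h v"])
         (auto intro!: borel_measurable_times_ennreal[OF _ h])
    also have "\<dots> = ?c * G ?u"
      unfolding G_def by (rule nn_integral_cmult[OF h])
    finally show ?thesis .
  qed
  have "(\<integral>\<^sup>+t. ?f t \<partial>(\<Pi>\<^sub>M p\<in>lattice (rs @ [r]). M)) = (\<integral>\<^sup>+t. ?f t \<partial>(\<Pi>\<^sub>M p\<in>?L \<union> ?C. M))"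
    by (simp only: lattice_snoc(1)[OF wp'])
  also have "\<dots> = (\<integral>\<^sup>+x. (\<integral>\<^sup>+y. ?f (merge ?L ?C (x, y)) \<partial>(\<Pi>\<^sub>M p\<in>?C. M)) \<partial>(\<Pi>\<^sub>M p\<in>?L. M))"
    by (rule P.product_nn_integral_fold[OF lattice_snoc(2)[OF wp'] finite_lattice[OF wp] _ meas]) simp
  also have "\<dots> = (\<integral>\<^sup>+x. (if edge_ordered up down rs x then 1 else 0) * (\<Prod>p\<in>?L. w (fst p - 1) (x p)) *
      G (\<lambda>j\<in>{..<?n}. x (pt rs j)) \<partial>(\<Pi>\<^sub>M p\<in>?L. M))"
    using inner by (rule nn_integral_cong)
  also have "\<dots> = (\<integral>\<^sup>+u. pre w (rev rs) u * (\<Prod>i<?n. w (length rs) (u i)) * G u \<partial>(\<Pi>\<^sub>M i\<in>{..<?n}. M))"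
    by (rule snoc.IH[OF wp G])
  also have "\<dots> = (\<integral>\<^sup>+u. (\<integral>\<^sup>+v. pre w (rev rs) u * (\<Prod>i<?n. w (length rs) (u i)) * (?E u v * ?W v * g v)
      \<partial>(\<Pi>\<^sub>M i\<in>{..<?n'}. M)) \<partial>(\<Pi>\<^sub>M i\<in>{..<?n}. M))"
  proof (intro nn_integral_cong)
    fix u assume u: "u \<in> space (\<Pi>\<^sub>M i\<in>{..<?n}. M)"
    have "(\<lambda>v. ?E u v * ?W v * g v) \<in> borel_measurable (\<Pi>\<^sub>M i\<in>{..<?n'}. M)"
      using measurable_compose[OF measurable_Pair1'[OF u] EWg] by simp
    then show "pre w (rev rs) u * (\<Prod>i<?n. w (length rs) (u i)) * G u =
        (\<integral>\<^sup>+v. pre w (rev rs) u * (\<Prod>i<?n. w (length rs) (u i)) * (?E u v * ?W v * g v) \<partial>(\<Pi>\<^sub>M i\<in>{..<?n'}. M))"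
      unfolding G_def by (rule nn_integral_cmult[symmetric])
  qed
  also have "\<dots> = (\<integral>\<^sup>+v. (\<integral>\<^sup>+u. pre w (rev rs) u * (\<Prod>i<?n. w (length rs) (u i)) * (?E u v * ?W v * g v)
      \<partial>(\<Pi>\<^sub>M i\<in>{..<?n}. M)) \<partial>(\<Pi>\<^sub>M i\<in>{..<?n'}. M))"
  proof (rule QQ.Fubini'[symmetric])
    have "pre w (rev rs) \<in> borel_measurable (\<Pi>\<^sub>M i\<in>{..<?n}. M)"
      using measurable_pre[where rs = "rev rs", OF w] by simp
    moreover have "(\<lambda>u. \<Prod>i<?n. w (length rs) (u i)) \<in> borel_measurable (\<Pi>\<^sub>M i\<in>{..<?n}. M)"
      by (intro borel_measurable_prod_ennreal measurable_compose[OF _ w] measurable_component_singleton)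
    ultimately have "(\<lambda>p. pre w (rev rs) (fst p) * (\<Prod>i<?n. w (length rs) (fst p i)) *
        (?E (fst p) (snd p) * ?W (snd p) * g (snd p))) \<in>
        borel_measurable ((\<Pi>\<^sub>M i\<in>{..<?n}. M) \<Otimes>\<^sub>M (\<Pi>\<^sub>M i\<in>{..<?n'}. M))"
      by (intro borel_measurable_times_ennreal[OF _ EWg] borel_measurable_times_ennreal) (rule measurable_compose[OF measurable_fst]; assumption)+
    then show "(\<lambda>(u, v). pre w (rev rs) u * (\<Prod>i<?n. w (length rs) (u i)) * (?E u v * ?W v * g v)) \<in>
        borel_measurable ((\<Pi>\<^sub>M i\<in>{..<?n}. M) \<Otimes>\<^sub>M (\<Pi>\<^sub>M i\<in>{..<?n'}. M))"
      by (simp add: split_beta')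
  qed
  also have "\<dots> = (\<integral>\<^sup>+v. pre w (rev (rs @ [r])) v * ?W v * g v \<partial>(\<Pi>\<^sub>M i\<in>{..<?n'}. M))"
  proof (intro nn_integral_cong)
    fix v assume v: "v \<in> space (\<Pi>\<^sub>M i\<in>{..<?n'}. M)"
    have 1: "(\<lambda>u. pre w (rev rs) u * (\<Prod>i<?n. w (length rs) (u i)) * ?E u v) \<in> borel_measurable (\<Pi>\<^sub>M i\<in>{..<?n}. M)"
    proof (intro borel_measurable_times_ennreal)
      show "pre w (rev rs) \<in> borel_measurable (\<Pi>\<^sub>M i\<in>{..<?n}. M)"
        using measurable_pre[where rs = "rev rs", OF w] by simp
      show "(\<lambda>u. \<Prod>i<?n. w (length rs) (u i)) \<in> borel_measurable (\<Pi>\<^sub>M i\<in>{..<?n}. M)"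
        by (intro borel_measurable_prod_ennreal measurable_compose[OF _ w] measurable_component_singleton)
      show "(\<lambda>u. ?E u v) \<in> borel_measurable (\<Pi>\<^sub>M i\<in>{..<?n}. M)"
        using measurable_compose[OF measurable_Pair2'[OF v] E] by simp
    qed
    have "(\<integral>\<^sup>+u. pre w (rev rs) u * (\<Prod>i<?n. w (length rs) (u i)) * (?E u v * ?W v * g v) \<partial>(\<Pi>\<^sub>M i\<in>{..<?n}. M)) =
        (\<integral>\<^sup>+u. (pre w (rev rs) u * (\<Prod>i<?n. w (length rs) (u i)) * ?E u v) * (?W v * g v) \<partial>(\<Pi>\<^sub>M i\<in>{..<?n}. M))"
      by (intro nn_integral_cong) (simp add: mult.assoc)
    also have "\<dots> = pre w (rev (rs @ [r])) v * (?W v * g v)"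
      by (subst nn_integral_multc[OF 1]) simp
    finally show "(\<integral>\<^sup>+u. pre w (rev rs) u * (\<Prod>i<?n. w (length rs) (u i)) * (?E u v * ?W v * g v) \<partial>(\<Pi>\<^sub>M i\<in>{..<?n}. M)) =
        pre w (rev (rs @ [r])) v * ?W v * g v" by (simp add: mult.assoc)
  qed
  finally show ?case by (simp only: length_append_singleton)
qed

end

section \<open>Expanding the integral over one column\<close>

interpretation real_chain: chain "lborel :: real measure" "(<)" "(<)"
proof (intro chain.intro chain_axioms.intro)
  show "sigma_finite_measure (lborel :: real measure)"
    by (rule lborel.sigma_finite_measure_axioms)
qed measurable

interpretation nat_chain: chain "count_space (UNIV :: nat set)" "(<)" "(\<le>)"
proof (intro chain.intro chain_axioms.intro)
  show "sigma_finite_measure (count_space (UNIV :: nat set))"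
    by (rule sigma_finite_measure_count_space)
qed (simp_all add: pair_measure_countable)

text \<open>The value 0 outside the open unit interval makes the bounds on the variables part of the
  weight; the endpoints only contribute a null set.\<close>

definition jweight :: "label list \<Rightarrow> nat \<Rightarrow> real \<Rightarrow> ennreal" where
  "jweight ds x t = (if 0 < t \<and> t < 1 then ennreal (omega (ds ! x) t) else 0)"

text \<open>The value 0 at \<open>m = 0\<close> restricts sums over all naturals to positive
  indices, also when \<open>k = 0\<close>.\<close>

definition zweight :: "nat \<Rightarrow> nat \<Rightarrow> ennreal" where
  "zweight k m = (if 1 \<le> m then ennreal (1 / real m ^ k) else 0)"

lemma measurable_omega [measurable]: "omega d \<in> borel_measurable borel"
  by (cases d) (simp_all add: omega.simps[abs_def])

lemma measurable_jweight: "jweight ds x \<in> borel_measurable lborel"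
  unfolding jweight_def[abs_def] by measurable

lemma prod_zweight_Suc:
  "(\<Prod>i<n. zweight k (m i)) * (\<Prod>i<n. ennreal (1 / real (m i))) = (\<Prod>i<n. zweight (Suc k) (m i))"
  unfolding prod.distrib[symmetric]
  by (intro prod.cong) (auto simp: zweight_def ennreal_mult[symmetric])

lemma prod_zweight_nonzero:
  fixes n :: nat
  shows "(\<Prod>i<n. zweight k (m i)) \<noteq> 0 \<Longrightarrow> i < n \<Longrightarrow> 1 \<le> m i"
  by (auto simp: zweight_def split: if_splits)

text \<open>Two consecutive new values are separated by an old one:
  \<open>v j \<le> u (j + low r) < v (Suc j)\<close>.\<close>

lemma interlaced_increasing:
  fixes v :: "nat \<Rightarrow> 'a :: order"
  assumes "n' + low r + high r = Suc n" "interlaced (<) (\<le>) (low r) n n' u v" "Suc j < n'"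
  shows "v j < v (Suc j)"
proof -
  have "high r \<le> 1" by (auto simp: high_def split: sym.splits)
  then have "j + low r < n"
    using assms(1,3) by linarith
  then have "v (j + low r - low r) \<le> u (j + low r)" "u (j + low r) < v (j + low r + 1 - low r)"
    using assms(2,3) unfolding interlaced_def by auto
  then show ?thesis by simp
qed

text \<open>A nonzero sum has at least one interlacing previous column. This provides the increasing
  exponents on which nonnegativity of the determinants rests.\<close>

lemma nat_chain_pre_increasing:
  assumes "weakly_proper rs" "nat_chain.pre w (rev rs) m \<noteq> 0" "Suc j < ncol rs"
  shows "m j < m (Suc j)"
proof (cases rs rule: rev_cases)
  case Nil
  with assms show ?thesis by simp
next
  case (snoc rs' r)
  have "\<exists>u. interlaced (<) (\<le>) (low r) (ncol rs') (ncol rs) u m"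
  proof (rule ccontr)
    assume "\<nexists>u. interlaced (<) (\<le>) (low r) (ncol rs') (ncol rs) u m"
    then have "nat_chain.pre w (rev rs) m = 0" by (simp add: snoc)
    with assms(2) show False by simp
  qed
  then obtain u where u: "interlaced (<) (\<le>) (low r) (ncol rs') (ncol rs) u m" by blast
  with assms snoc show ?thesis
    by (intro interlaced_increasing[OF ncol_snoc u[unfolded snoc]]) auto
qed

lemma measurable_gvdm:
  "(\<lambda>u. gvdm n u e) \<in> borel_measurable (\<Pi>\<^sub>M j\<in>{..<n}. lborel)"
  unfolding gvdm_def fdet_leibniz
proof (intro borel_measurable_sum borel_measurable_times borel_measurable_const borel_measurable_prod borel_measurable_power)
  fix p i assume "p \<in> {p. p permutes {..<n}}" "i \<in> {..<n}"
  then have "p i \<in> {..<n}" using permutes_in_image[of p "{..<n}" i] by auto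
  then show "(\<lambda>u. u (p i)) \<in> borel_measurable (\<Pi>\<^sub>M j\<in>{..<n}. lborel)"
    using measurable_component_singleton[of "p i" "{..<n}" "\<lambda>_. lborel :: real measure"] by simp
qed

lemma pred_box:
  fixes a :: "nat \<Rightarrow> real"
  shows "Measurable.pred (\<Pi>\<^sub>M j\<in>{..<n}. lborel) (\<lambda>u. \<forall>j<n. a j < u j \<and> u j < a (Suc j))"
proof (intro real_chain.pred_bounded)
  fix i assume "i < n"
  then have [measurable]: "(\<lambda>u. u i) \<in> borel_measurable (\<Pi>\<^sub>M j\<in>{..<n}. lborel :: real measure)"
    using measurable_component_singleton[of i "{..<n}" "\<lambda>_. lborel :: real measure"] by simp
  show "Measurable.pred (\<Pi>\<^sub>M j\<in>{..<n}. lborel) (\<lambda>u. a i < u i \<and> u i < a (Suc i))"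
    by measurable
qed

text \<open>Tonelli exchanges sum and integral, and the box integral of each determinant contributes
  the factors \<open>1 / m i\<close> that raise \<open>k\<close> to \<open>Suc k\<close>. The
  expansion of \<open>H\<close> is required only at increasing points of the open unit interval
  because the box contains no others. It serves both between columns and for the final box with the
  given nodes.\<close>

lemma nn_integral_box_expansion:
  fixes a :: "nat \<Rightarrow> real"
  assumes H: "\<And>u. (\<And>i. i < n \<Longrightarrow> 0 < u i \<and> u i < 1) \<Longrightarrow> (\<And>i. Suc i < n \<Longrightarrow> u i < u (Suc i)) \<Longrightarrow>
      H u = (\<integral>\<^sup>+m. P m * (\<Prod>i<n. zweight k (m i)) * ennreal (gvdm n u (\<lambda>i. m i - 1))
        \<partial>count_space (\<Pi>\<^sub>E i\<in>{..<n}. UNIV))"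
    and P: "\<And>m i. P m \<noteq> 0 \<Longrightarrow> Suc i < n \<Longrightarrow> m i < m (Suc i)"
    and a: "0 \<le> a 0" "a n \<le> 1" "\<And>j. j < n \<Longrightarrow> a j < a (Suc j)"
  shows "(\<integral>\<^sup>+u. (if \<forall>j<n. a j < u j \<and> u j < a (Suc j) then H u else 0) \<partial>(\<Pi>\<^sub>M j\<in>{..<n}. lborel)) =
    (\<integral>\<^sup>+m. P m * (\<Prod>i<n. zweight (Suc k) (m i)) * ennreal (gvdm (Suc n) a (case_nat 0 m))
      \<partial>count_space (\<Pi>\<^sub>E i\<in>{..<n}. UNIV))"
proof -
  have a_mono: "a i \<le> a j" if "i \<le> j" "j \<le> n" for i j
    using that
  proof (induction j)
    case (Suc j)
    then show ?case using a(3)[of j] by (cases "i = Suc j") auto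
  qed simp
  have a0: "0 \<le> a j" and a1: "a j \<le> 1" if "j \<le> n" for j
    using a_mono[of 0 j] a_mono[of j n] that a(1,2) by auto
  let ?B = "\<lambda>u. \<forall>j<n. a j < u j \<and> u j < a (Suc j)"
  let ?G = "\<lambda>m u. if ?B u then ennreal (gvdm n u (\<lambda>i. m i - 1)) else 0"
  let ?c = "\<lambda>m. P m * (\<Prod>i<n. zweight k (m i))"
  have meas: "?G m \<in> borel_measurable (\<Pi>\<^sub>M j\<in>{..<n}. lborel)" for m
    by (intro measurable_If predE pred_box measurable_compose[OF measurable_gvdm measurable_ennreal]) simp
  have "(if ?B u then H u else 0) = (\<integral>\<^sup>+m. ?c m * ?G m u \<partial>count_space (\<Pi>\<^sub>E i\<in>{..<n}. UNIV))" for u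
  proof (cases "?B u")
    case True
    have "H u = (\<integral>\<^sup>+m. ?c m * ennreal (gvdm n u (\<lambda>i. m i - 1)) \<partial>count_space (\<Pi>\<^sub>E i\<in>{..<n}. UNIV))"
    proof (rule H)
      show "0 < u i \<and> u i < 1" if "i < n" for i
        using True[rule_format, OF that] a0[of i] a1[of "Suc i"] that by auto
      show "u i < u (Suc i)" if "Suc i < n" for i
        using True[rule_format, of i] True[rule_format, OF that] that by auto
    qed
    then show ?thesis
      unfolding if_P[OF True] .
  next
    case False
    then show ?thesis
      unfolding if_not_P[OF False] by simp
  qed
  then have "(\<integral>\<^sup>+u. (if ?B u then H u else 0) \<partial>(\<Pi>\<^sub>M j\<in>{..<n}. lborel)) =
      (\<integral>\<^sup>+u. (\<integral>\<^sup>+m. ?c m * ?G m u \<partial>count_space (\<Pi>\<^sub>E i\<in>{..<n}. UNIV)) \<partial>(\<Pi>\<^sub>M j\<in>{..<n}. lborel))"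
    by (simp only:)
  also have "\<dots> = (\<integral>\<^sup>+m. (\<integral>\<^sup>+u. ?c m * ?G m u \<partial>(\<Pi>\<^sub>M j\<in>{..<n}. lborel)) \<partial>count_space (\<Pi>\<^sub>E i\<in>{..<n}. UNIV))"
    by (intro nn_integral_count_space_nn_integral countable_PiE borel_measurable_times_ennreal meas) auto
  also have "\<dots> = (\<integral>\<^sup>+m. P m * (\<Prod>i<n. zweight (Suc k) (m i)) * ennreal (gvdm (Suc n) a (case_nat 0 m))
      \<partial>count_space (\<Pi>\<^sub>E i\<in>{..<n}. UNIV))"
  proof (intro nn_integral_cong)
    fix m :: "nat \<Rightarrow> nat"
    have eq: "(\<integral>\<^sup>+u. ?c m * ?G m u \<partial>(\<Pi>\<^sub>M j\<in>{..<n}. lborel)) = ?c m * (\<integral>\<^sup>+u. ?G m u \<partial>(\<Pi>\<^sub>M j\<in>{..<n}. lborel))"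
      by (rule nn_integral_cmult[OF meas])
    show "(\<integral>\<^sup>+u. ?c m * ?G m u \<partial>(\<Pi>\<^sub>M j\<in>{..<n}. lborel)) =
        P m * (\<Prod>i<n. zweight (Suc k) (m i)) * ennreal (gvdm (Suc n) a (case_nat 0 m))"
    proof (cases "?c m = 0")
      case True
      then have "P m * (\<Prod>i<n. zweight (Suc k) (m i)) = 0"
        by (simp only: prod_zweight_Suc[symmetric] mult.assoc[symmetric] mult_zero_left)
      then show ?thesis
        unfolding eq by (simp only: True mult_zero_left)
    next
      case False
      then have "P m \<noteq> 0" "(\<Prod>i<n. zweight k (m i)) \<noteq> 0"
        by (metis mult_zero_left, metis mult_zero_right)
      then have "(\<integral>\<^sup>+u. ?G m u \<partial>(\<Pi>\<^sub>M j\<in>{..<n}. lborel)) =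
          (\<Prod>i<n. ennreal (1 / real (m i))) * ennreal (gvdm (Suc n) a (case_nat 0 m))"
        using P[of m] prod_zweight_nonzero[of k m n] a0 a(3) by (intro nn_integral_gvdm_box)
      then show ?thesis
        unfolding eq prod_zweight_Suc[symmetric] by (simp only: mult.assoc)
    qed
  qed
  finally show ?thesis .
qed

lemma extend_increasing:
  assumes n': "n' + low r + high r = Suc n"
    and v: "\<And>j. j < n' \<Longrightarrow> 0 < v j \<and> v j < 1" "\<And>j. Suc j < n' \<Longrightarrow> v j < v (Suc j)"
  defines "a \<equiv> extend (low r) n' v"
  shows "0 \<le> a 0" "a n \<le> 1" "\<And>j. j < n \<Longrightarrow> a j < a (Suc j)"
proof -
  have lh: "low r = 0 \<or> low r = 1" "high r = 0 \<or> high r = 1"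
    by (auto simp: low_def high_def split: sym.splits)
  show "0 \<le> a 0" using v(1)[of 0] by (auto simp: a_def extend_def)
  show "a n \<le> 1" using v(1)[of "n - low r"] by (auto simp: a_def extend_def)
  show "a j < a (Suc j)" if "j < n" for j
    using lh(1)
  proof
    assume l: "low r = 0"
    then show ?thesis using v(1)[of j] v(2)[of j] that n' lh(2) by (auto simp: a_def extend_def)
  next
    assume l: "low r = 1"
    show ?thesis
    proof (cases j)
      case 0
      then show ?thesis using l v(1)[of 0] by (auto simp: a_def extend_def)
    next
      case (Suc i)
      then show ?thesis using l v(1)[of i] v(2)[of i] that n' lh(2) by (auto simp: a_def extend_def)
    qed
  qed
qed

text \<open>Inside the unit interval a missing outer neighbour imposes the same condition as a
  neighbour with value 0 or 1.\<close>

lemma interlaced_iff_box: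
  assumes n': "n' + low r + high r = Suc n"
    and v: "\<And>j. j < n' \<Longrightarrow> 0 < v j \<and> v j < 1"
  defines "a \<equiv> extend (low r) n' v"
  shows "interlaced (<) (<) (low r) n n' u v \<and> (\<forall>i<n. 0 < u i \<and> u i < 1) \<longleftrightarrow>
    (\<forall>j<n. a j < u j \<and> u j < a (Suc j))" (is "?I \<and> ?U \<longleftrightarrow> ?B")
proof -
  have lh: "low r = 0 \<or> low r = 1" "high r = 0 \<or> high r = 1"
    by (auto simp: low_def high_def split: sym.splits)
  have lower: "a j = (if j < low r then 0 else v (j - low r))" "low r \<le> j \<Longrightarrow> j - low r < n'" if "j < n" for j
    using that n' lh by (auto simp: a_def extend_def)
  have upper: "a (Suc j) = (if Suc j - low r < n' then v (Suc j - low r) else 1)" for j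
    using lh(1) by (auto simp: a_def extend_def)
  have "(low r \<le> j \<and> j - low r < n' \<longrightarrow> v (j - low r) < u j) \<and> (j + 1 - low r < n' \<longrightarrow> u j < v (j + 1 - low r)) \<and>
      (0 < u j \<and> u j < 1) \<longleftrightarrow> a j < u j \<and> u j < a (Suc j)" if j: "j < n" for j
  proof -
    have "(low r \<le> j \<and> j - low r < n' \<longrightarrow> v (j - low r) < u j) \<and> 0 < u j \<longleftrightarrow> a j < u j"
      using lower[OF j] v[of "j - low r"] by (cases "j < low r") auto
    moreover have "(j + 1 - low r < n' \<longrightarrow> u j < v (j + 1 - low r)) \<and> u j < 1 \<longleftrightarrow> u j < a (Suc j)"
      using upper[of j] v[of "Suc j - low r"] by (cases "Suc j - low r < n'") auto
    ultimately show ?thesis by blast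
  qed
  then show ?thesis
    unfolding interlaced_def by blast
qed


section \<open>Bullet words built one label at a time\<close>

lemma labels_append [simp]: "labels (u @ v) = labels u @ labels v"
  by (simp add: labels_def)

lemma symbols_append [simp]: "symbols (u @ v) = symbols u @ symbols v"
  by (simp add: symbols_def)

lemma labels_Cons [simp]: "labels (Lab d # w) = d # labels w" "labels (Sym r # w) = labels w" "labels [] = []"
  by (simp_all add: labels_def)

lemma symbols_Cons [simp]: "symbols (Lab d # w) = symbols w" "symbols (Sym r # w) = r # symbols w" "symbols [] = []"
  by (simp_all add: symbols_def)

lemma bullet_word_Nil: "bullet_word [1] [] = [Lab Bullet]"
  by (simp add: bullet_word_def bullet_block_def)

lemma bullet_word_Suc:
  assumes "1 \<le> k"
  shows "bullet_word (ks @ [Suc k]) rs = bullet_word (ks @ [k]) rs @ [Sym SU, Lab Circ]"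
proof -
  have "concat (replicate k x) = concat (replicate (k - 1) x) @ x" for x :: "letter list"
    using assms by (cases k) (simp_all add: replicate_append_same[symmetric])
  then show ?thesis by (simp add: bullet_word_def bullet_block_def)
qed

lemma bullet_word_snoc:
  assumes "length ks = length rs"
  shows "bullet_word (ks @ [k, 1]) (rs @ [r]) = bullet_word (ks @ [k]) rs @ [Sym r, Lab Bullet]"
  using assms by (simp add: bullet_word_def bullet_block_def butlast_append)

text \<open>Appending \<open>[Sym SU, Lab Circ]\<close> raises the last entry of \<open>ks\<close>
  by one, and appending \<open>[Sym r, Lab Bullet]\<close> starts a new entry 1. The two induction
  steps follow this growth, so each adds exactly one column of the integral.\<close>

lemma bullet_word_induct [consumes 3, case_names Nil Circ Bullet]:
  assumes "length ks = Suc (length rs)" "\<forall>k\<in>set ks. 0 < k" "weakly_proper rs"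
    and "Q [1] []"
    and "\<And>ks k rs. length ks = length rs \<Longrightarrow> \<forall>i\<in>set ks. 0 < i \<Longrightarrow> 1 \<le> k \<Longrightarrow> weakly_proper rs \<Longrightarrow> Q (ks @ [k]) rs \<Longrightarrow> Q (ks @ [Suc k]) rs"
    and "\<And>ks k rs r. length ks = length rs \<Longrightarrow> \<forall>i\<in>set ks. 0 < i \<Longrightarrow> 1 \<le> k \<Longrightarrow> weakly_proper (rs @ [r]) \<Longrightarrow> Q (ks @ [k]) rs \<Longrightarrow>
      Q (ks @ [k, 1]) (rs @ [r])"
  shows "Q ks rs"
  using assms(1-3)
proof (induction rs arbitrary: ks rule: rev_induct)
  case Nil
  then obtain k where ks: "ks = [] @ [k]" "1 \<le> k" by (auto simp: length_Suc_conv)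
  have "Q ([] @ [k]) []"
    using ks(2)
  proof (induction k rule: dec_induct)
    case base
    then show ?case using assms(4) by simp
  next
    case (step k)
    then show ?case using assms(5)[of "[]" "[]" k] by simp
  qed
  with ks show ?case by simp
next
  case (snoc r rs)
  then obtain ks' k k' where ks: "ks = ks' @ [k, k']"
    by (metis append.assoc append_Cons append_Nil length_Suc_conv_rev length_append_singleton)
  have wp: "weakly_proper rs" using snoc.prems(3) by (simp add: weakly_proper_snoc)
  have len: "length ks' = length rs" and k: "1 \<le> k" "1 \<le> k'" using snoc.prems ks by auto
  have "Q (ks' @ [k]) rs" using snoc.prems(2) ks len wp by (intro snoc.IH) auto
  then have base: "Q ((ks' @ [k]) @ [1]) (rs @ [r])"
    using assms(6)[OF len _ k(1) snoc.prems(3)] snoc.prems(2) ks by simp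
  have "Q ((ks' @ [k]) @ [k']) (rs @ [r])"
    using k(2)
  proof (induction k' rule: dec_induct)
    case base
    then show ?case using \<open>Q ((ks' @ [k]) @ [1]) (rs @ [r])\<close> .
  next
    case (step k')
    show ?case by (rule assms(5)) (use step len snoc.prems ks in auto)
  qed
  with ks show ?case by simp
qed

lemma bullet_word_symbols:
  assumes "length ks = Suc (length rs)" "\<forall>k\<in>set ks. 0 < k" "weakly_proper rs"
  shows "length (labels (bullet_word ks rs)) = Suc (length (symbols (bullet_word ks rs))) \<and>
    weakly_proper (symbols (bullet_word ks rs)) \<and> weight (symbols (bullet_word ks rs)) = weight rs"
  using assms
proof (induction ks rs rule: bullet_word_induct)
  case Nil
  then show ?case by (simp add: bullet_word_Nil[unfolded One_nat_def])
next
  case (Circ ks k rs)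
  then show ?case
    using weakly_proper_weight[of rs] by (simp add: bullet_word_Suc weakly_proper_snoc)
next
  case (Bullet ks k rs r)
  then show ?case
    by (simp add: bullet_word_snoc weakly_proper_snoc del: One_nat_def)
qed

section \<open>The expansion along a bullet word\<close>

lemma prod_jweight:
  assumes "\<And>j. j < n \<Longrightarrow> 0 < v j \<and> v j < 1"
  shows "(\<Prod>j<n. jweight ds x (v j)) = ennreal (\<Prod>j<n. omega (ds ! x) (v j))"
proof -
  have "0 \<le> omega (ds ! x) (v j)" if "j < n" for j
    using assms[OF that] by (cases "ds ! x") auto
  then show ?thesis
    using assms by (subst prod_ennreal[symmetric]) (auto simp: jweight_def intro!: prod.cong)
qed

lemma prod_jweight_outside:
  fixes n :: nat
  assumes "j < n" "\<not> (0 < v j \<and> v j < 1)"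
  shows "(\<Prod>j<n. jweight ds x (v j)) = 0"
  using assms by (intro prod_zero) (auto simp: jweight_def)

text \<open>Expansion along the column of the node 0 removes the exponent 0, and every other column
  then contains a factor \<open>v j\<close>. This is the product that the densities
  \<open>1 / v j\<close> cancel.\<close>

lemma gvdm_extend_up:
  assumes m: "\<And>i. i < n \<Longrightarrow> 1 \<le> m i"
  shows "gvdm (Suc n) (extend 1 n v) (case_nat 0 m) = (\<Prod>j<n. v j) * gvdm n v (\<lambda>i. m i - 1)"
proof -
  have "gvdm (Suc n) (extend 1 n v) (case_nat 0 m) = fdet n (\<lambda>i j. v j ^ m i)"
    unfolding gvdm_def
  proof (subst fdet_first_col_unit)
    show "extend 1 n v 0 ^ case_nat 0 m (Suc i) = 0" if "i < n" for i
      using m[OF that] by (simp add: extend_def)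
    show "fdet n (\<lambda>i j. extend 1 n v (Suc j) ^ case_nat 0 m (Suc i)) = fdet n (\<lambda>i j. v j ^ m i)"
      by (intro fdet_cong) (simp add: extend_def)
  qed simp
  also have "\<dots> = fdet n (\<lambda>i j. v j * v j ^ (m i - 1))"
    using m by (intro fdet_cong) (metis Suc_diff_1 Suc_le_eq One_nat_def power_Suc)
  also have "\<dots> = (\<Prod>j<n. v j) * gvdm n v (\<lambda>i. m i - 1)"
    unfolding gvdm_def by (rule fdet_scale_cols)
  finally show ?thesis .
qed

lemma prod_zweight_0:
  fixes n :: nat
  shows "(\<Prod>i<n. zweight 0 (m i)) = (if \<forall>i<n. 1 \<le> m i then 1 else 0)"
proof (cases "\<forall>i<n. 1 \<le> m i")
  case True
  then show ?thesis by (auto simp: zweight_def intro!: prod.neutral)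
next
  case False
  then have "(\<Prod>i<n. zweight 0 (m i)) = 0"
    by (intro prod_zero) (auto simp: zweight_def)
  then show ?thesis unfolding if_not_P[OF False] .
qed

lemma nat_chain_pre_snoc:
  assumes "length ks = length rs"
  shows "nat_chain.pre (\<lambda>x. zweight ((ks @ [k, k']) ! x)) (rev (rs @ [r])) m' =
    (\<integral>\<^sup>+m. nat_chain.pre (\<lambda>x. zweight ((ks @ [k]) ! x)) (rev rs) m * (\<Prod>i<ncol rs. zweight k (m i)) *
      (if interlaced (<) (\<le>) (low r) (ncol rs) (ncol (rs @ [r])) m m' then 1 else 0)
      \<partial>count_space (\<Pi>\<^sub>E i\<in>{..<ncol rs}. UNIV))"
proof -
  have "nat_chain.pre (\<lambda>x. zweight ((ks @ [k, k']) ! x)) (rev rs) m = nat_chain.pre (\<lambda>x. zweight ((ks @ [k]) ! x)) (rev rs) m" for m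
    using assms by (intro nat_chain.pre_cong) (simp add: nth_append)
  moreover have "(\<Pi>\<^sub>M i\<in>{..<ncol rs}. count_space (UNIV :: nat set)) = count_space (\<Pi>\<^sub>E i\<in>{..<ncol rs}. UNIV)"
    by (rule count_space_PiM_finite) auto
  ultimately show ?thesis
    using assms by (simp add: nth_append)
qed

text \<open>Integrates out the last column of \<open>S\<close>, whose values run over the box with
  the extended nodes. \<open>pre\<close> weights only columns before the current one, which is why
  arbitrary labels \<open>es\<close> may be appended.\<close>

lemma real_chain_pre_snoc:
  assumes n': "n' + low r + high r = Suc n" and S: "ncol S = n" "ncol (S @ [r]) = n'"
    and H: "\<And>u. (\<And>i. i < n \<Longrightarrow> 0 < u i \<and> u i < 1) \<Longrightarrow> (\<And>i. Suc i < n \<Longrightarrow> u i < u (Suc i)) \<Longrightarrow>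
      real_chain.pre (jweight ds) (rev S) u * (\<Prod>i<n. jweight ds (length S) (u i)) =
      (\<integral>\<^sup>+m. P m * (\<Prod>i<n. zweight k (m i)) * ennreal (gvdm n u (\<lambda>i. m i - 1))
        \<partial>count_space (\<Pi>\<^sub>E i\<in>{..<n}. UNIV))"
    and P: "\<And>m i. P m \<noteq> 0 \<Longrightarrow> Suc i < n \<Longrightarrow> m i < m (Suc i)"
    and v: "\<And>j. j < n' \<Longrightarrow> 0 < v j \<and> v j < 1" "\<And>j. Suc j < n' \<Longrightarrow> v j < v (Suc j)"
    and ds: "length ds = Suc (length S)"
  shows "real_chain.pre (jweight (ds @ es)) (rev (S @ [r])) v =
    (\<integral>\<^sup>+m. P m * (\<Prod>i<n. zweight (Suc k) (m i)) * ennreal (gvdm (Suc n) (extend (low r) n' v) (case_nat 0 m))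
      \<partial>count_space (\<Pi>\<^sub>E i\<in>{..<n}. UNIV))"
proof -
  let ?a = "extend (low r) n' v"
  let ?H = "\<lambda>u. real_chain.pre (jweight ds) (rev S) u * (\<Prod>i<n. jweight ds (length S) (u i))"
  have w: "jweight (ds @ es) x = jweight ds x" if "x \<le> length S" for x
    using that ds by (simp add: fun_eq_iff jweight_def nth_append)
  have "real_chain.pre (jweight (ds @ es)) (rev S) u = real_chain.pre (jweight ds) (rev S) u" for u
    by (intro real_chain.pre_cong w) simp
  then have "real_chain.pre (jweight (ds @ es)) (rev (S @ [r])) v = (\<integral>\<^sup>+u. ?H u *
      (if interlaced (<) (<) (low r) n n' u v then 1 else 0) \<partial>(\<Pi>\<^sub>M j\<in>{..<n}. lborel))"
    using S by (simp add: w)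
  also have "\<dots> = (\<integral>\<^sup>+u. (if \<forall>j<n. ?a j < u j \<and> u j < ?a (Suc j) then ?H u else 0) \<partial>(\<Pi>\<^sub>M j\<in>{..<n}. lborel))"
  proof (intro nn_integral_cong)
    fix u :: "nat \<Rightarrow> real"
    note iff = interlaced_iff_box[where u = u and v = v, OF n' v(1)]
    show "?H u * (if interlaced (<) (<) (low r) n n' u v then 1 else 0) =
        (if \<forall>j<n. ?a j < u j \<and> u j < ?a (Suc j) then ?H u else 0)"
    proof (cases "\<forall>i<n. 0 < u i \<and> u i < 1")
      case True
      then have "(\<forall>j<n. ?a j < u j \<and> u j < ?a (Suc j)) \<longleftrightarrow> interlaced (<) (<) (low r) n n' u v"
        using iff by blast
      then show ?thesis by (simp only: if_distrib[of "(*) (?H u)"] mult_1_right mult_zero_right)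
    next
      case False
      then obtain j where "j < n" "\<not> (0 < u j \<and> u j < 1)" by blast
      then have "(\<Prod>i<n. jweight ds (length S) (u i)) = 0"
        by (rule prod_jweight_outside)
      then show ?thesis by (simp only: mult_zero_left mult_zero_right if_cancel)
    qed
  qed
  also have "\<dots> = (\<integral>\<^sup>+m. P m * (\<Prod>i<n. zweight (Suc k) (m i)) * ennreal (gvdm (Suc n) ?a (case_nat 0 m))
      \<partial>count_space (\<Pi>\<^sub>E i\<in>{..<n}. UNIV))"
    using extend_increasing[where v = v, OF n' v] by (intro nn_integral_box_expansion H P)
  finally show ?thesis .
qed

text \<open>The current column still has exponent \<open>last ks - 1\<close>: its last factor
  \<open>1 / m i\<close> arises only when this column is itself integrated, either in the next step
  or over the final box.\<close>

lemma pre_bullet_word: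
  assumes "length ks = Suc (length rs)" "\<forall>k\<in>set ks. 0 < k" "weakly_proper rs"
    and "\<And>j. j < ncol rs \<Longrightarrow> 0 < v j \<and> v j < 1" "\<And>j. Suc j < ncol rs \<Longrightarrow> v j < v (Suc j)"
  shows "real_chain.pre (jweight (labels (bullet_word ks rs))) (rev (symbols (bullet_word ks rs))) v *
      (\<Prod>i<ncol rs. jweight (labels (bullet_word ks rs)) (length (symbols (bullet_word ks rs))) (v i)) =
    (\<integral>\<^sup>+m. nat_chain.pre (\<lambda>x. zweight (ks ! x)) (rev rs) m * (\<Prod>i<ncol rs. zweight (last ks - 1) (m i)) *
      ennreal (gvdm (ncol rs) v (\<lambda>i. m i - 1)) \<partial>count_space (\<Pi>\<^sub>E i\<in>{..<ncol rs}. UNIV))"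
  using assms
proof (induction ks rs arbitrary: v rule: bullet_word_induct)
  case Nil
  have v: "\<And>j. j < 1 \<Longrightarrow> 0 < v j \<and> v j < 1" using Nil by simp
  \<comment> \<open>A fictitious empty column followed by \<open>SO\<close> has a single gap and
    hence one next point. With \<open>n = 0\<close> the interlacing lemma thus becomes the plain
    geometric series for \<open>1 / (1 - v 0)\<close>.\<close>
  have "gvdm (Suc 0) (extend (low SO) 1 v) (case_nat 0 m) = 1" for m
    unfolding gvdm_def by (subst fdet_first_col_unit) auto
  then have "(\<integral>\<^sup>+m. (if interlaced (<) (\<le>) (low SO) 0 1 (\<lambda>_. 0) m \<and> (\<forall>i<1. 1 \<le> m i)
      then ennreal (gvdm 1 v (\<lambda>i. m i - 1)) else 0) \<partial>count_space (\<Pi>\<^sub>E i\<in>{..<1}. UNIV)) =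
      ennreal (\<Prod>j<1. 1 / (1 - v j))"
    using nn_integral_gvdm_interlaced[of 1 SO 0 v "\<lambda>_. 0"] v by (simp add: low_def high_def)
  also have "\<dots> = (\<Prod>i<1. jweight [Bullet] 0 (v i))"
    using prod_jweight[where ds = "[Bullet]" and x = 0 and v = v and n = 1, OF v] by simp
  also have "(\<integral>\<^sup>+m. (if interlaced (<) (\<le>) (low SO) 0 1 (\<lambda>_. 0) m \<and> (\<forall>i<1. 1 \<le> m i)
      then ennreal (gvdm 1 v (\<lambda>i. m i - 1)) else 0) \<partial>count_space (\<Pi>\<^sub>E i\<in>{..<1}. UNIV)) =
      (\<integral>\<^sup>+m. (\<Prod>i<1. zweight 0 (m i)) * ennreal (gvdm 1 v (\<lambda>i. m i - 1)) \<partial>count_space (\<Pi>\<^sub>E i\<in>{..<1}. UNIV))"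
    unfolding prod_zweight_0 by (intro nn_integral_cong) (simp add: interlaced_def)
  finally show ?case
    unfolding bullet_word_Nil by simp
next
  case (Circ ks k rs)
  let ?W = "bullet_word (ks @ [k]) rs" and ?n = "ncol rs"
  let ?P = "\<lambda>m. nat_chain.pre (\<lambda>x. zweight ((ks @ [k]) ! x)) (rev rs) m"
  have W: "length (labels ?W) = Suc (length (symbols ?W))" "ncol (symbols ?W) = ?n" "weakly_proper (symbols ?W)"
    using bullet_word_symbols[of "ks @ [k]" rs] Circ by (auto simp: ncol_def)
  have P: "nat_chain.pre (\<lambda>x. zweight ((ks @ [Suc k]) ! x)) (rev rs) m = ?P m" for m
    using Circ(1) by (intro nat_chain.pre_cong) (simp add: nth_append)
  have pos: "\<And>j. j < ?n \<Longrightarrow> 0 < v j \<and> v j < 1" and inc: "\<And>j. Suc j < ?n \<Longrightarrow> v j < v (Suc j)"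
    using Circ.prems by auto
  have "real_chain.pre (jweight (labels ?W @ [Circ])) (rev (symbols ?W @ [SU])) v =
    (\<integral>\<^sup>+m. ?P m * (\<Prod>i<?n. zweight (Suc (k - 1)) (m i)) *
      ennreal (gvdm (Suc ?n) (extend (low SU) ?n v) (case_nat 0 m)) \<partial>count_space (\<Pi>\<^sub>E i\<in>{..<?n}. UNIV))"
  proof (rule real_chain_pre_snoc)
    show "?n + low SU + high SU = Suc ?n" by (simp add: low_def high_def)
    show "ncol (symbols ?W @ [SU]) = ?n" using W(2) by (simp add: ncol_def)
    show "real_chain.pre (jweight (labels ?W)) (rev (symbols ?W)) u * (\<Prod>i<?n. jweight (labels ?W) (length (symbols ?W)) (u i)) =
        (\<integral>\<^sup>+m. ?P m * (\<Prod>i<?n. zweight (k - 1) (m i)) * ennreal (gvdm ?n u (\<lambda>i. m i - 1))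
          \<partial>count_space (\<Pi>\<^sub>E i\<in>{..<?n}. UNIV))"
      if "\<And>i. i < ?n \<Longrightarrow> 0 < u i \<and> u i < 1" "\<And>i. Suc i < ?n \<Longrightarrow> u i < u (Suc i)" for u
      using Circ.IH[of u] that by simp
    show "m i < m (Suc i)" if "?P m \<noteq> 0" "Suc i < ?n" for m i
      by (rule nat_chain_pre_increasing[OF Circ(4) that])
  qed (use W pos inc in auto)
  also have "\<dots> = (\<integral>\<^sup>+m. ennreal (\<Prod>j<?n. v j) * (?P m * (\<Prod>i<?n. zweight k (m i)) *
      ennreal (gvdm ?n v (\<lambda>i. m i - 1))) \<partial>count_space (\<Pi>\<^sub>E i\<in>{..<?n}. UNIV))"
  proof (intro nn_integral_cong)
    fix m :: "nat \<Rightarrow> nat"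
    let ?Q = "\<Prod>i<?n. zweight k (m i)"
    have eq: "?Q * ennreal (gvdm (Suc ?n) (extend (low SU) ?n v) (case_nat 0 m)) =
        ?Q * (ennreal (\<Prod>j<?n. v j) * ennreal (gvdm ?n v (\<lambda>i. m i - 1)))"
    proof (cases "?Q = 0")
      case True
      then show ?thesis by (simp only: mult_zero_left)
    next
      case False
      have "gvdm (Suc ?n) (extend (low SU) ?n v) (case_nat 0 m) = (\<Prod>j<?n. v j) * gvdm ?n v (\<lambda>i. m i - 1)"
        using gvdm_extend_up[of ?n m v] prod_zweight_nonzero[OF False] by (simp add: low_def)
      moreover have "0 \<le> (\<Prod>j<?n. v j)"
        using pos by (intro prod_nonneg) (auto intro: less_imp_le)
      ultimately show ?thesis
        by (simp add: ennreal_mult')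
    qed
    have "Suc (k - 1) = k" using Circ(3) by simp
    then show "?P m * (\<Prod>i<?n. zweight (Suc (k - 1)) (m i)) *
        ennreal (gvdm (Suc ?n) (extend (low SU) ?n v) (case_nat 0 m)) =
      ennreal (\<Prod>j<?n. v j) * (?P m * ?Q * ennreal (gvdm ?n v (\<lambda>i. m i - 1)))"
      by (simp only: mult.assoc eq) (simp only: mult_ac)
  qed
  also have "\<dots> = ennreal (\<Prod>j<?n. v j) * (\<integral>\<^sup>+m. ?P m * (\<Prod>i<?n. zweight k (m i)) *
      ennreal (gvdm ?n v (\<lambda>i. m i - 1)) \<partial>count_space (\<Pi>\<^sub>E i\<in>{..<?n}. UNIV))"
    by (rule nn_integral_cmult) simp
  finally have pre: "real_chain.pre (jweight (labels ?W @ [Circ])) (rev (symbols ?W @ [SU])) v = \<dots>" .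
  have "(\<Prod>i<?n. jweight (labels ?W @ [Circ]) (length (symbols ?W @ [SU])) (v i)) =
      ennreal (\<Prod>j<?n. omega ((labels ?W @ [Circ]) ! length (symbols ?W @ [SU])) (v j))"
    using pos by (rule prod_jweight)
  also have "\<dots> = ennreal (\<Prod>j<?n. 1 / v j)"
    using W(1) by (simp add: nth_append)
  finally have w: "(\<Prod>i<?n. jweight (labels ?W @ [Circ]) (length (symbols ?W @ [SU])) (v i)) = ennreal (\<Prod>j<?n. 1 / v j)" .
  \<comment> \<open>The densities of the new column cancel the factors \<open>v j\<close> that came
    from the node 0, leaving the determinant with exponents \<open>m i - 1\<close>.\<close>
  have "ennreal (\<Prod>j<?n. v j) * ennreal (\<Prod>j<?n. 1 / v j) = ennreal (\<Prod>j<?n. v j * (1 / v j))"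
    unfolding prod.distrib using pos by (intro ennreal_mult''[symmetric] prod_nonneg) (auto intro: less_imp_le)
  also have "(\<Prod>j<?n. v j * (1 / v j)) = 1"
  proof (intro prod.neutral ballI)
    show "v j * (1 / v j) = 1" if "j \<in> {..<?n}" for j
      using pos[of j] that by simp
  qed
  finally have cancel: "ennreal (\<Prod>j<?n. v j) * ennreal (\<Prod>j<?n. 1 / v j) = 1" by simp
  have sym: "symbols (bullet_word (ks @ [Suc k]) rs) = symbols ?W @ [SU]"
    "labels (bullet_word (ks @ [Suc k]) rs) = labels ?W @ [Circ]"
    using Circ(3) by (simp_all add: bullet_word_Suc)
  have "c * X * d = X" if "c * d = 1" for c d X :: ennreal
    using that by (metis mult.assoc mult.commute mult_1)
  from this[OF cancel] show ?case
    unfolding sym pre w P by simp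
next
  case (Bullet ks k rs r)
  let ?W = "bullet_word (ks @ [k]) rs" and ?n = "ncol rs" and ?n' = "ncol (rs @ [r])"
  let ?P = "\<lambda>m. nat_chain.pre (\<lambda>x. zweight ((ks @ [k]) ! x)) (rev rs) m"
  let ?E = "\<lambda>m m'. if interlaced (<) (\<le>) (low r) ?n ?n' m m' then 1 else 0 :: ennreal"
  have wp: "weakly_proper rs" using Bullet(4) by (simp add: weakly_proper_snoc)
  have W: "length (labels ?W) = Suc (length (symbols ?W))" "ncol (symbols ?W) = ?n" "weight (symbols ?W) = weight rs"
    using bullet_word_symbols[of "ks @ [k]" rs] Bullet wp by (auto simp: ncol_def)
  have pos: "\<And>j. j < ?n' \<Longrightarrow> 0 < v j \<and> v j < 1" and inc: "\<And>j. Suc j < ?n' \<Longrightarrow> v j < v (Suc j)"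
    using Bullet.prems by auto
  have pre: "real_chain.pre (jweight (labels ?W @ [Bullet])) (rev (symbols ?W @ [r])) v =
    (\<integral>\<^sup>+m. ?P m * (\<Prod>i<?n. zweight (Suc (k - 1)) (m i)) *
      ennreal (gvdm (Suc ?n) (extend (low r) ?n' v) (case_nat 0 m)) \<partial>count_space (\<Pi>\<^sub>E i\<in>{..<?n}. UNIV))"
  proof (rule real_chain_pre_snoc)
    show "?n' + low r + high r = Suc ?n" by (rule ncol_snoc[OF Bullet(4)])
    show "ncol (symbols ?W @ [r]) = ?n'" using W(3) by (simp add: ncol_def)
    show "real_chain.pre (jweight (labels ?W)) (rev (symbols ?W)) u * (\<Prod>i<?n. jweight (labels ?W) (length (symbols ?W)) (u i)) =
        (\<integral>\<^sup>+m. ?P m * (\<Prod>i<?n. zweight (k - 1) (m i)) * ennreal (gvdm ?n u (\<lambda>i. m i - 1))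
          \<partial>count_space (\<Pi>\<^sub>E i\<in>{..<?n}. UNIV))"
      if "\<And>i. i < ?n \<Longrightarrow> 0 < u i \<and> u i < 1" "\<And>i. Suc i < ?n \<Longrightarrow> u i < u (Suc i)" for u
      using Bullet.IH[of u] that by simp
    show "m i < m (Suc i)" if "?P m \<noteq> 0" "Suc i < ?n" for m i
      by (rule nat_chain_pre_increasing[OF wp that])
  qed (use W pos inc in auto)
  have w: "(\<Prod>i<?n'. jweight (labels ?W @ [Bullet]) (length (symbols ?W @ [r])) (v i)) = ennreal (\<Prod>j<?n'. 1 / (1 - v j))"
    using W(1) by (subst prod_jweight[where v = v, OF pos]) (simp_all add: nth_append)
  have c0: "0 \<le> (\<Prod>j<?n'. 1 / (1 - v j))"
  proof (intro prod_nonneg ballI)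
    show "0 \<le> 1 / (1 - v j)" if "j \<in> {..<?n'}" for j
      using pos[of j] that by simp
  qed
  have if_conj: "(if A then 1 else 0) * ((if B then 1 else 0) * x) = (if A \<and> B then x else 0)" for A B and x :: ennreal
    by simp
  let ?R = "\<lambda>m'. (\<Prod>i<?n'. zweight 0 (m' i)) * ennreal (gvdm ?n' v (\<lambda>i. m' i - 1))"
  \<comment> \<open>The densities \<open>1 / (1 - v j)\<close> and the determinant on the extended
    nodes combine into a sum over the next index column \<open>m'\<close>. Its weight
    \<open>zweight 0\<close> records only positivity, the exponent being 0 so far.\<close>
  have expand: "?P m * (\<Prod>i<?n. zweight k (m i)) * ennreal (gvdm (Suc ?n) (extend (low r) ?n' v) (case_nat 0 m)) *
        ennreal (\<Prod>j<?n'. 1 / (1 - v j)) =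
      (\<integral>\<^sup>+m'. ?P m * (\<Prod>i<?n. zweight k (m i)) * ?E m m' * ?R m' \<partial>count_space (\<Pi>\<^sub>E i\<in>{..<?n'}. UNIV))" for m
  proof (cases "?P m * (\<Prod>i<?n. zweight k (m i)) = 0")
    case True
    then show ?thesis by (simp only: mult_zero_left nn_integral_const)
  next
    case False
    then have P0: "?P m \<noteq> 0" and z0: "(\<Prod>i<?n. zweight k (m i)) \<noteq> 0"
      by (metis mult_zero_left, metis mult_zero_right)
    have m1: "\<And>i. i < ?n \<Longrightarrow> 1 \<le> m i" and m2: "\<And>i. Suc i < ?n \<Longrightarrow> m i < m (Suc i)"
      using prod_zweight_nonzero[OF z0] nat_chain_pre_increasing[OF wp P0] by auto
    have "ennreal (gvdm (Suc ?n) (extend (low r) ?n' v) (case_nat 0 m)) * ennreal (\<Prod>j<?n'. 1 / (1 - v j)) =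
        ennreal ((\<Prod>j<?n'. 1 / (1 - v j)) * gvdm (Suc ?n) (extend (low r) ?n' v) (case_nat 0 m))"
      using c0 by (simp add: ennreal_mult' mult.commute)
    also have "\<dots> = (\<integral>\<^sup>+m'. (if interlaced (<) (\<le>) (low r) ?n ?n' m m' \<and> (\<forall>i<?n'. 1 \<le> m' i)
          then ennreal (gvdm ?n' v (\<lambda>i. m' i - 1)) else 0) \<partial>count_space (\<Pi>\<^sub>E i\<in>{..<?n'}. UNIV))"
      using nn_integral_gvdm_interlaced[where v = v and m = m, OF ncol_snoc[OF Bullet(4)] pos inc m1 m2] by simp
    also have "\<dots> = (\<integral>\<^sup>+m'. ?E m m' * ?R m' \<partial>count_space (\<Pi>\<^sub>E i\<in>{..<?n'}. UNIV))"
      unfolding prod_zweight_0 if_conj ..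
    finally have "ennreal (gvdm (Suc ?n) (extend (low r) ?n' v) (case_nat 0 m)) * ennreal (\<Prod>j<?n'. 1 / (1 - v j)) = \<dots>" .
    then show ?thesis
      by (simp only: mult.assoc nn_integral_cmult[symmetric] borel_measurable_count_space)
  qed
  have "real_chain.pre (jweight (labels ?W @ [Bullet])) (rev (symbols ?W @ [r])) v *
      (\<Prod>i<?n'. jweight (labels ?W @ [Bullet]) (length (symbols ?W @ [r])) (v i)) =
    (\<integral>\<^sup>+m. ?P m * (\<Prod>i<?n. zweight k (m i)) * ennreal (gvdm (Suc ?n) (extend (low r) ?n' v) (case_nat 0 m)) *
        ennreal (\<Prod>j<?n'. 1 / (1 - v j)) \<partial>count_space (\<Pi>\<^sub>E i\<in>{..<?n}. UNIV))"
    unfolding pre w using Bullet(3) by (subst nn_integral_multc[symmetric]) simp_all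
  also have "\<dots> = (\<integral>\<^sup>+m. (\<integral>\<^sup>+m'. ?P m * (\<Prod>i<?n. zweight k (m i)) * ?E m m' * ?R m'
      \<partial>count_space (\<Pi>\<^sub>E i\<in>{..<?n'}. UNIV)) \<partial>count_space (\<Pi>\<^sub>E i\<in>{..<?n}. UNIV))"
    unfolding expand ..
  also have "\<dots> = (\<integral>\<^sup>+m'. (\<integral>\<^sup>+m. ?P m * (\<Prod>i<?n. zweight k (m i)) * ?E m m' * ?R m'
      \<partial>count_space (\<Pi>\<^sub>E i\<in>{..<?n}. UNIV)) \<partial>count_space (\<Pi>\<^sub>E i\<in>{..<?n'}. UNIV))"
    by (intro nn_integral_count_space_nn_integral countable_PiE) auto
  also have "\<dots> = (\<integral>\<^sup>+m'. nat_chain.pre (\<lambda>x. zweight ((ks @ [k, 1]) ! x)) (rev (rs @ [r])) m' * ?R m'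
      \<partial>count_space (\<Pi>\<^sub>E i\<in>{..<?n'}. UNIV))"
    unfolding nat_chain_pre_snoc[OF Bullet(1)] by (subst nn_integral_multc) simp_all
  finally show ?case
    by (simp add: bullet_word_snoc[OF Bullet(1), unfolded One_nat_def] mult.assoc)
qed

section \<open>Convergence of the series\<close>

text \<open>With \<open>M\<close> the largest \<open>m p\<close>, the product of all \<open>m p ^ k p\<close> is at least \<open>M * \<Prod> m p\<close>, and
  \<open>M\<close> absorbs a factor \<open>m p powr (1 / card L)\<close> for each of the \<open>card L\<close> points.\<close>

lemma prod_inverse_power_le:
  fixes m :: "'a \<Rightarrow> nat"
  assumes L: "finite L" "L \<noteq> {}" and m: "\<And>p. p \<in> L \<Longrightarrow> 1 \<le> m p" and k: "\<And>p. p \<in> L \<Longrightarrow> 1 \<le> k p"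
    and top: "\<And>p. p \<in> L \<Longrightarrow> \<exists>q\<in>L. m p \<le> m q \<and> 2 \<le> k q"
  shows "(\<Prod>p\<in>L. 1 / real (m p) ^ k p) \<le> (\<Prod>p\<in>L. real (m p) powr (- 1 - 1 / card L))"
proof -
  let ?N = "card L"
  have N: "0 < ?N" using L by (simp add: card_gt_0_iff)
  have "Max (m ` L) \<in> m ` L"
    using L by (intro Max_in) auto
  then obtain p where p: "p \<in> L" "m p = Max (m ` L)"
    by (rule imageE) simp
  obtain q where q: "q \<in> L" "m p \<le> m q" "2 \<le> k q"
    using top[OF p(1)] by blast
  have max: "m x \<le> m q" if "x \<in> L" for x
    using Max_ge[of "m ` L" "m x"] L that p q by simp
  have pos: "0 < real (m x)" if "x \<in> L" for x using m[OF that] by simp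
  have "(\<Prod>x\<in>L. real (m x) powr (1 / ?N)) \<le> (\<Prod>x\<in>L. real (m q) powr (1 / ?N))"
    using max by (intro prod_mono conjI powr_mono2) auto
  also have "\<dots> = real (m q)"
    using pos[OF q(1)] N by (simp add: powr_realpow[symmetric] powr_powr)
  finally have le: "(\<Prod>x\<in>L. real (m x) powr (1 / ?N)) \<le> real (m q)" .
  have "(\<Prod>x\<in>L. real (m x) powr (1 + 1 / ?N)) = (\<Prod>x\<in>L. real (m x)) * (\<Prod>x\<in>L. real (m x) powr (1 / ?N))"
    unfolding prod.distrib[symmetric] using pos by (intro prod.cong) (auto simp: powr_add)
  also have "\<dots> \<le> (\<Prod>x\<in>L. real (m x)) * real (m q)"
    using le by (intro mult_left_mono prod_nonneg) auto
  \<comment> \<open>The extra factor \<open>m q\<close> is charged to the point \<open>q\<close>,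
    whose exponent is at least 2.\<close>
  also have "\<dots> = (\<Prod>x\<in>L. real (m x) * (if x = q then real (m q) else 1))"
    using L q(1) by (simp add: prod.distrib)
  also have "\<dots> \<le> (\<Prod>x\<in>L. real (m x) ^ k x)"
  proof (intro prod_mono conjI)
    fix x assume x: "x \<in> L"
    then have "real (m x) ^ (if x = q then 2 else 1) \<le> real (m x) ^ k x"
      using m[OF x] k[OF x] q(3) by (intro power_increasing) auto
    then show "real (m x) * (if x = q then real (m q) else 1) \<le> real (m x) ^ k x"
      by (simp add: power2_eq_square split: if_splits)
  qed simp
  finally have main: "(\<Prod>x\<in>L. real (m x) powr (1 + 1 / ?N)) \<le> (\<Prod>x\<in>L. real (m x) ^ k x)" .
  have "(\<Prod>x\<in>L. 1 / real (m x) ^ k x) = 1 / (\<Prod>x\<in>L. real (m x) ^ k x)"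
    by (simp add: prod_dividef)
  also have "\<dots> \<le> 1 / (\<Prod>x\<in>L. real (m x) powr (1 + 1 / ?N))"
    using main pos by (intro divide_left_mono mult_pos_pos prod_pos) auto
  also have "\<dots> = (\<Prod>x\<in>L. 1 / real (m x) powr (1 + 1 / ?N))"
    by (simp add: prod_dividef)
  also have "\<dots> = (\<Prod>x\<in>L. real (m x) powr (- 1 - 1 / ?N))"
    by (intro prod.cong) (auto simp: powr_minus_divide[symmetric])
  finally show ?thesis .
qed

section \<open>Maximal points and admissibility\<close>

lemma column_Suc:
  assumes "1 \<le> x" "x \<le> length rs"
  shows "column rs (Suc x) = next_column (rs ! (x - 1)) (column rs x)"
proof -
  have "take x rs = take (x - 1) rs @ [rs ! (x - 1)]"
    using assms take_Suc_conv_app_nth[of "x - 1" rs] by simp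
  then show ?thesis by (simp add: column_def)
qed

text \<open>\<open>SD\<close> or \<open>SC\<close> before the column would put
  \<open>(x - 1, y + 1)\<close> into the lattice, and \<open>SU\<close> or \<open>SO\<close> after
  it would put \<open>(x + 1, y + 1)\<close> there. What remains are the columns to which
  admissibility refers, the last one being subject to the further condition that the largest node is
  1.\<close>

lemma maximal_in_lattice:
  assumes L: "(x, y) \<in> lattice rs" and right: "(x + 1, y + 1) \<notin> lattice rs"
    and left: "x = 1 \<or> (x - 1, y + 1) \<notin> lattice rs"
  shows "x = 1 \<or> rs ! (x - 2) \<in> {SU, SO}" "x = length rs + 1 \<or> x \<le> length rs \<and> rs ! (x - 1) \<in> {SD, SC}"
proof -
  have x: "1 \<le> x" "x \<le> length rs + 1" and y: "y \<in> column rs x" using L by (auto simp: lattice_def)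
  show "x = 1 \<or> rs ! (x - 2) \<in> {SU, SO}"
  proof (cases "x = 1")
    case False
    then have "y \<in> next_column (rs ! (x - 2)) (column rs (x - 1))"
      using column_Suc[of "x - 1" rs] x y by (simp add: numeral_2_eq_2)
    moreover have "y + 1 \<notin> column rs (x - 1)"
      using left False x by (auto simp: lattice_def)
    ultimately show ?thesis by (cases "rs ! (x - 2)") auto
  qed simp
  show "x = length rs + 1 \<or> x \<le> length rs \<and> rs ! (x - 1) \<in> {SD, SC}"
  proof (cases "x = length rs + 1")
    case False
    then have "x \<le> length rs" using x by simp
    then have "y + 1 \<notin> next_column (rs ! (x - 1)) (column rs x)"
      using column_Suc[of x rs] right x by (auto simp: lattice_def)
    then show ?thesis using y \<open>x \<le> length rs\<close> by (cases "rs ! (x - 1)") auto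
  qed simp
qed

text \<open>Neighbours with a value at least as large lie one unit higher, on either side. Hence a
  point of greatest ordinate among those with value at least \<open>m p\<close> has neither.\<close>

lemma edge_ordered_maximal_above:
  fixes m :: "nat \<times> int \<Rightarrow> 'a :: order"
  assumes "weakly_proper rs" and ord: "edge_ordered (<) (\<le>) rs m" and p: "p \<in> lattice rs"
  shows "\<exists>x y. (x, y) \<in> lattice rs \<and> m p \<le> m (x, y) \<and> (x + 1, y + 1) \<notin> lattice rs \<and>
    (x = 1 \<or> (x - 1, y + 1) \<notin> lattice rs)"
proof -
  let ?A = "{q \<in> lattice rs. m p \<le> m q}"
  have A: "finite ?A" "p \<in> ?A" using finite_lattice[OF assms(1)] p by auto
  then have "snd ` ?A \<noteq> {}" by blast
  with A(1) have "Max (snd ` ?A) \<in> snd ` ?A" by (intro Max_in finite_imageI)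
  then obtain q where q': "Max (snd ` ?A) = snd q" "q \<in> ?A"
    by (rule imageE)
  define x y where "x = fst q" and "y = snd q"
  then have q: "(x, y) \<in> lattice rs" "m p \<le> m (x, y)" and y: "y = Max (snd ` ?A)"
    using q' by simp_all
  then have max: "snd q \<le> y" if "q \<in> ?A" for q
    unfolding y using A(1) that by (intro Max_ge) auto
  have "(x + 1, y + 1) \<notin> lattice rs"
  proof
    assume a: "(x + 1, y + 1) \<in> lattice rs"
    then have "m (x, y) < m (x + 1, y + 1)" using ord q(1) unfolding edge_ordered_def by blast
    then show False using max[of "(x + 1, y + 1)"] a q(2) by (auto dest: less_imp_le order_trans)
  qed
  moreover have "(x - 1, y + 1) \<notin> lattice rs" if "x \<noteq> 1"
  proof
    assume a: "(x - 1, y + 1) \<in> lattice rs"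
    have "1 \<le> x" using q(1) by (auto simp: lattice_def)
    then have "(x - 1 + 1, y + 1 - 1) = (x, y)" using that by simp
    then have "m (x, y) \<le> m (x - 1, y + 1)"
      using ord q(1) a unfolding edge_ordered_def by metis
    then show False using max[of "(x - 1, y + 1)"] a q(2) by (auto dest: order_trans)
  qed
  ultimately show ?thesis using q by blast
qed

lemma gen_det_last_column:
  assumes "weakly_proper rs"
  shows "gen_det ts (map (\<lambda>y. m (length rs + 1, y)) (last_column rs)) =
    gvdm (Suc (ncol rs)) ((!) ts) (case_nat 0 (\<lambda>i. m (pt rs i)))"
proof -
  have "gen_det ts (map (\<lambda>y. m (length rs + 1, y)) (last_column rs)) =
      fdet (Suc (ncol rs)) (\<lambda>i j. if i = 0 then 1 else ts ! j ^ (map (\<lambda>y. m (length rs + 1, y)) (last_column rs) ! (i - 1)))"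
    unfolding gen_det_def fdet_def by (simp add: last_column_eq[OF assms])
  also have "\<dots> = gvdm (Suc (ncol rs)) ((!) ts) (case_nat 0 (\<lambda>i. m (pt rs i)))"
    unfolding gvdm_def by (intro fdet_cong) (auto simp: last_column_eq[OF assms] pt_def split: nat.split)
  finally show ?thesis .
qed

text \<open>For a largest node \<open>T\<close> below 1, \<open>T ^ m \<le> B / m\<close> gains one
  power of the index in the last column.\<close>

lemma bounded_mult_power:
  fixes T :: real
  assumes "0 \<le> T" "T < 1"
  shows "\<exists>B>0. \<forall>m. real m * T ^ m \<le> B"
proof -
  have "(\<lambda>m. real m * T ^ m) \<longlonglongrightarrow> 0"
    using assms by (intro powser_times_n_limit_0) simp
  then have "Bseq (\<lambda>m. real m * T ^ m)"
    by (intro convergent_imp_Bseq convergentI)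
  then obtain B where "0 < B" "\<And>m. norm (real m * T ^ m) \<le> B"
    by (auto elim: BseqE)
  then show ?thesis
    by (metis abs_ge_self order_trans real_norm_def)
qed

lemma zeta_indices_eq:
  "zeta_indices rs = {m \<in> lattice rs \<rightarrow>\<^sub>E {1..}. edge_ordered (<) (\<le>) rs m}"
  by (simp add: zeta_indices_def edge_ordered_def)

lemma edge_ordered_last_increasing:
  fixes m :: "nat \<times> int \<Rightarrow> 'a :: order"
  assumes "weakly_proper rs" "edge_ordered (<) (\<le>) rs m" "Suc j < ncol rs"
  shows "m (pt rs j) < m (pt rs (Suc j))"
proof (cases rs rule: rev_cases)
  case Nil
  with assms show ?thesis by simp
next
  case (snoc rs' r)
  with assms show ?thesis
    using interlaced_increasing[OF ncol_snoc[of rs' r], of _ "\<lambda>j. m (pt rs j)" j] edge_ordered_snoc[of rs' r] by auto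
qed

lemma zeta_term_nonneg:
  assumes wp: "weakly_proper rs" and len: "length ts = Suc (ncol rs)"
    and ts: "0 \<le> hd ts" "sorted_wrt (<) ts"
    and m: "m \<in> zeta_indices rs"
  shows "0 \<le> gvdm (Suc (ncol rs)) ((!) ts) (case_nat 0 (\<lambda>i. m (pt rs i)))" "0 \<le> zeta_term ks rs ts m"
proof -
  have inc: "ts ! i < ts ! j" if "i < j" "j \<le> ncol rs" for i j
    using ts(2) that len by (simp add: sorted_wrt_iff_nth_less)
  have "0 \<le> ts ! 0" using ts(1) len by (cases ts) auto
  then have nonneg: "0 \<le> ts ! j" if "j \<le> ncol rs" for j
    using inc[of 0 j] that by (cases "j = 0") auto
  show *: "0 \<le> gvdm (Suc (ncol rs)) ((!) ts) (case_nat 0 (\<lambda>i. m (pt rs i)))"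
  proof (rule gvdm_case_nat_nonneg)
    show "1 \<le> m (pt rs i)" if "i < ncol rs" for i
      using m pt_in_lattice[OF wp that] by (auto simp: zeta_indices_eq PiE_iff)
    show "m (pt rs i) < m (pt rs (Suc i))" if "Suc i < ncol rs" for i
      using m that by (intro edge_ordered_last_increasing[OF wp]) (auto simp: zeta_indices_eq)
  qed (use inc nonneg in auto)
  show "0 \<le> zeta_term ks rs ts m"
    unfolding zeta_term_def gen_det_last_column[OF wp]
    by (intro mult_nonneg_nonneg * prod_nonneg) auto
qed

text \<open>The determinant is bounded by powers of the largest node. If that node is below 1, each
  index of the last column gains one power, recorded by \<open>d\<close> and the effective exponents
  \<open>k'\<close>. At a maximal point \<open>k'\<close> is at least 2, either through this gain or
  by admissibility, and every index is bounded by one at such a point.\<close>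

lemma zeta_term_bound:
  assumes ks: "length ks = Suc (length rs)" "\<forall>k\<in>set ks. 0 < k" and wp: "weakly_proper rs"
    and len: "length ts = Suc (ncol rs)"
    and ts: "0 \<le> hd ts" "sorted_wrt (<) ts" "last ts \<le> 1"
    and adm: "admissible ks rs ts"
  shows "\<exists>C\<ge>0. \<forall>m\<in>zeta_indices rs. zeta_term ks rs ts m \<le>
    C * (\<Prod>p\<in>lattice rs. real (m p) powr (- 1 - 1 / card (lattice rs)))"
proof -
  let ?n = "ncol rs" and ?T = "last ts" and ?L = "lattice rs"
  have inc: "ts ! i < ts ! j" if "i < j" "j \<le> ?n" for i j
    using ts(2) that len by (simp add: sorted_wrt_iff_nth_less)
  have T: "?T = ts ! ?n" using len by (subst last_conv_nth) auto
  have "0 \<le> ts ! 0" using ts(1) len by (cases ts) auto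
  then have nonneg: "0 \<le> ts ! j" if "j \<le> ?n" for j
    using inc[of 0 j] that by (cases "j = 0") auto
  have leT: "ts ! j \<le> ?T" if "j \<le> ?n" for j
    using inc[of j ?n] that T by (cases "j = ?n") auto
  define d :: nat where "d = (if ?T < 1 then 1 else 0)"
  obtain B where B: "0 \<le> B" "\<And>m. 1 \<le> m \<Longrightarrow> ?T ^ m \<le> B / real m ^ d"
  proof (cases "?T < 1")
    case True
    then obtain B where "0 < B" "\<forall>m. real m * ?T ^ m \<le> B"
      using bounded_mult_power[of ?T] nonneg[of ?n] T by auto
    then show ?thesis
      using that[of B] True by (auto simp: d_def field_simps)
  next
    case False
    then show ?thesis
      using that[of 1] ts(3) nonneg[of ?n] T by (auto simp: d_def)
  qed
  define k' where "k' p = ks ! (fst p - 1) + (if fst p = Suc (length rs) then d else 0)" for p :: "nat \<times> int"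
  have bound: "zeta_term ks rs ts m \<le> fact (Suc ?n) * B ^ ?n * (\<Prod>p\<in>?L. 1 / real (m p) ^ k' p)"
    if m: "m \<in> zeta_indices rs" for m
  proof -
    have m1: "1 \<le> m p" if "p \<in> ?L" for p
      using m that by (auto simp: zeta_indices_eq PiE_iff)
    let ?c = "case_nat 1 (\<lambda>i. B / real (m (pt rs i)) ^ d)"
    have "gvdm (Suc ?n) ((!) ts) (case_nat 0 (\<lambda>i. m (pt rs i))) \<le> fact (Suc ?n) * (\<Prod>i<Suc ?n. ?c i)"
      unfolding gvdm_def
    proof (rule order_trans[OF abs_ge_self abs_fdet_le])
      fix i j assume ij: "i < Suc ?n" "j < Suc ?n"
      show "\<bar>ts ! j ^ case_nat 0 (\<lambda>i. m (pt rs i)) i\<bar> \<le> ?c i"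
      proof (cases i)
        case (Suc i')
        have "ts ! j ^ m (pt rs i') \<le> ?T ^ m (pt rs i')"
          using nonneg[of j] leT[of j] ij by (intro power_mono) auto
        also have "\<dots> \<le> B / real (m (pt rs i')) ^ d"
          using Suc ij by (intro B(2) m1 pt_in_lattice[OF wp]) auto
        finally show ?thesis using Suc nonneg[of j] ij by simp
      qed simp
    qed
    also have "(\<Prod>i<Suc ?n. ?c i) = B ^ ?n * (\<Prod>i<?n. 1 / real (m (pt rs i)) ^ d)"
      unfolding prod.lessThan_Suc_shift by (simp add: prod_dividef)
    also have "(\<Prod>i<?n. 1 / real (m (pt rs i)) ^ d) = (\<Prod>p\<in>pt rs ` {..<?n}. 1 / real (m p) ^ d)"
      by (simp add: prod.reindex[OF inj_pt])
    also have "\<dots> = (\<Prod>p\<in>?L. if fst p = Suc (length rs) then 1 / real (m p) ^ d else 1)"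
    proof -
      have "pt rs ` {..<?n} = {p \<in> ?L. fst p = Suc (length rs)}"
        using last_column_lattice[OF wp] by (auto simp: pt_def image_iff)
      then show ?thesis
        using finite_lattice[OF wp] by (simp add: prod.inter_filter)
    qed
    finally have "zeta_term ks rs ts m \<le> fact (Suc ?n) * (B ^ ?n *
        (\<Prod>p\<in>?L. if fst p = Suc (length rs) then 1 / real (m p) ^ d else 1)) *
        (\<Prod>(x, y)\<in>?L. 1 / real (m (x, y)) ^ (ks ! (x - 1)))"
      unfolding zeta_term_def gen_det_last_column[OF wp]
      by (intro mult_right_mono prod_nonneg) auto
    also have "\<dots> = fact (Suc ?n) * B ^ ?n * ((\<Prod>p\<in>?L. if fst p = Suc (length rs) then 1 / real (m p) ^ d else 1) *
        (\<Prod>(x, y)\<in>?L. 1 / real (m (x, y)) ^ (ks ! (x - 1))))"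
      by (simp only: mult.assoc)
    also have "(\<Prod>p\<in>?L. if fst p = Suc (length rs) then 1 / real (m p) ^ d else 1) *
        (\<Prod>(x, y)\<in>?L. 1 / real (m (x, y)) ^ (ks ! (x - 1))) = (\<Prod>p\<in>?L. 1 / real (m p) ^ k' p)"
      unfolding prod.distrib[symmetric]
      by (intro prod.cong) (auto simp: k'_def power_add split: if_splits)
    finally show ?thesis .
  qed
  have le: "(\<Prod>p\<in>?L. 1 / real (m p) ^ k' p) \<le> (\<Prod>p\<in>?L. real (m p) powr (- 1 - 1 / card ?L))"
    if m: "m \<in> zeta_indices rs" for m
  proof (rule prod_inverse_power_le)
    show "finite ?L" by (rule finite_lattice[OF wp])
    show "?L \<noteq> {}" using pt_in_lattice[OF wp ncol_pos[OF wp]] by auto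
    show "1 \<le> m p" if "p \<in> ?L" for p
      using m that by (auto simp: zeta_indices_eq PiE_iff)
    show "1 \<le> k' p" if "p \<in> ?L" for p
    proof -
      have "ks ! (fst p - 1) \<in> set ks" using fst_lattice_le[OF that] ks(1) by (intro nth_mem) auto
      then show ?thesis using ks(2) by (fastforce simp: k'_def)
    qed
    show "\<exists>q\<in>?L. m p \<le> m q \<and> 2 \<le> k' q" if p: "p \<in> ?L" for p
    proof -
      obtain x y where q: "(x, y) \<in> ?L" "m p \<le> m (x, y)" "(x + 1, y + 1) \<notin> ?L"
        "x = 1 \<or> (x - 1, y + 1) \<notin> ?L"
        using edge_ordered_maximal_above[OF wp _ p, of m] m by (auto simp: zeta_indices_eq)
      note max = maximal_in_lattice[OF q(1,3,4)]
      have x: "x \<in> {1..length rs + 1}" using q(1) by (auto simp: lattice_def)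
      have "ks ! (x - 1) \<in> set ks" using x ks(1) by (intro nth_mem) auto
      then have k1: "0 < ks ! (x - 1)" using ks(2) by auto
      have "2 \<le> k' (x, y)"
      proof (cases "x = length rs + 1 \<and> ?T < 1")
        case True
        then show ?thesis using k1 by (simp add: k'_def d_def)
      next
        case False
        then have "x = length rs + 1 \<and> ?T = 1 \<or> x \<le> length rs \<and> rs ! (x - 1) \<in> {SD, SC}"
          using max(2) ts(3) by auto
        then have "1 < ks ! (x - 1)"
          using adm[unfolded admissible_def, rule_format, OF x] max(1) by blast
        then show ?thesis by (simp add: k'_def)
      qed
      then show ?thesis using q by blast
    qed
  qed
  show ?thesis
  proof (intro exI[of _ "fact (Suc ?n) * B ^ ?n"] conjI ballI)
    show "0 \<le> fact (Suc ?n) * B ^ ?n" using B(1) by simp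
    show "zeta_term ks rs ts m \<le> fact (Suc ?n) * B ^ ?n * (\<Prod>p\<in>?L. real (m p) powr (- 1 - 1 / card ?L))"
      if "m \<in> zeta_indices rs" for m
      using bound[OF that] mult_left_mono[OF le[OF that], of "fact (Suc ?n) * B ^ ?n"] B(1)
      by (meson order_trans fact_ge_zero mult_nonneg_nonneg zero_le_power)
  qed
qed

section \<open>The series and the integral as iterated sums and integrals\<close>

text \<open>The majorant factors over the lattice points. Extending the sum to all families
  therefore leaves a finite product of one-dimensional series with exponent below -1.\<close>

lemma nn_integral_zeta_finite:
  assumes ks: "length ks = Suc (length rs)" "\<forall>k\<in>set ks. 0 < k" and wp: "weakly_proper rs"
    and len: "length ts = Suc (ncol rs)"
    and ts: "0 \<le> hd ts" "sorted_wrt (<) ts" "last ts \<le> 1"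
    and adm: "admissible ks rs ts"
  shows "(\<integral>\<^sup>+m. ennreal (zeta_term ks rs ts m) \<partial>count_space (zeta_indices rs)) < \<infinity>"
proof -
  let ?L = "lattice rs"
  let ?h = "\<lambda>x::nat. real x powr (- 1 - 1 / card ?L)"
  have L: "finite ?L" "0 < card ?L"
    using finite_lattice[OF wp] pt_in_lattice[OF wp ncol_pos[OF wp]] by (auto simp: card_gt_0_iff)
  obtain C where C: "0 \<le> C" "\<And>m. m \<in> zeta_indices rs \<Longrightarrow> zeta_term ks rs ts m \<le> C * (\<Prod>p\<in>?L. ?h (m p))"
    using zeta_term_bound[OF assms] by blast
  \<comment> \<open>The index 0 contributes nothing, since \<open>0 powr a\<close> is 0 by
    convention.\<close>
  have "(\<integral>\<^sup>+x. ennreal (?h x) \<partial>count_space UNIV) = (\<Sum>x. ennreal (?h x))"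
    by (rule nn_integral_count_space_nat)
  also have "\<dots> < \<infinity>"
    using L(2) by (subst suminf_ennreal_eq[OF _ summable_sums]) (simp_all add: summable_real_powr_iff)
  finally have fin: "(\<integral>\<^sup>+x. ennreal (?h x) \<partial>count_space UNIV) < \<infinity>" .
  have "(\<integral>\<^sup>+m. ennreal (zeta_term ks rs ts m) \<partial>count_space (zeta_indices rs)) =
      (\<integral>\<^sup>+m. ennreal (zeta_term ks rs ts m) * indicator (zeta_indices rs) m \<partial>count_space (\<Pi>\<^sub>E p\<in>?L. UNIV))"
    by (subst (1 2) nn_integral_count_space_indicator)
       (auto intro!: nn_integral_cong simp: zeta_indices_eq PiE_iff split: split_indicator)
  also have "\<dots> \<le> (\<integral>\<^sup>+m. ennreal C * (\<Prod>p\<in>?L. ennreal (?h (m p))) \<partial>count_space (\<Pi>\<^sub>E p\<in>?L. UNIV))"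
  proof (intro nn_integral_mono)
    fix m :: "nat \<times> int \<Rightarrow> nat"
    show "ennreal (zeta_term ks rs ts m) * indicator (zeta_indices rs) m \<le> ennreal C * (\<Prod>p\<in>?L. ennreal (?h (m p)))"
    proof (cases "m \<in> zeta_indices rs")
      case True
      have "ennreal C * (\<Prod>p\<in>?L. ennreal (?h (m p))) = ennreal (C * (\<Prod>p\<in>?L. ?h (m p)))"
        using C(1) by (simp add: prod_ennreal ennreal_mult')
      then show ?thesis using C(2)[OF True] True by (simp add: ennreal_leI)
    qed simp
  qed
  also have "\<dots> = (\<integral>\<^sup>+m. ennreal C * (\<Prod>p\<in>?L. ennreal (?h (m p))) \<partial>(\<Pi>\<^sub>M p\<in>?L. count_space UNIV))"
    using L(1) by (subst count_space_PiM_finite) auto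
  also have "\<dots> = ennreal C * (\<integral>\<^sup>+m. (\<Prod>p\<in>?L. ennreal (?h (m p))) \<partial>(\<Pi>\<^sub>M p\<in>?L. count_space UNIV))"
    by (intro nn_integral_cmult borel_measurable_prod_ennreal measurable_compose[OF measurable_component_singleton]) auto
  also have "(\<integral>\<^sup>+m. (\<Prod>p\<in>?L. ennreal (?h (m p))) \<partial>(\<Pi>\<^sub>M p\<in>?L. count_space UNIV)) =
      (\<Prod>p\<in>?L. \<integral>\<^sup>+x. ennreal (?h x) \<partial>count_space UNIV)"
    by (rule nat_chain.P.product_nn_integral_prod[OF L(1)]) simp
  also have "ennreal C * \<dots> < \<infinity>"
    using fin by (simp add: ennreal_mult_less_top power_less_top_ennreal)
  finally show ?thesis .
qed

lemma nn_integral_zeta: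
  assumes wp: "weakly_proper rs" and len: "length ts = Suc (ncol rs)"
    and ts: "0 \<le> hd ts" "sorted_wrt (<) ts"
  shows "(\<integral>\<^sup>+m. ennreal (zeta_term ks rs ts m) \<partial>count_space (zeta_indices rs)) =
    (\<integral>\<^sup>+m. nat_chain.pre (\<lambda>x. zweight (ks ! x)) (rev rs) m * (\<Prod>i<ncol rs. zweight (ks ! length rs) (m i)) *
      ennreal (gvdm (Suc (ncol rs)) ((!) ts) (case_nat 0 m)) \<partial>count_space (\<Pi>\<^sub>E i\<in>{..<ncol rs}. UNIV))"
proof -
  let ?L = "lattice rs" and ?n = "ncol rs"
  let ?g = "\<lambda>m. ennreal (gvdm (Suc ?n) ((!) ts) (case_nat 0 m))"
  let ?F = "\<lambda>m. (if edge_ordered (<) (\<le>) rs m then 1 else 0) * (\<Prod>p\<in>?L. zweight (ks ! (fst p - 1)) (m p)) *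
      ?g (\<lambda>j\<in>{..<?n}. m (pt rs j))"
  have pim: "(\<Pi>\<^sub>M i\<in>I. count_space (UNIV :: nat set)) = count_space (\<Pi>\<^sub>E i\<in>I. UNIV)" if "finite I" for I :: "'i set"
    using that by (rule count_space_PiM_finite) simp
  have F: "?F m = ennreal (zeta_term ks rs ts m) * indicator (zeta_indices rs) m" if "m \<in> (\<Pi>\<^sub>E p\<in>?L. UNIV)" for m
  proof (cases "m \<in> zeta_indices rs")
    case True
    then have m1: "1 \<le> m p" if "p \<in> ?L" for p
      using that by (auto simp: zeta_indices_eq PiE_iff)
    have "(\<Prod>p\<in>?L. zweight (ks ! (fst p - 1)) (m p)) = ennreal (\<Prod>p\<in>?L. 1 / real (m p) ^ (ks ! (fst p - 1)))"
      using m1 by (subst prod_ennreal[symmetric]) (auto simp: zweight_def intro!: prod.cong)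
    moreover have "gvdm (Suc ?n) ((!) ts) (case_nat 0 (\<lambda>j\<in>{..<?n}. m (pt rs j))) =
        gvdm (Suc ?n) ((!) ts) (case_nat 0 (\<lambda>i. m (pt rs i)))"
      by (rule gvdm_cong) (auto split: nat.split)
    moreover have "zeta_term ks rs ts m = gvdm (Suc ?n) ((!) ts) (case_nat 0 (\<lambda>i. m (pt rs i))) *
        (\<Prod>p\<in>?L. 1 / real (m p) ^ (ks ! (fst p - 1)))"
      unfolding zeta_term_def gen_det_last_column[OF wp] by (simp add: case_prod_beta)
    ultimately show ?thesis
      using True zeta_term_nonneg(1)[OF wp len ts True]
      by (simp add: zeta_indices_eq ennreal_mult' mult.commute)
  next
    case False
    \<comment> \<open>An extensional family outside the index set breaks an order condition or takes
      the value 0, where \<open>zweight\<close> vanishes.\<close>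
    then have "\<not> edge_ordered (<) (\<le>) rs m \<or> (\<exists>p\<in>?L. m p = 0)"
      using that by (auto simp: zeta_indices_eq PiE_iff Suc_le_eq)
    then have "?F m = 0"
    proof
      assume "\<exists>p\<in>?L. m p = 0"
      then obtain p where "p \<in> ?L" "m p = 0" by blast
      then have "(\<Prod>p\<in>?L. zweight (ks ! (fst p - 1)) (m p)) = 0"
        using finite_lattice[OF wp] by (intro prod_zero bexI[of _ p]) (simp_all add: zweight_def)
      then show ?thesis by (simp only: mult_zero_left mult_zero_right)
    qed simp
    with False show ?thesis by simp
  qed
  have "(\<integral>\<^sup>+m. ennreal (zeta_term ks rs ts m) \<partial>count_space (zeta_indices rs)) =
      (\<integral>\<^sup>+m. ennreal (zeta_term ks rs ts m) * indicator (zeta_indices rs) m \<partial>count_space (\<Pi>\<^sub>E p\<in>?L. UNIV))"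
    by (subst (1 2) nn_integral_count_space_indicator)
       (auto intro!: nn_integral_cong simp: zeta_indices_eq PiE_iff split: split_indicator)
  also have "\<dots> = (\<integral>\<^sup>+m. ?F m \<partial>count_space (\<Pi>\<^sub>E p\<in>?L. UNIV))"
    using F by (intro nn_integral_cong) simp
  also have "\<dots> = (\<integral>\<^sup>+m. ?F m \<partial>(\<Pi>\<^sub>M p\<in>?L. count_space UNIV))"
    by (simp only: pim[OF finite_lattice[OF wp]])
  also have "\<dots> = (\<integral>\<^sup>+m. nat_chain.pre (\<lambda>x. zweight (ks ! x)) (rev rs) m * (\<Prod>i<?n. zweight (ks ! length rs) (m i)) *
      ?g m \<partial>(\<Pi>\<^sub>M i\<in>{..<?n}. count_space UNIV))"
    using wp by (rule nat_chain.nn_integral_lattice) (simp_all add: pim)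
  finally show ?thesis by (simp only: pim[OF finite_lessThan])
qed

section \<open>Null sets and the domain of integration\<close>

lemma AE_PiM_neq:
  fixes c :: real
  assumes "finite L" "p \<in> L"
  shows "AE t in (\<Pi>\<^sub>M q\<in>L. lborel). t p \<noteq> c"
proof -
  let ?A = "\<lambda>q. if q = p then {c} else UNIV"
  have "emeasure (\<Pi>\<^sub>M q\<in>L. lborel) (Pi\<^sub>E L ?A) = (\<Prod>q\<in>L. emeasure lborel (?A q))"
    using assms(1) by (intro real_chain.P.emeasure_PiM) auto
  also have "\<dots> = 0"
    using assms by (intro prod_zero) (auto intro!: bexI[of _ p])
  finally have "emeasure (\<Pi>\<^sub>M q\<in>L. lborel) (Pi\<^sub>E L ?A) = 0" .
  moreover have "Pi\<^sub>E L ?A \<in> sets (\<Pi>\<^sub>M q\<in>L. lborel)"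
    using assms(1) by (intro sets_PiM_I_finite) auto
  ultimately show ?thesis
    using assms(2) by (intro AE_I[where N = "Pi\<^sub>E L ?A"]) (auto simp: space_PiM PiE_iff extensional_def)
qed

text \<open>Strict inequalities along generating pairs propagate along paths by transitivity.
  Conversely, a generating pair consists of distinct points and so is itself a strict
  relation.\<close>

lemma poset_less_iff_edge_ordered:
  fixes t :: "nat \<times> int \<Rightarrow> 'a :: order"
  shows "(\<forall>p\<in>lattice (symbols w). \<forall>q\<in>lattice (symbols w). poset_less w p q \<longrightarrow> t p < t q) \<longleftrightarrow>
    edge_ordered (<) (<) (symbols w) t" (is "?P \<longleftrightarrow> ?E")
proof
  assume P: ?P
  have gen: "t p < t q" if "(p, q) \<in> poset_gen w" "p \<noteq> q" for p q
  proof -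
    have "p \<in> lattice (symbols w)" "q \<in> lattice (symbols w)"
      using that(1) by (auto simp: poset_gen_def)
    then show ?thesis
      using P that by (auto simp: poset_less_def)
  qed
  show ?E
    unfolding edge_ordered_def
  proof (intro conjI allI impI)
    fix x y
    show "t (x, y) < t (x + 1, y + 1)" if "(x, y) \<in> lattice (symbols w) \<and> (x + 1, y + 1) \<in> lattice (symbols w)"
      by (rule gen) (use that in \<open>auto simp: poset_gen_def\<close>)
    show "t (x + 1, y - 1) < t (x, y)" if "(x, y) \<in> lattice (symbols w) \<and> (x + 1, y - 1) \<in> lattice (symbols w)"
      by (rule gen) (use that in \<open>auto simp: poset_gen_def\<close>)
  qed
next
  assume E: ?E
  have gen: "t p < t q" if "(p, q) \<in> poset_gen w" for p q
    using that E unfolding poset_gen_def edge_ordered_def by auto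
  have "t p < t q" if "(p, q) \<in> (poset_gen w)\<^sup>+" for p q
    using that by (induction rule: trancl_induct) (auto intro: gen less_trans)
  then show ?P
    by (auto simp: poset_less_def rtrancl_eq_or_trancl)
qed

lemma J_domain_eq:
  assumes wp: "weakly_proper (symbols w)"
  shows "J_domain w us = {t \<in> space (J_measure w).
    (\<forall>p\<in>lattice (symbols w). fst p \<le> length (symbols w) \<longrightarrow> t p \<in> {0..1}) \<and>
    (\<forall>i<ncol (symbols w). t (pt (symbols w) i) \<in> {us ! i .. us ! (i + 1)}) \<and>
    edge_ordered (<) (<) (symbols w) t}"
  unfolding J_domain_def poset_less_iff_edge_ordered
  by (auto simp: space_PiM last_column_eq[OF wp] pt_def)

lemma measurable_component_real:
  "p \<in> L \<Longrightarrow> (\<lambda>t. t p) \<in> borel_measurable (\<Pi>\<^sub>M q\<in>L. (lborel :: real measure))"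
  using measurable_component_singleton[of p L "\<lambda>_. lborel :: real measure"] by simp

lemma sets_J_domain:
  assumes wp: "weakly_proper (symbols w)"
  shows "J_domain w us \<in> sets (J_measure w)"
proof -
  let ?M = "J_measure w"
  have "Measurable.pred ?M (\<lambda>t. \<forall>p\<in>lattice (symbols w). fst p \<le> length (symbols w) \<longrightarrow> t p \<in> {0..1})"
  proof (intro pred_intros_finite(3) pred_intros_imp' finite_lattice[OF wp])
    fix p assume "p \<in> lattice (symbols w)"
    note [measurable] = measurable_component_real[OF this]
    show "Measurable.pred ?M (\<lambda>t. t p \<in> {0..1})" by measurable
  qed
  moreover have "Measurable.pred ?M (\<lambda>t. \<forall>i<ncol (symbols w). t (pt (symbols w) i) \<in> {us ! i .. us ! (i + 1)})"
  proof (intro real_chain.pred_bounded)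
    fix i assume "i < ncol (symbols w)"
    note [measurable] = measurable_component_real[OF pt_in_lattice[OF wp this]]
    show "Measurable.pred ?M (\<lambda>t. t (pt (symbols w) i) \<in> {us ! i .. us ! (i + 1)})" by measurable
  qed
  ultimately show ?thesis
    unfolding J_domain_eq[OF wp]
    by (intro predE pred_intros_logic real_chain.pred_edge_ordered[OF wp])
qed

lemma measurable_J_integrand:
  "J_integrand w \<in> borel_measurable (J_measure w)"
  unfolding J_integrand_def[abs_def]
  by (intro borel_measurable_prod measurable_compose[OF measurable_component_real measurable_omega])

lemma omega_nonneg: "0 \<le> t \<Longrightarrow> t \<le> 1 \<Longrightarrow> 0 \<le> omega d t"
  by (cases d) auto

lemma J_domain_unit_interval:
  assumes wp: "weakly_proper (symbols w)" and len: "length us = Suc (ncol (symbols w))"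
    and us: "0 \<le> hd us" "sorted_wrt (<) us" "last us \<le> 1"
    and t: "t \<in> J_domain w us" and p: "p \<in> lattice (symbols w)"
  shows "0 \<le> t p" "t p \<le> 1"
proof -
  let ?n = "ncol (symbols w)"
  have "0 \<le> t p \<and> t p \<le> 1"
  proof (cases "fst p \<le> length (symbols w)")
    case True
    then show ?thesis using t p by (auto simp: J_domain_eq[OF wp])
  next
    case False
    then obtain j where j: "j < ?n" "p = pt (symbols w) j"
      using p fst_lattice_le[OF p] last_column_lattice[OF wp, of "snd p"]
      by (cases p) (auto simp: pt_def le_Suc_eq)
    have inc: "us ! i \<le> us ! j" if "i \<le> j" "j \<le> ?n" for i j
      using us(2) that len by (cases "i = j") (auto simp: sorted_wrt_iff_nth_less less_imp_le)
    have "0 \<le> us ! 0" "us ! ?n \<le> 1"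
      using us(1,3) len hd_conv_nth[of us] last_conv_nth[of us] by force+
    then have "0 \<le> us ! j" "us ! (j + 1) \<le> 1"
      using inc[of 0 j] inc[of "j + 1" ?n] j(1) by auto
    then show ?thesis using t j by (auto simp: J_domain_eq[OF wp])
  qed
  then show "0 \<le> t p" "t p \<le> 1" by auto
qed

text \<open>Off the null set where a coordinate equals 0, 1 or a node, closed and open intervals
  agree. The domain then splits into edge conditions, unit interval and final box, the separate
  factors that \<open>nn_integral_lattice\<close> expects.\<close>

lemma AE_J_integrand:
  assumes wp: "weakly_proper (symbols w)" and len: "length us = Suc (ncol (symbols w))"
    and us: "0 \<le> hd us" "sorted_wrt (<) us" "last us \<le> 1"
  shows "AE t in J_measure w. ennreal (indicator (J_domain w us) t * J_integrand w t) =
    (if edge_ordered (<) (<) (symbols w) t then 1 else 0) *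
    (\<Prod>p\<in>lattice (symbols w). jweight (labels w) (fst p - 1) (t p)) *
    (if \<forall>j<ncol (symbols w). us ! j < t (pt (symbols w) j) \<and> t (pt (symbols w) j) < us ! Suc j then 1 else 0)"
proof -
  let ?L = "lattice (symbols w)" and ?n = "ncol (symbols w)" and ?E = "edge_ordered (<) (<) (symbols w)"
  let ?B = "\<lambda>t. \<forall>j<?n. us ! j < t (pt (symbols w) j) \<and> t (pt (symbols w) j) < us ! Suc j"
  have fin: "finite ?L" by (rule finite_lattice[OF wp])
  have "AE t in J_measure w. \<forall>p\<in>?L. \<forall>c\<in>{0, 1} \<union> set us. t p \<noteq> c"
    by (intro AE_finite_allI fin AE_PiM_neq) auto
  then show ?thesis
  proof (rule AE_mp, intro AE_I2 impI)
    fix t assume sp: "t \<in> space (J_measure w)" and ne: "\<forall>p\<in>?L. \<forall>c\<in>{0, 1} \<union> set us. t p \<noteq> c"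
    show "ennreal (indicator (J_domain w us) t * J_integrand w t) = (if ?E t then 1 else 0) *
        (\<Prod>p\<in>?L. jweight (labels w) (fst p - 1) (t p)) * (if ?B t then 1 else 0)"
    proof (cases "t \<in> J_domain w us")
      case True
      have unit: "0 < t p" "t p < 1" if "p \<in> ?L" for p
        using J_domain_unit_interval[OF wp len us True that] ne that by (auto simp: less_le)
      have "?B t"
      proof (intro allI impI)
        fix j assume j: "j < ?n"
        then have "t (pt (symbols w) j) \<in> {us ! j .. us ! Suc j}"
          using True by (auto simp: J_domain_eq[OF wp])
        moreover have "t (pt (symbols w) j) \<noteq> us ! j" "t (pt (symbols w) j) \<noteq> us ! Suc j"
          using ne pt_in_lattice[OF wp j] j len by auto
        ultimately show "us ! j < t (pt (symbols w) j) \<and> t (pt (symbols w) j) < us ! Suc j" by auto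
      qed
      moreover have "?E t"
        using True by (auto simp: J_domain_eq[OF wp])
      moreover have "(\<Prod>p\<in>?L. jweight (labels w) (fst p - 1) (t p)) = ennreal (J_integrand w t)"
      proof -
        have "(\<Prod>p\<in>?L. jweight (labels w) (fst p - 1) (t p)) =
            (\<Prod>p\<in>?L. ennreal (omega (labels w ! (fst p - 1)) (t p)))"
          using unit by (intro prod.cong) (auto simp: jweight_def)
        also have "\<dots> = ennreal (J_integrand w t)"
          unfolding J_integrand_def poset_label_def
          by (intro prod_ennreal omega_nonneg less_imp_le unit)
        finally show ?thesis .
      qed
      ultimately show ?thesis
        using True by simp
    next
      case False
      have "(if ?E t then 1 else 0) * (\<Prod>p\<in>?L. jweight (labels w) (fst p - 1) (t p)) * (if ?B t then 1 else 0) = (0 :: ennreal)"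
      proof (rule ccontr)
        assume "\<not> ?thesis"
        then have E: "?E t" and B: "?B t" and w: "(\<Prod>p\<in>?L. jweight (labels w) (fst p - 1) (t p)) \<noteq> 0"
          by (auto split: if_splits)
        have nz: "jweight (labels w) (fst p - 1) (t p) \<noteq> 0" if "p \<in> ?L" for p
          using w fin that by (metis prod_zero)
        have "0 < t p \<and> t p < 1" if "p \<in> ?L" for p
          using nz[OF that] by (auto simp: jweight_def split: if_splits)
        then have "t \<in> J_domain w us"
          using E B sp by (auto simp: J_domain_eq[OF wp] less_imp_le)
        with False show False by simp
      qed
      with False show ?thesis by simp
    qed
  qed
qed

lemma nn_integral_J:
  assumes wp: "weakly_proper (symbols w)" and len: "length us = Suc (ncol (symbols w))"
    and us: "0 \<le> hd us" "sorted_wrt (<) us" "last us \<le> 1"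
  shows "(\<integral>\<^sup>+t. ennreal (indicator (J_domain w us) t * J_integrand w t) \<partial>J_measure w) =
    (\<integral>\<^sup>+v. (if \<forall>j<ncol (symbols w). us ! j < v j \<and> v j < us ! Suc j
        then real_chain.pre (jweight (labels w)) (rev (symbols w)) v *
          (\<Prod>i<ncol (symbols w). jweight (labels w) (length (symbols w)) (v i)) else 0)
      \<partial>(\<Pi>\<^sub>M i\<in>{..<ncol (symbols w)}. lborel))"
proof -
  let ?S = "symbols w" and ?n = "ncol (symbols w)"
  let ?g = "\<lambda>v. if \<forall>j<?n. us ! j < v j \<and> v j < us ! Suc j then 1 else 0 :: ennreal"
  have g: "?g \<in> borel_measurable (\<Pi>\<^sub>M i\<in>{..<?n}. lborel)"
    by (intro measurable_If predE pred_box measurable_const) simp_all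
  have "(\<integral>\<^sup>+t. ennreal (indicator (J_domain w us) t * J_integrand w t) \<partial>J_measure w) =
      (\<integral>\<^sup>+t. (if edge_ordered (<) (<) ?S t then 1 else 0) *
        (\<Prod>p\<in>lattice ?S. jweight (labels w) (fst p - 1) (t p)) *
        ?g (\<lambda>j\<in>{..<?n}. t (pt ?S j)) \<partial>J_measure w)"
    using AE_J_integrand[OF assms] by (intro nn_integral_cong_AE) (auto elim!: eventually_mono cong: if_cong all_cong)
  also have "\<dots> = (\<integral>\<^sup>+v. real_chain.pre (jweight (labels w)) (rev ?S) v *
      (\<Prod>i<?n. jweight (labels w) (length ?S) (v i)) * ?g v \<partial>(\<Pi>\<^sub>M i\<in>{..<?n}. lborel))"
    by (rule real_chain.nn_integral_lattice[OF wp measurable_jweight g])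
  also have "\<dots> = (\<integral>\<^sup>+v. (if \<forall>j<?n. us ! j < v j \<and> v j < us ! Suc j
      then real_chain.pre (jweight (labels w)) (rev ?S) v * (\<Prod>i<?n. jweight (labels w) (length ?S) (v i)) else 0)
      \<partial>(\<Pi>\<^sub>M i\<in>{..<?n}. lborel))"
    by (simp only: if_distrib[of "(*) _"] mult_1_right mult_zero_right)
  finally show ?thesis .
qed

text \<open>Summability and integrability belong to the conclusion because \<open>zeta\<close> and
  \<open>J\<close> take the default value 0 without them, so that the equation alone would say less
  than intended.\<close>

theorem theorem3p3:
  fixes s :: nat and ks :: "nat list" and rs :: "sym list" and ts :: "real list"
  assumes "length ks = s + 1" and "\<forall>k\<in>set ks. k > 0"
    and "length rs = s" and "weakly_proper rs"
    and "int (length ts) = weight rs + 2"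
    and "0 \<le> hd ts" and "sorted_wrt (<) ts" and "last ts \<le> 1"
    and "admissible ks rs ts"
  shows "zeta_term ks rs ts summable_on zeta_indices rs \<and>
         set_integrable (J_measure (bullet_word ks rs)) (J_domain (bullet_word ks rs) ts)
           (J_integrand (bullet_word ks rs)) \<and>
         zeta ks rs ts = J (bullet_word ks rs) ts"
proof -
  let ?w = "bullet_word ks rs" and ?n = "ncol rs"
  note pos = assms(2) and wp = assms(4) and ts = assms(6-8)
  have ks: "length ks = Suc (length rs)" using assms(1,3) by simp
  have len: "length ts = Suc ?n"
    using assms(5) weakly_proper_weight[OF wp] by (simp add: ncol_def)
  have W: "weakly_proper (symbols ?w)" "ncol (symbols ?w) = ?n"
    using bullet_word_symbols[OF ks pos wp] by (auto simp: ncol_def)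
  have inc: "ts ! i < ts ! j" if "i < j" "j \<le> ?n" for i j
    using ts(2) that len by (simp add: sorted_wrt_iff_nth_less)
  have ends: "0 \<le> ts ! 0" "ts ! ?n \<le> 1"
    using ts(1,3) len hd_conv_nth[of ts] last_conv_nth[of ts] by force+
  have last: "ks ! length rs = last ks" "Suc (last ks - 1) = last ks"
  proof -
    have "ks \<noteq> []" using ks by auto
    then show "ks ! length rs = last ks" "Suc (last ks - 1) = last ks"
      using ks pos last_in_set[of ks] by (auto simp: last_conv_nth)
  qed
  let ?f = "\<lambda>t. indicator (J_domain ?w ts) t * J_integrand ?w t"
  have "(\<integral>\<^sup>+t. ennreal (?f t) \<partial>J_measure ?w) =
      (\<integral>\<^sup>+v. (if \<forall>j<?n. ts ! j < v j \<and> v j < ts ! Suc j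
        then real_chain.pre (jweight (labels ?w)) (rev (symbols ?w)) v *
          (\<Prod>i<?n. jweight (labels ?w) (length (symbols ?w)) (v i)) else 0) \<partial>(\<Pi>\<^sub>M i\<in>{..<?n}. lborel))"
    by (rule nn_integral_J[OF W(1) len[folded W(2)] ts, unfolded W(2)])
  \<comment> \<open>The last column is integrated over the box with nodes \<open>ts\<close>. This
    produces the determinant \<open>F\<close> and the missing factors \<open>1 / m i\<close>, so
    that \<open>last ks - 1\<close> becomes \<open>last ks\<close>.\<close>
  also have "\<dots> = (\<integral>\<^sup>+m. nat_chain.pre (\<lambda>x. zweight (ks ! x)) (rev rs) m * (\<Prod>i<?n. zweight (Suc (last ks - 1)) (m i)) *
      ennreal (gvdm (Suc ?n) ((!) ts) (case_nat 0 m)) \<partial>count_space (\<Pi>\<^sub>E i\<in>{..<?n}. UNIV))"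
    by (rule nn_integral_box_expansion) (use pre_bullet_word[OF ks pos wp] nat_chain_pre_increasing[OF wp] ends inc in auto)
  also have "\<dots> = (\<integral>\<^sup>+m. ennreal (zeta_term ks rs ts m) \<partial>count_space (zeta_indices rs))"
    unfolding nn_integral_zeta[OF wp len ts(1,2)] last ..
  finally have eq: "(\<integral>\<^sup>+t. ennreal (?f t) \<partial>J_measure ?w) =
      (\<integral>\<^sup>+m. ennreal (zeta_term ks rs ts m) \<partial>count_space (zeta_indices rs))" .
  have fin: "(\<integral>\<^sup>+m. ennreal (zeta_term ks rs ts m) \<partial>count_space (zeta_indices rs)) < \<infinity>"
    by (rule nn_integral_zeta_finite[OF ks pos wp len ts assms(9)])
  have zeta_nonneg: "AE m in count_space (zeta_indices rs). 0 \<le> zeta_term ks rs ts m"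
    using zeta_term_nonneg(2)[OF wp len ts(1,2)] by (simp add: AE_count_space)
  have f_nonneg: "0 \<le> ?f t" for t
    using J_domain_unit_interval[OF W(1) _ ts, of t] len W(2)
    by (auto simp: J_integrand_def split: split_indicator intro!: prod_nonneg omega_nonneg)
  have f_meas: "?f \<in> borel_measurable (J_measure ?w)"
    using sets_J_domain[OF W(1)] measurable_J_integrand by (intro borel_measurable_times borel_measurable_indicator)
  have "integrable (count_space (zeta_indices rs)) (zeta_term ks rs ts)"
    using fin zeta_nonneg by (intro integrableI_nonneg) auto
  then have abs: "Infinite_Set_Sum.abs_summable_on (zeta_term ks rs ts) (zeta_indices rs)"
    by (simp add: abs_summable_on_def)
  have "zeta_term ks rs ts summable_on zeta_indices rs"
    using abs abs_summable_equivalent abs_summable_summable by blast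
  \<comment> \<open>Integrability is inherited from the series: the two nonnegative integrals are
    equal, and that of the series is finite.\<close>
  moreover have "set_integrable (J_measure ?w) (J_domain ?w ts) (J_integrand ?w)"
    unfolding set_integrable_def real_scaleR_def
    using fin f_nonneg unfolding eq[symmetric] by (intro integrableI_nonneg f_meas) auto
  moreover have "zeta ks rs ts = J ?w ts"
  proof -
    have "zeta ks rs ts = infsetsum (zeta_term ks rs ts) (zeta_indices rs)"
      unfolding zeta_def using abs by (rule infsetsum_infsum[symmetric])
    also have "\<dots> = enn2real (\<integral>\<^sup>+m. ennreal (zeta_term ks rs ts m) \<partial>count_space (zeta_indices rs))"
      unfolding infsetsum_def using zeta_nonneg by (intro integral_eq_nn_integral) auto
    also have "\<dots> = enn2real (\<integral>\<^sup>+t. ennreal (?f t) \<partial>J_measure ?w)"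
      by (simp only: eq)
    also have "\<dots> = J ?w ts"
      unfolding J_def set_lebesgue_integral_def real_scaleR_def
      using f_nonneg by (intro integral_eq_nn_integral[symmetric] f_meas) auto
    finally show ?thesis .
  qed
  ultimately show ?thesis by blast
qed

end
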